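(* $\langle I(\mathbf{N})\rangle$ is the minimum nonzero Bousfield class: for every nonzero object $E$ of $\mathsf{D}(\Lambda)$, we have $\langle E\rangle\ge\langle I(\mathbf{N})\rangle$.
   Context: Fix a countable field $k$ and integers $n_i\ge 2$ for all $i\ge 1$. Let $\Lambda = k[x_1,x_2,x_3,\dots]/(x_i^{n_i}\ \text{for all } i)$, graded by $\deg x_i = 2^i$. All modules are graded; $\mathsf{D}(\Lambda)$ is the unbounded derived category of (cochain complexes of) graded $\Lambda$-modules with degree-preserving maps, and $\otimes^L_\Lambda$ is the derived tensor product. For an object $X$ of $\mathsf{D}(\Lambda)$, its Bousfield class is $\langle X\rangle=\{W\in \mathrm{ob}\,\mathsf{D}(\Lambda) : X\otimes^L_\Lambda W=0\}$. Bousfield classes are ordered by reverse inclusion: $\langle X\rangle\le\langle Y\rangle$ iff $Y\otimes^L_\Lambda W=0$ implies $X\otimes^L_\Lambda W=0$. $\mathbf{N}=\{1,2,3,\dots\}$, and $I(\mathbf{N})=\mathrm{Hom}_k^*(\Lambda,k)$ is the graded $k$-dual of $\Lambda$ (concentrated in non-positive internal degrees), viewed as a $\Lambda$-module and hence as an object of $\mathsf{D}(\Lambda)$. *)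

theory Defs
  imports
    "HOL-Algebra.QuotRing"
    "HOL-Algebra.Module"
    "HOL-Algebra.Free_Abelian_Groups"
    "HOL-Library.Poly_Mapping"
    "HOL-Library.Countable_Set"
begin

section \<open>The truncated polynomial ring\<close>

text \<open>
  Polynomials over \<open>k\<close> in the variables \<open>x\<^sub>1, x\<^sub>2, \<dots>\<close> are finitely supported functions on
  monomials, whose exponents are indexed from 0: position \<open>j\<close> of a monomial holds the exponent of
  \<open>x\<close> with index \<open>j + 1\<close>.
\<close>

type_synonym monomial = "nat \<Rightarrow>\<^sub>0 nat"
type_synonym 'k mpoly = "monomial \<Rightarrow>\<^sub>0 'k"
type_synonym 'k lam = "'k mpoly set"

definition poly_ring :: "'k::field mpoly ring" where
  "poly_ring = \<lparr>carrier = UNIV, monoid.mult = (*), one = 1, ring.zero = 0, add = (+)\<rparr>"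

definition var :: "nat \<Rightarrow> 'k::field mpoly" where
  "var i = Poly_Mapping.single (Poly_Mapping.single (i - 1) 1) 1"

definition rel_ideal :: "(nat \<Rightarrow> nat) \<Rightarrow> 'k::field mpoly set" where
  "rel_ideal n = Idl\<^bsub>poly_ring\<^esub> {var i ^ n i | i. 1 \<le> i}"

definition Lambda :: "(nat \<Rightarrow> nat) \<Rightarrow> 'k::field lam ring" where
  "Lambda n = poly_ring Quot rel_ideal n"

definition mono_deg :: "monomial \<Rightarrow> nat" where
  "mono_deg m = (\<Sum>j\<in>Poly_Mapping.keys m. Poly_Mapping.lookup m j * 2 ^ (j + 1))"

definition Lambda_piece :: "(nat \<Rightarrow> nat) \<Rightarrow> int \<Rightarrow> 'k::field lam set" where
  "Lambda_piece n d =
     {rel_ideal n +>\<^bsub>poly_ring\<^esub> p | p. \<forall>m\<in>Poly_Mapping.keys p. int (mono_deg m) = d}"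

definition Lambda_const :: "(nat \<Rightarrow> nat) \<Rightarrow> 'k::field \<Rightarrow> 'k lam" where
  "Lambda_const n c = rel_ideal n +>\<^bsub>poly_ring\<^esub> Poly_Mapping.single 0 c"


section \<open>Graded modules and complexes\<close>

text \<open>As usual for \<^locale>\<open>module\<close>, the fields \<open>mult\<close> and \<open>one\<close> of the module record are irrelevant.\<close>

record ('l, 'a) gmod = "('l, 'a) Module.module" +
  piece :: "int \<Rightarrow> 'a set"

definition graded_module :: "(nat \<Rightarrow> nat) \<Rightarrow> ('k::field lam, 'a) gmod \<Rightarrow> bool" where
  "graded_module n M \<longleftrightarrow>
     Module.module (Lambda n) M \<and>
     (\<forall>d. subgroup (piece M d) (add_monoid M)) \<and>
     (\<forall>x\<in>carrier M. \<exists>!c. (\<forall>d. c d \<in> piece M d) \<and> finite {d. c d \<noteq> \<zero>\<^bsub>M\<^esub>} \<and>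
                          x = (\<Oplus>\<^bsub>M\<^esub>d\<in>{d. c d \<noteq> \<zero>\<^bsub>M\<^esub>}. c d)) \<and>
     (\<forall>e d. \<forall>l\<in>Lambda_piece n e. \<forall>x\<in>piece M d. l \<odot>\<^bsub>M\<^esub> x \<in> piece M (e + d))"

definition graded_hom ::
  "(nat \<Rightarrow> nat) \<Rightarrow> ('k::field lam, 'a) gmod \<Rightarrow> ('k lam, 'b) gmod \<Rightarrow> ('a \<Rightarrow> 'b) \<Rightarrow> bool" where
  "graded_hom n M N f \<longleftrightarrow>
     f \<in> hom (add_monoid M) (add_monoid N) \<and>
     (\<forall>l\<in>carrier (Lambda n). \<forall>x\<in>carrier M. f (l \<odot>\<^bsub>M\<^esub> x) = l \<odot>\<^bsub>N\<^esub> f x) \<and>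
     (\<forall>d. f ` piece M d \<subseteq> piece N d)"

record ('l, 'a) gcomplex =
  obj :: "int \<Rightarrow> ('l, 'a) gmod"
  bd :: "int \<Rightarrow> 'a \<Rightarrow> 'a"

definition is_complex :: "(nat \<Rightarrow> nat) \<Rightarrow> ('k::field lam, 'a) gcomplex \<Rightarrow> bool" where
  "is_complex n X \<longleftrightarrow>
     (\<forall>i. graded_module n (obj X i)) \<and>
     (\<forall>i. graded_hom n (obj X i) (obj X (i + 1)) (bd X i)) \<and>
     (\<forall>i. \<forall>x\<in>carrier (obj X i). bd X (i + 1) (bd X i x) = \<zero>\<^bsub>obj X (i + 2)\<^esub>)"

definition cocycles :: "('l, 'a) gcomplex \<Rightarrow> int \<Rightarrow> 'a set" where
  "cocycles X i = {x \<in> carrier (obj X i). bd X i x = \<zero>\<^bsub>obj X (i + 1)\<^esub>}"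

definition coboundaries :: "('l, 'a) gcomplex \<Rightarrow> int \<Rightarrow> 'a set" where
  "coboundaries X i = bd X (i - 1) ` carrier (obj X (i - 1))"

definition chain_map ::
  "(nat \<Rightarrow> nat) \<Rightarrow> ('k::field lam, 'a) gcomplex \<Rightarrow> ('k lam, 'b) gcomplex \<Rightarrow> (int \<Rightarrow> 'a \<Rightarrow> 'b) \<Rightarrow> bool"
where
  "chain_map n X Y f \<longleftrightarrow>
     (\<forall>i. graded_hom n (obj X i) (obj Y i) (f i)) \<and>
     (\<forall>i. \<forall>x\<in>carrier (obj X i). f (i + 1) (bd X i x) = bd Y i (f i x))"

text \<open>The two clauses after \<open>chain_map\<close> are injectivity and surjectivity on cohomology.\<close>

definition quasi_iso ::
  "(nat \<Rightarrow> nat) \<Rightarrow> ('k::field lam, 'a) gcomplex \<Rightarrow> ('k lam, 'b) gcomplex \<Rightarrow> (int \<Rightarrow> 'a \<Rightarrow> 'b) \<Rightarrow> bool"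
where
  "quasi_iso n X Y f \<longleftrightarrow> chain_map n X Y f \<and>
     (\<forall>i. \<forall>x\<in>cocycles X i. f i x \<in> coboundaries Y i \<longrightarrow> x \<in> coboundaries X i) \<and>
     (\<forall>i. \<forall>y\<in>cocycles Y i. \<exists>x\<in>cocycles X i. y \<ominus>\<^bsub>obj Y i\<^esub> f i x \<in> coboundaries Y i)"

definition zero_gmod :: "('l, unit) gmod" where
  "zero_gmod = \<lparr>carrier = {()}, monoid.mult = (\<lambda>_ _. ()), one = (), ring.zero = (), add = (\<lambda>_ _. ()),
                smult = (\<lambda>_ _. ()), piece = (\<lambda>_. {()})\<rparr>"

definition zero_complex :: "('l, unit) gcomplex" where
  "zero_complex = \<lparr>obj = (\<lambda>_. zero_gmod), bd = (\<lambda>_ _. ())\<rparr>"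

text \<open>
  Objects of the derived category are complexes, and inverting the quasi-isomorphisms makes \<open>X\<close> a
  zero object exactly when the unique chain map from \<open>X\<close> to the zero complex is a
  quasi-isomorphism.
\<close>

definition zero_in_D :: "(nat \<Rightarrow> nat) \<Rightarrow> ('k::field lam, 'a) gcomplex \<Rightarrow> bool" where
  "zero_in_D n X \<longleftrightarrow> quasi_iso n X zero_complex (\<lambda>_ _. ())"


section \<open>Tensor product of complexes\<close>

text \<open>
  The \<open>m\<close>-th term of the tensor product is the direct sum over all \<open>p\<close> of the tensor products over
  \<open>\<Lambda>\<close> of \<open>X\<^sup>p\<close> and \<open>Y\<^sup>m\<^sup>-\<^sup>p\<close>. It is presented at once as an abelian group, with one generator
  \<open>(p, x, y)\<close> for each elementary tensor in the \<open>p\<close>-th summand.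
\<close>

type_synonym ('a, 'b) formal_tensor = "(int \<times> 'a \<times> 'b) \<Rightarrow>\<^sub>0 int"

definition tensor_symbols ::
  "('l, 'a) gcomplex \<Rightarrow> ('l, 'b) gcomplex \<Rightarrow> int \<Rightarrow> (int \<times> 'a \<times> 'b) set" where
  "tensor_symbols X Y m =
     {(p, x, y) | p x y. x \<in> carrier (obj X p) \<and> y \<in> carrier (obj Y (m - p))}"

definition tensor_relators ::
  "(nat \<Rightarrow> nat) \<Rightarrow> ('k::field lam, 'a) gcomplex \<Rightarrow> ('k lam, 'b) gcomplex \<Rightarrow> int
    \<Rightarrow> ('a, 'b) formal_tensor set" where
  "tensor_relators n X Y m =
     {frag_of (p, x \<oplus>\<^bsub>obj X p\<^esub> x', y) - frag_of (p, x, y) - frag_of (p, x', y) | p x x' y.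
        x \<in> carrier (obj X p) \<and> x' \<in> carrier (obj X p) \<and> y \<in> carrier (obj Y (m - p))} \<union>
     {frag_of (p, x, y \<oplus>\<^bsub>obj Y (m - p)\<^esub> y') - frag_of (p, x, y) - frag_of (p, x, y') | p x y y'.
        x \<in> carrier (obj X p) \<and> y \<in> carrier (obj Y (m - p)) \<and> y' \<in> carrier (obj Y (m - p))} \<union>
     {frag_of (p, l \<odot>\<^bsub>obj X p\<^esub> x, y) - frag_of (p, x, l \<odot>\<^bsub>obj Y (m - p)\<^esub> y) | p l x y.
        l \<in> carrier (Lambda n) \<and> x \<in> carrier (obj X p) \<and> y \<in> carrier (obj Y (m - p))}"

definition tensor_kernel ::
  "(nat \<Rightarrow> nat) \<Rightarrow> ('k::field lam, 'a) gcomplex \<Rightarrow> ('k lam, 'b) gcomplex \<Rightarrow> int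
    \<Rightarrow> ('a, 'b) formal_tensor set" where
  "tensor_kernel n X Y m =
     generate (free_Abelian_group (tensor_symbols X Y m)) (tensor_relators n X Y m)"

definition tensor_class ::
  "(nat \<Rightarrow> nat) \<Rightarrow> ('k::field lam, 'a) gcomplex \<Rightarrow> ('k lam, 'b) gcomplex \<Rightarrow> int
    \<Rightarrow> ('a, 'b) formal_tensor \<Rightarrow> ('a, 'b) formal_tensor set" where
  "tensor_class n X Y m z =
     tensor_kernel n X Y m #>\<^bsub>free_Abelian_group (tensor_symbols X Y m)\<^esub> z"

definition tensor_group ::
  "(nat \<Rightarrow> nat) \<Rightarrow> ('k::field lam, 'a) gcomplex \<Rightarrow> ('k lam, 'b) gcomplex \<Rightarrow> int
    \<Rightarrow> ('a, 'b) formal_tensor set monoid" where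
  "tensor_group n X Y m =
     free_Abelian_group (tensor_symbols X Y m) Mod tensor_kernel n X Y m"

text \<open>
  A map given on formal tensors is applied to a coset by taking the union of the cosets of the
  images of its elements; these cosets coincide whenever the map respects the relators.
\<close>

definition tensor_obj ::
  "(nat \<Rightarrow> nat) \<Rightarrow> ('k::field lam, 'a) gcomplex \<Rightarrow> ('k lam, 'b) gcomplex \<Rightarrow> int
    \<Rightarrow> ('k lam, ('a, 'b) formal_tensor set) gmod" where
  "tensor_obj n X Y m =
     \<lparr>carrier = carrier (tensor_group n X Y m),
      monoid.mult = undefined, one = undefined,
      ring.zero = \<one>\<^bsub>tensor_group n X Y m\<^esub>,
      add = (\<otimes>\<^bsub>tensor_group n X Y m\<^esub>),
      smult = (\<lambda>l A. \<Union>z\<in>A. tensor_class n X Y m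
                 (frag_extend (\<lambda>(p, x, y). frag_of (p, l \<odot>\<^bsub>obj X p\<^esub> x, y)) z)),
      piece = (\<lambda>d. generate (tensor_group n X Y m)
                 {tensor_class n X Y m (frag_of (p, x, y)) | p x y i j.
                    x \<in> piece (obj X p) i \<and> y \<in> piece (obj Y (m - p)) j \<and> i + j = d})\<rparr>"

definition tensor_bd ::
  "(nat \<Rightarrow> nat) \<Rightarrow> ('k::field lam, 'a) gcomplex \<Rightarrow> ('k lam, 'b) gcomplex \<Rightarrow> int
    \<Rightarrow> ('a, 'b) formal_tensor set \<Rightarrow> ('a, 'b) formal_tensor set" where
  "tensor_bd n X Y m A =
     (\<Union>z\<in>A. tensor_class n X Y (m + 1)
        (frag_extend (\<lambda>(p, x, y).
           frag_of (p + 1, bd X p x, y) +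
           frag_cmul (if even p then 1 else - 1) (frag_of (p, x, bd Y (m - p) y))) z))"

definition tensor_complex ::
  "(nat \<Rightarrow> nat) \<Rightarrow> ('k::field lam, 'a) gcomplex \<Rightarrow> ('k lam, 'b) gcomplex
    \<Rightarrow> ('k lam, ('a, 'b) formal_tensor set) gcomplex" where
  "tensor_complex n X Y = \<lparr>obj = tensor_obj n X Y, bd = tensor_bd n X Y\<rparr>"


section \<open>Derived tensor product and Bousfield classes\<close>

definition lin_span :: "(nat \<Rightarrow> nat) \<Rightarrow> ('k::field lam, 'a) gmod \<Rightarrow> 'a set \<Rightarrow> 'a set" where
  "lin_span n M S =
     {\<Oplus>\<^bsub>M\<^esub>b\<in>A. c b \<odot>\<^bsub>M\<^esub> b | A c. finite A \<and> A \<subseteq> S \<and> c \<in> A \<rightarrow> carrier (Lambda n)}"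

definition lin_indep :: "(nat \<Rightarrow> nat) \<Rightarrow> ('k::field lam, 'a) gmod \<Rightarrow> 'a set \<Rightarrow> bool" where
  "lin_indep n M S \<longleftrightarrow>
     (\<forall>A c. finite A \<and> A \<subseteq> S \<and> c \<in> A \<rightarrow> carrier (Lambda n) \<and>
            (\<Oplus>\<^bsub>M\<^esub>b\<in>A. c b \<odot>\<^bsub>M\<^esub> b) = \<zero>\<^bsub>M\<^esub> \<longrightarrow> (\<forall>b\<in>A. c b = \<zero>\<^bsub>Lambda n\<^esub>))"

text \<open>
  A complex is semifree if its terms have homogeneous bases \<open>B i\<close> which admit an exhaustive
  filtration (by \<open>\<rho>\<close>, with values in the natural numbers) such that the differential of a basis
  element is a combination of basis elements of strictly smaller filtration. Semifree complexes are
  K-projective, hence K-flat, so they compute derived tensor products of unbounded complexes.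
\<close>

definition semifree :: "(nat \<Rightarrow> nat) \<Rightarrow> ('k::field lam, 'a) gcomplex \<Rightarrow> bool" where
  "semifree n P \<longleftrightarrow> is_complex n P \<and>
     (\<exists>(B :: int \<Rightarrow> 'a set) (\<rho> :: int \<Rightarrow> 'a \<Rightarrow> nat). \<forall>i.
        B i \<subseteq> (\<Union>d. piece (obj P i) d) \<and>
        lin_span n (obj P i) (B i) = carrier (obj P i) \<and>
        lin_indep n (obj P i) (B i) \<and>
        (\<forall>b\<in>B i. bd P i b \<in> lin_span n (obj P (i + 1)) {b' \<in> B (i + 1). \<rho> (i + 1) b' < \<rho> i b}))"

definition semifree_resolution ::
  "(nat \<Rightarrow> nat) \<Rightarrow> ('k::field lam, 'a) gcomplex \<Rightarrow> ('k lam, 'b) gcomplex \<Rightarrow> bool" where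
  "semifree_resolution n W P \<longleftrightarrow> semifree n P \<and> (\<exists>f. quasi_iso n P W f)"

text \<open>
  \<open>is_derived_tensor n X W T\<close> says that \<open>T\<close> is the derived tensor product of \<open>X\<close> and \<open>W\<close> computed by
  some semifree resolution \<open>P\<close> of \<open>W\<close>; up to isomorphism in the derived category, \<open>T\<close> does not
  depend on \<open>P\<close>. The elements of \<open>P\<close> are taken in a fixed type, which is always large enough: the
  bar resolution of \<open>W\<close> over \<open>k\<close> has a basis of symbols \<open>[m\<^sub>1|\<dots>|m\<^sub>s]w\<close>, with \<open>w\<close> in a homogeneous
  \<open>k\<close>-basis of \<open>W\<close> and the \<open>m\<^sub>j\<close> nontrivial monomials, so its elements are finitely supported
  functions from such symbols to \<open>\<Lambda>\<close>. It is semifree when the basis of \<open>W\<close> is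
  chosen so that the differential maps each basis element to a basis element or to zero.
\<close>

definition is_derived_tensor ::
  "(nat \<Rightarrow> nat) \<Rightarrow> ('k::field lam, 'a) gcomplex \<Rightarrow> ('k lam, 'b) gcomplex
    \<Rightarrow> ('k lam, ('a, monomial list \<times> 'b \<Rightarrow> 'k lam) formal_tensor set) gcomplex \<Rightarrow> bool" where
  "is_derived_tensor n X W T \<longleftrightarrow>
     (\<exists>P. semifree_resolution n W P \<and> T = tensor_complex n X P)"

text \<open>
  A Bousfield class is a proper class; its members with elements in the type \<open>'b\<close> form a set. Hence
  \<open>\<langle>X\<rangle> \<le> \<langle>Y\<rangle>\<close> means \<open>bousfield_class n Y \<subseteq> bousfield_class n X\<close> at every type \<open>'b\<close>, and
  \<open>\<langle>X\<rangle> = \<langle>Y\<rangle>\<close> means equality at every type.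
\<close>

definition bousfield_class ::
  "(nat \<Rightarrow> nat) \<Rightarrow> ('k::field lam, 'a) gcomplex \<Rightarrow> ('k lam, 'b) gcomplex set" where
  "bousfield_class n X =
     {W. is_complex n W \<and> (\<exists>T. is_derived_tensor n X W T \<and> zero_in_D n T)}"


section \<open>The graded dual\<close>

text \<open>
  An element is a \<open>k\<close>-linear functional on \<open>\<Lambda>\<close> vanishing on almost all homogeneous pieces, i.e. a
  finite sum of functionals on the single pieces; functionals on the piece of degree \<open>e\<close> have degree
  \<open>-e\<close>.
\<close>

definition dual_carrier :: "(nat \<Rightarrow> nat) \<Rightarrow> ('k::field lam \<Rightarrow> 'k) set" where
  "dual_carrier n =
     {f \<in> extensional (carrier (Lambda n)).
        (\<forall>a\<in>carrier (Lambda n). \<forall>b\<in>carrier (Lambda n). f (a \<oplus>\<^bsub>Lambda n\<^esub> b) = f a + f b) \<and>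
        (\<forall>c. \<forall>a\<in>carrier (Lambda n). f (Lambda_const n c \<otimes>\<^bsub>Lambda n\<^esub> a) = c * f a) \<and>
        finite {e. \<exists>a\<in>Lambda_piece n e. f a \<noteq> 0}}"

definition dual_gmod :: "(nat \<Rightarrow> nat) \<Rightarrow> ('k::field lam, 'k lam \<Rightarrow> 'k) gmod" where
  "dual_gmod n =
     \<lparr>carrier = dual_carrier n,
      monoid.mult = undefined, one = undefined,
      ring.zero = (\<lambda>a\<in>carrier (Lambda n). 0),
      add = (\<lambda>f g. \<lambda>a\<in>carrier (Lambda n). f a + g a),
      smult = (\<lambda>l f. \<lambda>a\<in>carrier (Lambda n). f (l \<otimes>\<^bsub>Lambda n\<^esub> a)),
      piece = (\<lambda>d. {f \<in> dual_carrier n. \<forall>e. e \<noteq> - d \<longrightarrow> (\<forall>a\<in>Lambda_piece n e. f a = 0)})\<rparr>"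

definition stalk_complex :: "('l, 'a) gmod \<Rightarrow> ('l, 'a) gcomplex" where
  "stalk_complex M =
     \<lparr>obj = (\<lambda>i. if i = 0 then M else M\<lparr>carrier := {\<zero>\<^bsub>M\<^esub>}, piece := (\<lambda>_. {\<zero>\<^bsub>M\<^esub>})\<rparr>),
      bd = (\<lambda>_ _. \<zero>\<^bsub>M\<^esub>)\<rparr>"

definition dual_complex :: "(nat \<Rightarrow> nat) \<Rightarrow> ('k::field lam, 'k lam \<Rightarrow> 'k) gcomplex" where
  "dual_complex n = stalk_complex (dual_gmod n)"

end

theory Submission
  imports Defs "HOL.Modules" "HOL-Computational_Algebra.Group_Closure"
begin

text \<open>
  Let \<open>I\<close> be the graded dual and suppose that \<open>E \<otimes> P\<close> is acyclic, where \<open>P\<close> is a semifree resolution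
  of \<open>W\<close> and \<open>E\<close> is not acyclic. The same \<open>P\<close> shows that \<open>W\<close> is annihilated by \<open>I\<close>
  (\<open>zero_dual_tensor_if_zero_tensor\<close>), for three reasons.

  First, \<open>\<Lambda>\<close> is free over the subring generated by all variables but one, and it carries a Frobenius
  form over it, the coefficient of the top power of that variable. Over the smaller ring the tensor
  product \<open>N\<close> has two actions of the variable. Their difference \<open>t\<close> is nilpotent, its cokernel is the
  tensor product over the larger ring, and the Frobenius form identifies its kernel with the
  cokernel. If the cokernel is acyclic then \<open>t\<close> is bijective and nilpotent on the cohomology of \<open>N\<close>,
  which therefore vanishes. Repeating this, the tensor product of \<open>E\<close> and \<open>P\<close> over the subring on
  \<open>x\<^sub>i\<close>, \<open>i > M\<close>, is acyclic for every \<open>M\<close> (\<open>acyclic_mod_tail\<close>).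

  Second, \<open>I\<close> is the union of cyclic modules, generated by the functionals that read off the
  coefficient of the top monomial in the first \<open>M\<close> variables. Since \<open>P\<close> is free, this makes \<open>I\<close> flat
  against \<open>P\<close> in a concrete sense: if \<open>I \<otimes> P\<close> has cohomology then there are \<open>M\<close> and a cocycle \<open>p\<close> of
  \<open>P\<close> whose product with the top monomial in \<open>x\<^sub>M\<^sub>+\<^sub>1, \<dots>, x\<^sub>M\<^sub>'\<close> is not a coboundary, for any
  \<open>M' \<ge> M\<close> (\<open>acyclic_dual_tensor\<close>).

  Third, such a \<open>p\<close> and a class \<open>y \<noteq> 0\<close> of \<open>E\<close> have a nonzero product \<open>y \<otimes> p\<close> over the subring on
  \<open>x\<^sub>i\<close>, \<open>i > M\<close>, which contradicts the first step. A relation that makes \<open>y \<otimes> p\<close> bound involves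
  finitely many variables. These are eliminated one at a time, each replacing \<open>p\<close> by its product with
  the top power of the variable and \<open>y\<close> by a nonzero multiple, until only the base field is left,
  where linear functionals separate (\<open>socle_coboundary_if_tensor_boundary\<close>).

  Finally \<open>I\<close> is itself nonzero, because \<open>I \<otimes> \<Lambda>\<close> has cohomology (\<open>nonzero_dual_tensor_Lambda\<close>).

  Tensor products are handled as formal tensors modulo subgroups of relations, so that changing the
  ground ring only changes the subgroup and all operators act on one type.
\<close>

abbreviation lookup :: "('a \<Rightarrow>\<^sub>0 'b::zero) \<Rightarrow> 'a \<Rightarrow> 'b" where "lookup \<equiv> Poly_Mapping.lookup"
abbreviation single :: "'a \<Rightarrow> 'b \<Rightarrow> ('a \<Rightarrow>\<^sub>0 'b::zero)" where "single \<equiv> Poly_Mapping.single"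
abbreviation keys :: "('a \<Rightarrow>\<^sub>0 'b::zero) \<Rightarrow> 'a set" where "keys \<equiv> Poly_Mapping.keys"

section \<open>The truncated polynomial ring\<close>

lemma poly_mapping_sum_single: "p = (\<Sum>m\<in>keys p. single m (lookup p m))"
proof (rule poly_mapping_eqI)
  fix k
  have "lookup (\<Sum>m\<in>keys p. single m (lookup p m)) k
      = (\<Sum>m\<in>keys p. if k = m then lookup p k else 0)"
    unfolding lookup_sum by (intro sum.cong) (auto simp: lookup_single)
  then show "lookup p k = lookup (\<Sum>m\<in>keys p. single m (lookup p m)) k"
    by (simp add: in_keys_iff)
qed

lemma mpoly_induct [case_names zero single add]:
  assumes "P 0" "\<And>m c. P (single m c)" "\<And>p q. P p \<Longrightarrow> P q \<Longrightarrow> P (p + q)"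
  shows "P (p :: 'a \<Rightarrow>\<^sub>0 'b::comm_monoid_add)"
proof -
  have "P (\<Sum>m\<in>A. single m (lookup p m))" if "finite A" for A
    using that by induction (auto intro: assms)
  then show ?thesis
    using poly_mapping_sum_single[of p] by (metis finite_keys)
qed

lemma lookup_mult_single_add:
  fixes p :: "'k::field mpoly"
  shows "lookup (p * single \<nu> c) (\<kappa> + \<nu>) = lookup p \<kappa> * c"
  by (induction p rule: mpoly_induct)
    (auto simp: mult_single lookup_single lookup_add distrib_right when_def)

lemma lookup_mult_single_zero:
  fixes p :: "'k::field mpoly"
  assumes "\<And>\<kappa>. \<tau> \<noteq> \<kappa> + \<nu>"
  shows "lookup (p * single \<nu> c) \<tau> = 0"
  using assms by (induction p rule: mpoly_induct)
    (auto simp: mult_single lookup_single lookup_add distrib_right when_def)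

definition reduced :: "(nat \<Rightarrow> nat) \<Rightarrow> monomial \<Rightarrow> bool" where
  "reduced n m \<longleftrightarrow> (\<forall>j. lookup m j < n (Suc j))"

lemma poly_ring_simps [simp]:
  "carrier poly_ring = UNIV" "x \<otimes>\<^bsub>poly_ring\<^esub> y = x * y" "\<one>\<^bsub>poly_ring\<^esub> = 1"
  "\<zero>\<^bsub>poly_ring\<^esub> = 0" "x \<oplus>\<^bsub>poly_ring\<^esub> y = x + y"
  by (simp_all add: poly_ring_def)

lemma cring_poly_ring: "cring (poly_ring :: 'k::field mpoly ring)"
proof (rule cringI)
  show "abelian_group (poly_ring :: 'k mpoly ring)"
  proof (rule abelian_groupI; simp add: algebra_simps)
    fix x :: "'k mpoly"
    show "\<exists>y. x + y = 0" by (rule exI[of _ "-x"]) simp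
  qed
  show "Group.comm_monoid (poly_ring :: 'k mpoly ring)"
    by (rule comm_monoidI) (simp_all add: algebra_simps)
qed (simp add: algebra_simps)

lemma minus_poly_ring [simp]: "\<ominus>\<^bsub>poly_ring\<^esub> x = - (x :: 'k::field mpoly)"
proof -
  interpret cring "poly_ring :: 'k mpoly ring" by (rule cring_poly_ring)
  show ?thesis by (rule minus_equality) simp_all
qed

definition nonreduced_span :: "(nat \<Rightarrow> nat) \<Rightarrow> 'k::field mpoly set" where
  "nonreduced_span n = {p. \<forall>m\<in>keys p. \<not> reduced n m}"

lemma nonreduced_span_iff: "p \<in> nonreduced_span n \<longleftrightarrow> (\<forall>m. reduced n m \<longrightarrow> lookup p m = 0)"
  by (auto simp: nonreduced_span_def in_keys_iff)

lemma nonreduced_span_add: "p \<in> nonreduced_span n \<Longrightarrow> q \<in> nonreduced_span n \<Longrightarrow> p + q \<in> nonreduced_span n"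
  by (simp add: nonreduced_span_iff lookup_add)

lemma reduced_add: "reduced n (a + b) \<Longrightarrow> reduced n b"
  unfolding reduced_def lookup_add by (metis add_lessD1 add.commute)

lemma ideal_nonreduced_span: "ideal (nonreduced_span n) (poly_ring :: 'k::field mpoly ring)"
proof -
  interpret cring "poly_ring :: 'k mpoly ring" by (rule cring_poly_ring)
  have mult: "q * p \<in> nonreduced_span n" if "p \<in> nonreduced_span n" for p q :: "'k mpoly"
    using that keys_mult[of q p] reduced_add unfolding nonreduced_span_def by blast
  have mult': "p * q \<in> nonreduced_span n" if "p \<in> nonreduced_span n" for p q :: "'k mpoly"
    using mult[OF that, of q] by (simp add: mult.commute)
  have zero: "0 \<in> (nonreduced_span n :: 'k mpoly set)"
    by (simp add: nonreduced_span_iff)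
  note inv = minus_poly_ring[unfolded a_inv_def, simplified]
  show ?thesis
  proof (rule idealI)
    show "ring (poly_ring :: 'k mpoly ring)" by (rule ring_axioms)
    show "subgroup (nonreduced_span n) (add_monoid (poly_ring :: 'k mpoly ring))"
      by (rule group.subgroupI[OF a_group])
        (use zero in \<open>(fastforce simp: nonreduced_span_iff lookup_add inv)+\<close>)
  qed (simp_all add: mult mult')
qed

lemma var_power: "var i ^ k = single (single (i - 1) k) (1 :: 'k::field)"
  by (induction k) (auto simp: var_def mult_single simp flip: single_add)

lemma monomial_split:
  assumes "k \<le> lookup m j"
  shows "(m :: monomial) = (m - single j k) + single j k"
  using assms by (intro poly_mapping_eqI) (auto simp: lookup_add lookup_minus lookup_single when_def)

text \<open>
  The relations are powers of variables, so the ideal is spanned by monomials, and the coefficients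
  at reduced monomials are coordinates on the quotient.
\<close>

lemma rel_ideal_eq: "rel_ideal n = (nonreduced_span n :: 'k::field mpoly set)"
proof -
  interpret cring "poly_ring :: 'k mpoly ring" by (rule cring_poly_ring)
  let ?G = "{var i ^ n i | i. 1 \<le> i} :: 'k mpoly set"
  have gens: "?G \<subseteq> nonreduced_span n"
  proof
    fix p assume "p \<in> ?G"
    then obtain i where i: "1 \<le> i" "p = var i ^ n i" by blast
    have "\<not> reduced n (single (i - 1) (n i))"
      unfolding reduced_def using i by (auto intro!: exI[of _ "i - 1"])
    then show "p \<in> nonreduced_span n"
      by (auto simp: i var_power nonreduced_span_def)
  qed
  have id: "ideal (Idl\<^bsub>poly_ring\<^esub> ?G) poly_ring"
    by (rule genideal_ideal) simp
  show ?thesis unfolding rel_ideal_def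
  proof
    show "Idl\<^bsub>poly_ring\<^esub> ?G \<subseteq> nonreduced_span n"
      using gens by (rule genideal_minimal[OF ideal_nonreduced_span])
    show "nonreduced_span n \<subseteq> Idl\<^bsub>poly_ring\<^esub> ?G"
    proof
      fix p :: "'k mpoly" assume p: "p \<in> nonreduced_span n"
      have single: "single m c \<in> Idl\<^bsub>poly_ring\<^esub> ?G" if m: "\<not> reduced n m" for m and c :: 'k
      proof -
        obtain j where j: "n (Suc j) \<le> lookup m j"
          using m unfolding reduced_def by (meson not_less)
        have "var (Suc j) ^ n (Suc j) \<in> Idl\<^bsub>poly_ring\<^esub> ?G"
          using genideal_self[of ?G] by force
        from ideal.I_l_closed[OF id this, of "single (m - single j (n (Suc j))) c"]
        show ?thesis
          using monomial_split[OF j] by (simp add: var_power mult_single)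
      qed
      have add: "a + b \<in> Idl\<^bsub>poly_ring\<^esub> ?G" if "a \<in> Idl\<^bsub>poly_ring\<^esub> ?G" "b \<in> Idl\<^bsub>poly_ring\<^esub> ?G" for a b
        using additive_subgroup.a_closed[OF ideal.axioms(1)[OF id] that] by simp
      have zero: "0 \<in> Idl\<^bsub>poly_ring\<^esub> ?G"
        using additive_subgroup.zero_closed[OF ideal.axioms(1)[OF id]] by simp
      have "(\<Sum>m\<in>A. single m (lookup p m)) \<in> Idl\<^bsub>poly_ring\<^esub> ?G"
        if "finite A" "A \<subseteq> keys p" for A
        using that
      proof (induction rule: finite_induct)
        case (insert m A)
        then show ?case
          using p unfolding nonreduced_span_def sum.insert[OF insert.hyps] by (intro add single) auto
      qed (use zero in \<open>simp only: sum.empty\<close>)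
      from this[of "keys p"] show "p \<in> Idl\<^bsub>poly_ring\<^esub> ?G"
        by (simp flip: poly_mapping_sum_single)
    qed
  qed
qed

lemma ideal_rel_ideal: "ideal (rel_ideal n) (poly_ring :: 'k::field mpoly ring)"
  unfolding rel_ideal_eq by (rule ideal_nonreduced_span)

lemma cring_Lambda: "cring (Lambda n :: 'k::field lam ring)"
  unfolding Lambda_def by (rule ideal.quotient_is_cring[OF ideal_rel_ideal cring_poly_ring])

definition cls :: "(nat \<Rightarrow> nat) \<Rightarrow> 'k::field mpoly \<Rightarrow> 'k lam" where
  "cls n p = rel_ideal n +>\<^bsub>poly_ring\<^esub> p"

lemma Lambda_const_eq: "Lambda_const n c = cls n (single 0 c)"
  by (simp add: Lambda_const_def cls_def)

lemma Lambda_piece_eq: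
  "Lambda_piece n d = {cls n p | p. \<forall>m\<in>keys p. int (mono_deg m) = d}"
  by (simp add: Lambda_piece_def cls_def)

lemma cls_ring_hom: "cls n \<in> ring_hom poly_ring (Lambda n :: 'k::field lam ring)"
  unfolding Lambda_def using ideal.rcos_ring_hom[OF ideal_rel_ideal, of n]
  by (simp add: cls_def[abs_def])

lemma carrier_Lambda: "carrier (Lambda n) = range (cls n :: 'k::field mpoly \<Rightarrow> 'k lam)"
  by (auto simp: Lambda_def FactRing_def A_RCOSETS_def' cls_def)

lemma cls_closed [simp]: "cls n p \<in> carrier (Lambda n)"
  by (simp add: carrier_Lambda)

lemma cls_add: "cls n p \<oplus>\<^bsub>Lambda n\<^esub> cls n q = cls n (p + q)"
  using ring_hom_add[OF cls_ring_hom, of p q n] by simp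

lemma cls_mult: "cls n p \<otimes>\<^bsub>Lambda n\<^esub> cls n q = cls n (p * q)"
  using ring_hom_mult[OF cls_ring_hom, of p q n] by simp

lemma one_Lambda: "\<one>\<^bsub>Lambda n\<^esub> = cls n 1"
  using ring_hom_one[OF cls_ring_hom, of n, symmetric] by simp

lemma zero_Lambda: "\<zero>\<^bsub>Lambda n\<^esub> = cls n (0 :: 'k::field mpoly)"
  using ring_hom_zero[OF cls_ring_hom cring.axioms(1)[OF cring_poly_ring] cring.axioms(1)[OF cring_Lambda], of n, symmetric]
  by simp

lemma cls_eq_iff:
  "cls n p = cls n q \<longleftrightarrow> (\<forall>\<mu>. reduced n \<mu> \<longrightarrow> lookup p \<mu> = lookup (q :: 'k::field mpoly) \<mu>)"
proof -
  interpret ideal "rel_ideal n" "poly_ring :: 'k mpoly ring" by (rule ideal_rel_ideal)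
  have "cls n p = cls n q \<longleftrightarrow> p - q \<in> rel_ideal n"
  proof -
    have "p \<ominus>\<^bsub>poly_ring\<^esub> q = p - q" by (simp add: a_minus_def)
    then show ?thesis
      unfolding cls_def using quotient_eq_iff_same_a_r_cos[OF ideal_rel_ideal, of p q n] by simp
  qed
  then show ?thesis
    by (simp add: rel_ideal_eq nonreduced_span_iff lookup_minus)
qed


lemma Lambda_cases:
  assumes "l \<in> carrier (Lambda n)" obtains p where "l = cls n p"
  using assms by (auto simp: carrier_Lambda)

text \<open>Only at reduced monomials is the value independent of the representative.\<close>

definition coef :: "(nat \<Rightarrow> nat) \<Rightarrow> 'k::field lam \<Rightarrow> monomial \<Rightarrow> 'k" where
  "coef n l \<mu> = lookup (SOME p. l = cls n p) \<mu>"

lemma coef_cls [simp]: "reduced n \<mu> \<Longrightarrow> coef n (cls n p) \<mu> = lookup p \<mu>"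
  unfolding coef_def using someI[of "\<lambda>q. cls n p = cls n q" p] by (auto simp: cls_eq_iff)

lemma coef_add:
  "reduced n \<mu> \<Longrightarrow> l \<in> carrier (Lambda n) \<Longrightarrow> l' \<in> carrier (Lambda n) \<Longrightarrow>
    coef n (l \<oplus>\<^bsub>Lambda n\<^esub> l') \<mu> = coef n l \<mu> + coef n l' \<mu>"
  by (auto elim!: Lambda_cases simp: cls_add lookup_add)

lemma cls_single_zero: "\<not> reduced n \<mu> \<Longrightarrow> cls n (single \<mu> c) = \<zero>\<^bsub>Lambda n\<^esub>"
  by (auto simp: zero_Lambda cls_eq_iff lookup_single when_def)

definition xvar :: "(nat \<Rightarrow> nat) \<Rightarrow> nat \<Rightarrow> 'k::field lam" where
  "xvar n i = cls n (var i)"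

lemma xvar_closed [simp]: "xvar n i \<in> carrier (Lambda n)"
  by (simp add: xvar_def)

lemma Lambda_const_closed [simp]: "Lambda_const n c \<in> carrier (Lambda n)"
  by (simp add: Lambda_const_eq)

lemma xvar_pow: "(xvar n i :: 'k::field lam) [^]\<^bsub>Lambda n\<^esub> (k::nat) = cls n (var i ^ k)"
proof -
  interpret cring "Lambda n :: 'k lam ring" by (rule cring_Lambda)
  show ?thesis
    by (induction k) (simp_all add: one_Lambda cls_mult xvar_def mult.commute)
qed

lemma xvar_pow_zero: "1 \<le> i \<Longrightarrow> n i \<le> k \<Longrightarrow> xvar n i [^]\<^bsub>Lambda n\<^esub> (k::nat) = \<zero>\<^bsub>Lambda n\<^esub>"
  unfolding xvar_pow var_power
  by (rule cls_single_zero) (auto simp: reduced_def not_less intro!: exI[of _ "i - 1"])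

lemma Lambda_induct [consumes 1, case_names const var add mult]:
  assumes l: "(l :: 'k::field lam) \<in> carrier (Lambda n)"
    and const: "\<And>c. P (Lambda_const n c)" and var: "\<And>i. 1 \<le> i \<Longrightarrow> P (xvar n i)"
    and add: "\<And>l l'. \<lbrakk>l \<in> carrier (Lambda n); l' \<in> carrier (Lambda n); P l; P l'\<rbrakk> \<Longrightarrow> P (l \<oplus>\<^bsub>Lambda n\<^esub> l')"
    and mult: "\<And>l l'. \<lbrakk>l \<in> carrier (Lambda n); l' \<in> carrier (Lambda n); P l; P l'\<rbrakk> \<Longrightarrow> P (l \<otimes>\<^bsub>Lambda n\<^esub> l')"
  shows "P l"
proof -
  have cadd: "P (cls n (p + q))" if "P (cls n p)" "P (cls n q)" for p q
    using add[OF _ _ that] by (simp add: cls_add)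
  have cmult: "P (cls n (p * q))" if "P (cls n p)" "P (cls n q)" for p q
    using mult[OF _ _ that] by (simp add: cls_mult)
  have c: "P (cls n (single 0 c))" for c
    using const[of c] by (simp add: Lambda_const_eq)
  have one: "P (cls n 1)"
    using c[of 1] by simp
  have pw: "P (cls n (single (single j k) 1))" for j k
  proof (induction k)
    case 0
    then show ?case using one by simp
  next
    case (Suc k)
    have "P (cls n (single (single j k) 1 * var (Suc j)))"
      using Suc var[of "Suc j"] unfolding xvar_def by (intro cmult) auto
    then show ?case by (simp add: var_def mult_single flip: single_add)
  qed
  have mono: "P (cls n (single m 1))" for m
  proof (induction m rule: mpoly_induct)
    case (add p q)
    then show ?case using cmult[OF add] by (simp add: mult_single)
  qed (use pw one in auto)
  have "P (cls n p)" for p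
  proof (induction p rule: mpoly_induct)
    case zero
    then show ?case using c[of 0] by simp
  next
    case (single m b)
    then show ?case using cmult[OF c[of b] mono[of m]] by (simp add: mult_single)
  qed (rule cadd)
  then show ?thesis using l by (auto elim: Lambda_cases)
qed

section \<open>The Frobenius structure in one variable\<close>

text \<open>
  The coefficient of \<open>x\<^sub>i\<close> to the power \<open>n\<^sub>i - 1\<close>. Monomials with a higher power of \<open>x\<^sub>i\<close> vanish in \<open>\<Lambda>\<close>
  and are sent to 0.
\<close>

definition poly_top :: "(nat \<Rightarrow> nat) \<Rightarrow> nat \<Rightarrow> 'k::field mpoly \<Rightarrow> 'k mpoly" where
  "poly_top n i p = (\<Sum>m\<in>keys p.
     if lookup m (i - 1) = n i - 1
     then single (m - single (i - 1) (n i - 1)) (lookup p m) else 0)"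

lemma poly_top_add: "poly_top n i (p + q) = poly_top n i p + poly_top n i q"
  unfolding poly_top_def
  by (rule setsum_keys_plus_distrib) (auto simp: single_add)

lemma poly_top_single: "poly_top n i (single m c) =
   (if lookup m (i - 1) = n i - 1
     then single (m - single (i - 1) (n i - 1)) c else 0)"
  by (auto simp: poly_top_def)

lemma poly_top_zero [simp]: "poly_top n i 0 = 0"
  by (simp add: poly_top_def)

lemma poly_top_mult:
  assumes "lookup m (i - 1) = 0"
  shows "poly_top n i (single m c * p) = single m c * poly_top n i p"
proof (induction p rule: mpoly_induct)
  case (single m' c')
  have "m + m' - single (i - 1) (n i - 1) = m + (m' - single (i - 1) (n i - 1))"
    if "lookup m' (i - 1) = n i - 1"
    using that assms by (intro poly_mapping_eqI) (auto simp: lookup_add lookup_minus lookup_single when_def)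
  then show ?case using assms by (auto simp: mult_single poly_top_single lookup_add)
qed (auto simp: poly_top_add distrib_left)

lemma poly_top_nonreduced:
  assumes "1 \<le> i" "0 < n i" "p \<in> nonreduced_span n" shows "poly_top n i p \<in> nonreduced_span n"
proof -
  have "\<not> reduced n (m - single (i - 1) (n i - 1))"
    if m: "\<not> reduced n m" "lookup m (i - 1) = n i - 1" for m
  proof -
    obtain j where j: "n (Suc j) \<le> lookup m j"
      using m unfolding reduced_def by (meson not_less)
    then have "j \<noteq> i - 1" using m assms by (cases i) auto
    then have "n (Suc j) \<le> lookup (m - single (i - 1) (n i - 1)) j"
      using j by (auto simp: lookup_minus lookup_single when_def)
    then show ?thesis unfolding reduced_def by (meson not_less)
  qed
  then have "lookup (poly_top n i p) \<mu> = 0" if "reduced n \<mu>" for \<mu>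
    using that assms(3) unfolding poly_top_def lookup_sum nonreduced_span_def
    by (intro sum.neutral) (auto simp: lookup_single when_def)
  then show ?thesis by (simp add: nonreduced_span_iff)
qed

lemma poly_top_frobenius:
  assumes "1 \<le> i" "0 < n i"
  shows "(\<Sum>a<n i. var i ^ a * poly_top n i (var i ^ (n i - 1 - a) * p)) - (p :: 'k::field mpoly) \<in> nonreduced_span n"
proof -
  interpret ideal "nonreduced_span n" "poly_ring :: 'k mpoly ring" by (rule ideal_nonreduced_span)
  show ?thesis
  proof (induction p rule: mpoly_induct)
    case zero
    then show ?case by (simp add: nonreduced_span_def)
  next
    case (single m c)
    define k where "k = lookup m (i - 1)"
    have "var i ^ a * poly_top n i (var i ^ (n i - 1 - a) * single m c)
         = (if a = k then single m c else 0)" if "a < n i" for a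
    proof -
      have top: "lookup (single (i - 1) (n i - 1 - a) + m) (i - 1) = n i - 1 \<longleftrightarrow> a = k"
        using that by (auto simp: lookup_add k_def)
      show ?thesis
      proof (cases "a = k")
        case True
        have "single (i - 1) a + (single (i - 1) (n i - 1 - a) + m - single (i - 1) (n i - 1)) = m"
          using that True by (intro poly_mapping_eqI) (auto simp: lookup_add lookup_minus lookup_single when_def k_def)
        then show ?thesis
          using True top by (simp only: var_power mult_single poly_top_single if_True mult_1_left simp_thms)
      next
        case False
        then show ?thesis
          using top by (simp only: var_power mult_single poly_top_single if_False mult_zero_right)
      qed
    qed
    then have "(\<Sum>a<n i. var i ^ a * poly_top n i (var i ^ (n i - 1 - a) * single m c))
        = (if k < n i then single m c else 0)"
      by (simp add: sum.delta)
    moreover have "\<not> reduced n m" if "\<not> k < n i"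
      using that assms unfolding reduced_def k_def by (auto intro!: exI[of _ "i - 1"])
    ultimately show ?case
      by (auto simp: nonreduced_span_def)
  next
    case (add p q)
    have "(\<Sum>a<n i. var i ^ a * poly_top n i (var i ^ (n i - 1 - a) * (p + q))) - (p + q)
      = ((\<Sum>a<n i. var i ^ a * poly_top n i (var i ^ (n i - 1 - a) * p)) - p) +
        ((\<Sum>a<n i. var i ^ a * poly_top n i (var i ^ (n i - 1 - a) * q)) - q)"
      by (simp add: distrib_left poly_top_add sum.distrib)
    then show ?case using nonreduced_span_add[OF add] by (simp only:)
  qed
qed

definition top_coeff :: "(nat \<Rightarrow> nat) \<Rightarrow> nat \<Rightarrow> 'k::field lam \<Rightarrow> 'k lam" where
  "top_coeff n i l = cls n (poly_top n i (SOME p. l = cls n p))"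

lemma cls_eq_iff_diff: "cls n p = cls n q \<longleftrightarrow> p - q \<in> nonreduced_span n"
  by (auto simp: cls_eq_iff nonreduced_span_iff lookup_minus)

lemma top_coeff_cls:
  assumes "1 \<le> i" "0 < n i"
  shows "top_coeff n i (cls n p) = cls n (poly_top n i p)"
proof -
  define q where "q = (SOME q. cls n p = cls n q)"
  have "cls n p = cls n q" unfolding q_def by (rule someI) simp
  then have "q - p \<in> nonreduced_span n" by (metis cls_eq_iff_diff)
  then have "poly_top n i (q - p) \<in> nonreduced_span n" by (rule poly_top_nonreduced[of i n, OF assms])
  moreover have "poly_top n i q = poly_top n i (q - p) + poly_top n i p"
    by (simp flip: poly_top_add)
  ultimately show ?thesis
    unfolding top_coeff_def q_def[symmetric] by (simp add: cls_eq_iff_diff)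
qed

lemma top_coeff_closed [simp]: "top_coeff n i l \<in> carrier (Lambda n)"
  by (simp add: top_coeff_def)

context
  fixes n :: "nat \<Rightarrow> nat" and i :: nat
  assumes i: "1 \<le> i" "0 < n i"
begin

lemma top_coeff_add: "l \<in> carrier (Lambda n) \<Longrightarrow> l' \<in> carrier (Lambda n) \<Longrightarrow>
    top_coeff n i (l \<oplus>\<^bsub>Lambda n\<^esub> l') = top_coeff n i l \<oplus>\<^bsub>Lambda n\<^esub> top_coeff n i l'"
  by (auto elim!: Lambda_cases simp: cls_add top_coeff_cls[of i n, OF i] poly_top_add)

lemma top_coeff_zero: "top_coeff n i \<zero>\<^bsub>Lambda n\<^esub> = \<zero>\<^bsub>Lambda n\<^esub>"
  by (simp add: zero_Lambda top_coeff_cls[of i n, OF i])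

lemma top_coeff_const: "l \<in> carrier (Lambda n) \<Longrightarrow>
    top_coeff n i (Lambda_const n c \<otimes>\<^bsub>Lambda n\<^esub> l) = Lambda_const n c \<otimes>\<^bsub>Lambda n\<^esub> top_coeff n i l"
  by (auto elim!: Lambda_cases simp: cls_mult Lambda_const_eq top_coeff_cls[of i n, OF i] poly_top_mult)

lemma top_coeff_xvar: "l \<in> carrier (Lambda n) \<Longrightarrow> 1 \<le> j \<Longrightarrow> j \<noteq> i \<Longrightarrow>
    top_coeff n i (xvar n j \<otimes>\<^bsub>Lambda n\<^esub> l) = xvar n j \<otimes>\<^bsub>Lambda n\<^esub> top_coeff n i l"
proof (elim Lambda_cases)
  fix p assume "1 \<le> j" "j \<noteq> i" "l = cls n p"
  moreover from this i(1) have "lookup (single (j - 1) (1::nat)) (i - 1) = 0"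
    by (auto simp: lookup_single when_def)
  ultimately show ?thesis
    by (simp add: cls_mult xvar_def var_def top_coeff_cls[of i n, OF i] poly_top_mult)
qed

lemma finsum_cls: "finite A \<Longrightarrow> (\<Oplus>\<^bsub>Lambda n\<^esub>a\<in>A. cls n (f a :: 'a::field mpoly)) = cls n (\<Sum>a\<in>A. f a)"
proof -
  interpret cring "Lambda n :: 'a lam ring" by (rule cring_Lambda)
  show "finite A \<Longrightarrow> ?thesis"
    by (induction A rule: finite_induct) (auto simp: zero_Lambda cls_add)
qed

text \<open>
  The top coefficient is a Frobenius form for \<open>\<Lambda>\<close> over the subring of the remaining variables: it
  vanishes on the product of \<open>x\<^sub>i\<^sup>a\<close> with the complement of \<open>x\<^sub>i\<^sup>b\<close> unless \<open>a = b\<close>, so that these powers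
  are dual bases.
\<close>

lemma top_coeff_frobenius:
  assumes "l \<in> carrier (Lambda n)"
  shows "(\<Oplus>\<^bsub>Lambda n\<^esub>a\<in>{..<n i}. xvar n i [^]\<^bsub>Lambda n\<^esub> a \<otimes>\<^bsub>Lambda n\<^esub>
      top_coeff n i (xvar n i [^]\<^bsub>Lambda n\<^esub> (n i - 1 - a) \<otimes>\<^bsub>Lambda n\<^esub> l)) = l"
proof -
  obtain p where p: "l = cls n p" using assms by (rule Lambda_cases)
  show ?thesis
    using poly_top_frobenius[of i n, OF i, of p]
    by (simp add: p xvar_pow cls_mult top_coeff_cls[of i n, OF i] finsum_cls cls_eq_iff_diff del: power_Suc)
qed

end

section \<open>Acyclicity of quotient complexes\<close>

definition subgp :: "'x::ab_group_add set \<Rightarrow> bool" where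
  "subgp A \<longleftrightarrow> 0 \<in> A \<and> (\<forall>a\<in>A. \<forall>b\<in>A. a - b \<in> A)"

lemma subgp_zero: "subgp A \<Longrightarrow> 0 \<in> A"
  by (simp add: subgp_def)

lemma subgp_diff: "subgp A \<Longrightarrow> a \<in> A \<Longrightarrow> b \<in> A \<Longrightarrow> a - b \<in> A"
  by (simp add: subgp_def)

lemma subgp_minus: "subgp A \<Longrightarrow> a \<in> A \<Longrightarrow> - a \<in> A"
  using subgp_diff[of A 0 a] subgp_zero by auto

lemma subgp_add: "subgp A \<Longrightarrow> a \<in> A \<Longrightarrow> b \<in> A \<Longrightarrow> a + b \<in> A"
  using subgp_diff[of A a "- b"] subgp_minus by auto

lemma subgp_sum: "subgp A \<Longrightarrow> (\<And>i. i \<in> I \<Longrightarrow> f i \<in> A) \<Longrightarrow> (\<Sum>i\<in>I. f i) \<in> A"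
  by (induction I rule: infinite_finite_induct) (auto simp: subgp_zero subgp_add)

lemma subgp_trans: "subgp A \<Longrightarrow> a - b \<in> A \<Longrightarrow> b - c \<in> A \<Longrightarrow> a - c \<in> A"
  using subgp_add[of A "a - b" "b - c"] by simp

lemma subgp_cong: "subgp A \<Longrightarrow> a - b \<in> A \<Longrightarrow> a \<in> A \<longleftrightarrow> b \<in> A"
  using subgp_add[of A "a - b" b] subgp_diff[of A a "a - b"] by auto

lemma subgp_group_closure: "subgp (group_closure R)"
  by (simp add: subgp_def group_closure.diff)

lemma group_closure_least:
  assumes "subgp A" "R \<subseteq> A" shows "group_closure R \<subseteq> A"
proof
  fix x assume "x \<in> group_closure R"
  then show "x \<in> A"
    by induction (use assms in \<open>auto simp: subgp_zero subgp_diff\<close>)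
qed

lemma additive_group_closure:
  assumes "additive f" "\<And>r. r \<in> R \<Longrightarrow> f r \<in> A" "subgp A" "x \<in> group_closure R"
  shows "f x \<in> A"
  using assms(4)
  by induction (use assms in \<open>auto simp: additive.zero additive.diff subgp_diff subgp_zero\<close>)

text \<open>
  A graded group \<open>X\<close> with an operator \<open>d\<close> that is a differential on the quotient \<open>X/J\<close>. Working
  with representatives keeps all elements in one type.
\<close>

locale quotient_complex =
  fixes X J :: "int \<Rightarrow> 'x::ab_group_add set" and d :: "int \<Rightarrow> 'x \<Rightarrow> 'x"
  assumes X: "subgp (X m)" and J: "subgp (J m)" and JX: "J m \<subseteq> X m"
    and d_additive: "additive (d m)"
    and d_X: "u \<in> X m \<Longrightarrow> d m u \<in> X (m + 1)"
    and d_J: "u \<in> J m \<Longrightarrow> d m u \<in> J (m + 1)"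
    and d_d: "u \<in> X m \<Longrightarrow> d (m + 1) (d m u) \<in> J (m + 2)"

definition acyclic_mod :: "(int \<Rightarrow> 'x::ab_group_add set) \<Rightarrow> (int \<Rightarrow> 'x set) \<Rightarrow> (int \<Rightarrow> 'x \<Rightarrow> 'x) \<Rightarrow> bool" where
  "acyclic_mod X J d \<longleftrightarrow> (\<forall>m. \<forall>z\<in>X m. d m z \<in> J (m + 1) \<longrightarrow> (\<exists>u\<in>X (m - 1). z - d (m - 1) u \<in> J m))"

text \<open>
  If the kernel of a nilpotent chain endomorphism \<open>t\<close> of \<open>N\<close> is the image of an endomorphism \<open>g\<close>
  whose kernel is the image of \<open>t\<close>, then \<open>g\<close> identifies \<open>N/tN\<close> with the kernel of \<open>t\<close>. If \<open>N/tN\<close>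
  is acyclic then \<open>t\<close> has acyclic kernel and cokernel, hence acts bijectively on the cohomology
  of \<open>N\<close>; being nilpotent there, it forces the cohomology to vanish.
\<close>

lemma (in quotient_complex) acyclic_mod_lift:
  assumes t: "\<And>m. additive (t m)" "\<And>m u. u \<in> X m \<Longrightarrow> t m u \<in> X m" "\<And>m u. u \<in> J m \<Longrightarrow> t m u \<in> J m"
      "\<And>m u. u \<in> X m \<Longrightarrow> d m (t m u) = t (m + 1) (d m u)"
    and g: "\<And>m. additive (g m)" "\<And>m u. u \<in> X m \<Longrightarrow> g m u \<in> X m" "\<And>m u. u \<in> J m \<Longrightarrow> g m u \<in> J m"
      "\<And>m u. u \<in> X m \<Longrightarrow> d m (g m u) = g (m + 1) (d m u)"
    and tg: "\<And>m u. u \<in> X m \<Longrightarrow> t m (g m u) \<in> J m" and gt: "\<And>m u. u \<in> X m \<Longrightarrow> g m (t m u) \<in> J m"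
    and ker_t: "\<And>m u. u \<in> X m \<Longrightarrow> t m u \<in> J m \<Longrightarrow> \<exists>v\<in>X m. u - g m v \<in> J m"
    and ker_g: "\<And>m u. u \<in> X m \<Longrightarrow> g m u \<in> J m \<Longrightarrow> \<exists>v\<in>X m. u - t m v \<in> J m"
    and nilp: "\<And>m u. u \<in> X m \<Longrightarrow> (t m ^^ N) u \<in> J m"
    and acyc: "acyclic_mod X (\<lambda>m. {j + t m u | j u. j \<in> J m \<and> u \<in> X m}) d"
  shows "acyclic_mod X J d"
proof -
  note sg = subgp_zero subgp_diff subgp_add subgp_minus
  interpret t: additive "t i" for i by (rule t(1))
  interpret g: additive "g i" for i by (rule g(1))
  interpret d: additive "d i" for i by (rule d_additive)
  have acyc': "\<exists>w\<in>X (m - 1). \<exists>j\<in>J m. \<exists>u\<in>X m. z = d (m - 1) w + j + t m u"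
    if "z \<in> X m" "d m z = j + t (m + 1) u" "j \<in> J (m + 1)" "u \<in> X (m + 1)" for m z j u
  proof -
    have "d m z \<in> {j + t (m + 1) u | j u. j \<in> J (m + 1) \<and> u \<in> X (m + 1)}" using that by blast
    then obtain w where w: "w \<in> X (m - 1)" "z - d (m - 1) w \<in> {j + t m u | j u. j \<in> J m \<and> u \<in> X m}"
      using acyc \<open>z \<in> X m\<close> unfolding acyclic_mod_def by meson
    then obtain j u where "z - d (m - 1) w = j + t m u" "j \<in> J m" "u \<in> X m" by blast
    then have "z = d (m - 1) w + j + t m u" by (simp add: algebra_simps)
    then show ?thesis using w(1) \<open>j \<in> J m\<close> \<open>u \<in> X m\<close> by blast
  qed
  have step: "\<exists>w\<in>X (m - 1). \<exists>v\<in>X m. d m v \<in> J (m + 1) \<and> z - d (m - 1) w - t m v \<in> J m"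
    if z: "z \<in> X m" "d m z \<in> J (m + 1)" for m z
  proof -
    obtain w j v where w: "w \<in> X (m - 1)" "j \<in> J m" "v \<in> X m" "z = d (m - 1) w + j + t m v"
      using acyc'[of z m "d m z" 0] z X[THEN subgp_zero] by (auto simp: t.zero)
    \<comment> \<open>\<open>t v\<close> represents \<open>z\<close>, but \<open>v\<close> need not be a cocycle. Its boundary is in the kernel of \<open>t\<close>,
        hence of the form \<open>g u\<close>, and \<open>u\<close> is a cocycle of the acyclic cokernel.\<close>
    have dd: "d m (d (m - 1) w) \<in> J (m + 1)" using d_d[OF w(1)] by (simp add: algebra_simps)
    have dv: "d m v \<in> X (m + 1)" by (rule d_X[OF w(3)])
    have "t (m + 1) (d m v) = d m z - d m (d (m - 1) w) - d m j"
      using t(4)[OF w(3)] w(4) by (simp add: d.add algebra_simps)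
    then have "t (m + 1) (d m v) \<in> J (m + 1)" using z dd d_J[OF w(2)] J by (simp add: sg)
    then obtain u where u: "u \<in> X (m + 1)" "d m v - g (m + 1) u \<in> J (m + 1)"
      using ker_t[OF dv] by blast
    have "d (m + 1) (d m v - g (m + 1) u) \<in> J (m + 2)" using d_J[OF u(2)] by (simp add: algebra_simps)
    moreover have "d (m + 1) (d m v - g (m + 1) u) = d (m + 1) (d m v) - g (m + 2) (d (m + 1) u)"
      using g(4)[OF u(1)] by (simp add: d.diff add.assoc)
    ultimately have "g (m + 2) (d (m + 1) u) \<in> J (m + 2)"
      using d_d[OF w(3)] subgp_diff[OF J, of "d (m + 1) (d m v)" "m + 2" "d (m + 1) (d m v - g (m + 1) u)"] by simp
    moreover have du: "d (m + 1) u \<in> X (m + 2)" using d_X[OF u(1)] by (simp add: algebra_simps)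
    ultimately obtain s where s: "s \<in> X (m + 2)" "d (m + 1) u - t (m + 2) s \<in> J (m + 2)"
      using ker_g by blast
    obtain r j' q where r: "r \<in> X m" "j' \<in> J (m + 1)" "q \<in> X (m + 1)" "u = d m r + j' + t (m + 1) q"
      using acyc'[OF u(1), of "d (m + 1) u - t (m + 2) s" s] s by (auto simp: algebra_simps)
    \<comment> \<open>Writing \<open>u\<close> as a boundary in the cokernel gives the correction \<open>g r\<close> of \<open>v\<close>, which \<open>t\<close> kills.\<close>
    have "d m (v - g m r) = (d m v - g (m + 1) u) + g (m + 1) j' + g (m + 1) (t (m + 1) q)"
      using r(4) g(4)[OF r(1)] by (simp add: d.diff g.add)
    then have 1: "d m (v - g m r) \<in> J (m + 1)"
      using u(2) g(3)[OF r(2)] gt[OF r(3)] J by (simp add: sg)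
    have "z - d (m - 1) w - t m (v - g m r) = j + t m (g m r)"
      using w(4) by (simp add: t.diff)
    then have 2: "z - d (m - 1) w - t m (v - g m r) \<in> J m"
      using w(2) tg[OF r(1)] J by (simp add: sg)
    have "v - g m r \<in> X m" using w(3) g(2)[OF r(1)] X by (simp add: sg)
    then show ?thesis using w(1) 1 2 by blast
  qed
  have tk_additive: "additive (t m ^^ k)" for m k
    by (induction k) (auto simp: additive_def t.add)
  have tk: "u \<in> X m \<Longrightarrow> (t m ^^ k) u \<in> X m" "u \<in> X m \<Longrightarrow> d m ((t m ^^ k) u) = (t (m + 1) ^^ k) (d m u)"
      "u \<in> J m \<Longrightarrow> (t m ^^ k) u \<in> J m" for k m u
    by (induction k) (auto simp: t(2-4))
  have iter: "\<exists>w\<in>X (m - 1). \<exists>v\<in>X m. d m v \<in> J (m + 1) \<and> z - d (m - 1) w - (t m ^^ k) v \<in> J m"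
    if z: "z \<in> X m" "d m z \<in> J (m + 1)" for m z k
  proof (induction k)
    case 0
    show ?case
      by (rule bexI[of _ 0], rule bexI[of _ z])
        (use z X[THEN subgp_zero] J[THEN subgp_zero] in \<open>auto simp: d.zero\<close>)
  next
    case (Suc k)
    then obtain w v where w: "w \<in> X (m - 1)" "v \<in> X m" "d m v \<in> J (m + 1)" "z - d (m - 1) w - (t m ^^ k) v \<in> J m"
      by blast
    then obtain w' v' where w': "w' \<in> X (m - 1)" "v' \<in> X m" "d m v' \<in> J (m + 1)" "v - d (m - 1) w' - t m v' \<in> J m"
      using step by blast
    interpret tk: additive "t i ^^ k" for i by (rule tk_additive)
    have "d (m - 1) ((t (m - 1) ^^ k) w') = (t m ^^ k) (d (m - 1) w')"
      using tk(2)[OF w'(1), of k] by simp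
    then have eq: "z - d (m - 1) (w + (t (m - 1) ^^ k) w') - (t m ^^ Suc k) v'
        = (z - d (m - 1) w - (t m ^^ k) v) + (t m ^^ k) (v - d (m - 1) w' - t m v')"
      by (simp add: d.add tk.diff funpow_swap1)
    have "z - d (m - 1) (w + (t (m - 1) ^^ k) w') - (t m ^^ Suc k) v' \<in> J m"
      unfolding eq using tk(3)[OF w'(4)] w(4) J by (intro subgp_add)
    moreover have "w + (t (m - 1) ^^ k) w' \<in> X (m - 1)" using tk(1) w w' X by (simp add: sg)
    ultimately show ?case using w' by blast
  qed
  show ?thesis unfolding acyclic_mod_def
  proof (intro allI ballI impI)
    fix m z assume z: "z \<in> X m" "d m z \<in> J (m + 1)"
    from iter[OF z, of N] obtain w v where w: "w \<in> X (m - 1)" "v \<in> X m" "z - d (m - 1) w - (t m ^^ N) v \<in> J m"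
      by blast
    then have "z - d (m - 1) w \<in> J m"
      using subgp_add[OF J w(3) nilp[OF w(2)]] by simp
    then show "\<exists>u\<in>X (m - 1). z - d (m - 1) u \<in> J m" using w by blast
  qed
qed

text \<open>
  Two commuting nilpotent operators, as for multiplication by a variable on the two sides of a
  tensor product.
\<close>

locale nilpotent_pair = quotient_complex X J d
  for X J :: "int \<Rightarrow> 'x::ab_group_add set" and d :: "int \<Rightarrow> 'x \<Rightarrow> 'x" +
  fixes L R :: "int \<Rightarrow> 'x \<Rightarrow> 'x" and N :: nat
  assumes L: "additive (L m)" "u \<in> X m \<Longrightarrow> L m u \<in> X m" "u \<in> J m \<Longrightarrow> L m u \<in> J m"
      "u \<in> X m \<Longrightarrow> d m (L m u) = L (m + 1) (d m u)" "u \<in> X m \<Longrightarrow> (L m ^^ N) u \<in> J m"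
    and R: "additive (R m)" "u \<in> X m \<Longrightarrow> R m u \<in> X m" "u \<in> J m \<Longrightarrow> R m u \<in> J m"
      "u \<in> X m \<Longrightarrow> d m (R m u) = R (m + 1) (d m u)" "u \<in> X m \<Longrightarrow> (R m ^^ N) u \<in> J m"
    and LR: "L m (R m u) = R m (L m u)"
begin

text \<open>The quotient of \<open>L\<^sup>k - R\<^sup>k\<close> by \<open>L - R\<close>.\<close>

definition G :: "nat \<Rightarrow> int \<Rightarrow> 'x \<Rightarrow> 'x" where
  "G k m u = (\<Sum>a<k. (L m ^^ a) ((R m ^^ (k - 1 - a)) u))"

sublocale L: additive "L m" for m by (rule L(1))
sublocale R: additive "R m" for m by (rule R(1))
sublocale d: additive "d m" for m by (rule d_additive)

sublocale Lk: additive "L m ^^ k" for m k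
  by (induction k) (auto simp: additive_def L.add)
sublocale Rk: additive "R m ^^ k" for m k
  by (induction k) (auto simp: additive_def R.add)
sublocale G: additive "G k m" for k m
  by unfold_locales (simp add: G_def Rk.add Lk.add sum.distrib)

lemma Lk: "u \<in> X m \<Longrightarrow> (L m ^^ k) u \<in> X m" "u \<in> J m \<Longrightarrow> (L m ^^ k) u \<in> J m"
    "u \<in> X m \<Longrightarrow> d m ((L m ^^ k) u) = (L (m + 1) ^^ k) (d m u)"
  by (induction k) (auto simp: L)

lemma Rk: "u \<in> X m \<Longrightarrow> (R m ^^ k) u \<in> X m" "u \<in> J m \<Longrightarrow> (R m ^^ k) u \<in> J m"
    "u \<in> X m \<Longrightarrow> d m ((R m ^^ k) u) = (R (m + 1) ^^ k) (d m u)"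
  by (induction k) (auto simp: R)

lemma LkR: "(L m ^^ k) (R m u) = R m ((L m ^^ k) u)"
  by (induction k) (auto simp: LR)

lemma RkL: "(R m ^^ k) (L m u) = L m ((R m ^^ k) u)"
  by (induction k) (auto simp: LR)

lemma LkRk: "(L m ^^ k) ((R m ^^ l) u) = (R m ^^ l) ((L m ^^ k) u)"
  by (induction l) (auto simp: LkR)

lemma G_X: "u \<in> X m \<Longrightarrow> G k m u \<in> X m" and G_J: "u \<in> J m \<Longrightarrow> G k m u \<in> J m"
  unfolding G_def using X J by (auto intro!: subgp_sum Lk Rk)

lemma G_d: "u \<in> X m \<Longrightarrow> d m (G k m u) = G k (m + 1) (d m u)"
  unfolding G_def by (simp add: d.sum Lk(3) Rk(3) Rk(1))

lemma G_Suc: "G (Suc k) m u = R m (G k m u) + (L m ^^ k) u"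
proof -
  have "R m (G k m u) = (\<Sum>a<k. (L m ^^ a) ((R m ^^ (k - a)) u))"
    unfolding G_def R.sum
  proof (rule sum.cong)
    fix a assume "a \<in> {..<k}"
    then have "k - a = Suc (k - 1 - a)" by auto
    then show "R m ((L m ^^ a) ((R m ^^ (k - 1 - a)) u)) = (L m ^^ a) ((R m ^^ (k - a)) u)"
      by (simp add: LkR)
  qed simp
  then show ?thesis by (simp add: G_def)
qed

lemma telescope: "L m (G k m u) - R m (G k m u) = (L m ^^ k) u - (R m ^^ k) u"
proof (induction k)
  case 0
  then show ?case by (simp add: G_def L.zero R.zero)
next
  case (Suc k)
  have "L m (G (Suc k) m u) - R m (G (Suc k) m u) = R m (L m (G k m u) - R m (G k m u)) + L m ((L m ^^ k) u) - R m ((L m ^^ k) u)"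
    by (simp add: G_Suc L.add R.add R.diff LR)
  then show ?case by (simp add: Suc R.diff)
qed

lemma G_diff: "G k m (L m u - R m u) = L m (G k m u) - R m (G k m u)"
proof -
  have "G k m (L m u) = L m (G k m u)"
    unfolding G_def L.sum by (intro sum.cong) (simp_all add: RkL funpow_swap1)
  moreover have "G k m (R m u) = R m (G k m u)"
    unfolding G_def R.sum by (intro sum.cong) (simp_all add: LkR flip: funpow_swap1)
  ultimately show ?thesis by (simp add: G.diff)
qed

lemma G_diff_J: "u \<in> X m \<Longrightarrow> G N m (L m u - R m u) \<in> J m"
  using J by (simp add: G_diff telescope subgp_diff L R)

end

text \<open>
  An operator \<open>\<epsilon>\<close> that commutes with \<open>L\<close> and is a Frobenius form for \<open>R\<close>: the powers of \<open>R\<close> and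
  their complements are dual bases. Modulo \<open>J\<close>, the kernel of \<open>L - R\<close> is then the image of \<open>G N\<close>,
  and vice versa.
\<close>

locale frobenius_pair = nilpotent_pair X J d L R N
  for X J :: "int \<Rightarrow> 'x::ab_group_add set" and d L R :: "int \<Rightarrow> 'x \<Rightarrow> 'x" and N :: nat +
  fixes \<epsilon> :: "int \<Rightarrow> 'x \<Rightarrow> 'x"
  assumes \<epsilon>: "additive (\<epsilon> m)" "u \<in> X m \<Longrightarrow> \<epsilon> m u \<in> X m" "u \<in> J m \<Longrightarrow> \<epsilon> m u \<in> J m"
    and L\<epsilon>: "L m (\<epsilon> m u) = \<epsilon> m (L m u)"
    and frobenius: "u \<in> X m \<Longrightarrow> u - (\<Sum>a<N. (R m ^^ a) (\<epsilon> m ((R m ^^ (N - 1 - a)) u))) \<in> J m"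
begin

sublocale \<epsilon>: additive "\<epsilon> m" for m by (rule \<epsilon>(1))

lemma Lk\<epsilon>: "(L m ^^ k) (\<epsilon> m u) = \<epsilon> m ((L m ^^ k) u)"
  by (induction k) (auto simp: L\<epsilon>)

lemma ker_diff:
  assumes u: "u \<in> X m" "L m u - R m u \<in> J m"
  shows "u - G N m (\<epsilon> m u) \<in> J m"
proof -
  have pow: "(R m ^^ k) u - (L m ^^ k) u \<in> J m" for k
  proof (induction k)
    case 0
    then show ?case using J[THEN subgp_zero] by simp
  next
    case (Suc k)
    have "(R m ^^ Suc k) u - (L m ^^ Suc k) u = R m ((R m ^^ k) u - (L m ^^ k) u) - (L m ^^ k) (L m u - R m u)"
      by (simp add: R.diff Lk.diff LkR flip: funpow_swap1)
    then show ?case using Suc u J by (simp add: subgp_diff R Lk)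
  qed
  have "G N m (\<epsilon> m u) = (\<Sum>a<N. (R m ^^ a) (\<epsilon> m ((L m ^^ (N - 1 - a)) u)))"
    unfolding G_def Lk\<epsilon>[symmetric] LkRk[symmetric]
    by (subst sum.nat_diff_reindex[symmetric]) (auto intro!: sum.cong)
  then have "(\<Sum>a<N. (R m ^^ a) (\<epsilon> m ((R m ^^ (N - 1 - a)) u))) - G N m (\<epsilon> m u)
      = (\<Sum>a<N. (R m ^^ a) (\<epsilon> m ((R m ^^ (N - 1 - a)) u - (L m ^^ (N - 1 - a)) u)))"
    by (simp add: sum_subtractf \<epsilon>.diff Rk.diff)
  also have "\<dots> \<in> J m"
    using J by (intro subgp_sum Rk \<epsilon> pow)
  finally show ?thesis
    using subgp_trans[OF J frobenius[OF u(1)]] by blast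
qed

lemma ker_G:
  assumes u: "u \<in> X m" "G N m u \<in> J m"
  shows "\<exists>v\<in>X m. u - (L m v - R m v) \<in> J m"
proof -
  let ?w = "\<lambda>a. \<epsilon> m ((R m ^^ (N - 1 - a)) u)"
  define v where "v = - (\<Sum>a<N. G a m (?w a))"
  have v: "v \<in> X m"
    unfolding v_def using X u by (intro subgp_minus subgp_sum G_X \<epsilon> Rk)
  have "\<epsilon> m (G N m u) = (\<Sum>a<N. (L m ^^ a) (?w a))"
    by (simp add: G_def \<epsilon>.sum Lk\<epsilon>)
  moreover have "L m v - R m v = - (\<Sum>a<N. L m (G a m (?w a)) - R m (G a m (?w a)))"
    by (simp add: v_def L.minus R.minus L.sum R.sum sum_subtractf)
  moreover have "\<dots> = - (\<Sum>a<N. (L m ^^ a) (?w a) - (R m ^^ a) (?w a))"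
    by (simp add: telescope)
  ultimately have "u - (L m v - R m v) = (u - (\<Sum>a<N. (R m ^^ a) (?w a))) + \<epsilon> m (G N m u)"
    by (simp add: sum_subtractf)
  then have "u - (L m v - R m v) \<in> J m"
    using subgp_add[OF J frobenius[OF u(1)] \<epsilon>(3)[OF u(2)]] by (simp only:)
  then show ?thesis using v by blast
qed

text \<open>In the expansion of \<open>(L - R)\<close> to the power \<open>2 N\<close> each term has a factor \<open>L\<^sup>N\<close> or \<open>R\<^sup>N\<close>.\<close>

lemma nilpotent_diff: "u \<in> X m \<Longrightarrow> 2 * N \<le> a + b + c \<Longrightarrow> (L m ^^ a) ((R m ^^ b) (((\<lambda>u. L m u - R m u) ^^ c) u)) \<in> J m"
proof (induction c arbitrary: a b u)
  case 0
  then have "N \<le> a \<or> N \<le> b" by linarith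
  moreover have "(L m ^^ a) ((R m ^^ b) u) \<in> J m" if "N \<le> a"
    unfolding LkRk using that Lk(2)[OF L(5)[OF 0(1)], of "a - N"]
    by (intro Rk(2)) (simp flip: funpow_add[THEN fun_cong, unfolded comp_def])
  moreover have "(L m ^^ a) ((R m ^^ b) u) \<in> J m" if "N \<le> b"
    using that Rk(2)[OF R(5)[OF 0(1)], of "b - N"]
    by (intro Lk(2)) (simp flip: funpow_add[THEN fun_cong, unfolded comp_def])
  ultimately show ?case by auto
next
  case (Suc c)
  let ?t = "\<lambda>u. L m u - R m u"
  let ?u = "(?t ^^ c) u"
  have "(L m ^^ a) ((R m ^^ b) ((?t ^^ Suc c) u)) = (L m ^^ Suc a) ((R m ^^ b) ?u) - (L m ^^ a) ((R m ^^ Suc b) ?u)"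
    by (simp add: Rk.diff Lk.diff RkL funpow_swap1)
  moreover have "(L m ^^ Suc a) ((R m ^^ b) ?u) \<in> J m" "(L m ^^ a) ((R m ^^ Suc b) ?u) \<in> J m"
    using Suc by (auto simp del: funpow.simps)
  ultimately show ?case using J by (simp add: subgp_diff del: funpow.simps)
qed

lemma acyclic_mod_lift_frobenius:
  assumes "acyclic_mod X (\<lambda>m. {j + (L m u - R m u) | j u. j \<in> J m \<and> u \<in> X m}) d"
  shows "acyclic_mod X J d"
proof (rule acyclic_mod_lift[where t = "\<lambda>m u. L m u - R m u" and g = "G N" and N = "2 * N"])
  fix m u assume u: "u \<in> X m"
  show "L m (G N m u) - R m (G N m u) \<in> J m"
    using u J by (simp add: telescope subgp_diff L R)
  then show "G N m (L m u - R m u) \<in> J m" by (simp add: G_diff)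
  show "((\<lambda>u. L m u - R m u) ^^ (2 * N)) u \<in> J m"
    using nilpotent_diff[OF u, of 0 0 "2 * N"] by simp
  show "\<exists>v\<in>X m. u - G N m v \<in> J m" if "L m u - R m u \<in> J m"
    using ker_diff[OF u that] \<epsilon>(2)[OF u] by blast
  show "\<exists>v\<in>X m. u - (L m v - R m v) \<in> J m" if "G N m u \<in> J m"
    by (rule ker_G[OF u that])
qed (use assms X J in \<open>auto simp: additive_def L.add R.add subgp_diff L R d.diff G.add G_X G_J G_d\<close>)

end

section \<open>Tensor products as quotients of formal tensors\<close>

text \<open>
  Complexes without their grading. Acyclicity of a tensor product is a statement about the
  underlying modules, and this keeps the grading of the dual out of the argument.
\<close>

locale lam_complex =
  fixes n :: "nat \<Rightarrow> nat" and X :: "('k::field lam, 'a) gcomplex"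
  assumes module: "Module.module (Lambda n) (obj X i)"
    and bd_hom: "bd X i \<in> hom (add_monoid (obj X i)) (add_monoid (obj X (i + 1)))"
    and bd_smult [simp]: "l \<in> carrier (Lambda n) \<Longrightarrow> x \<in> carrier (obj X i) \<Longrightarrow>
          bd X i (l \<odot>\<^bsub>obj X i\<^esub> x) = l \<odot>\<^bsub>obj X (i + 1)\<^esub> bd X i x"
    and bd_bd [simp]: "x \<in> carrier (obj X i) \<Longrightarrow> bd X (i + 1) (bd X i x) = \<zero>\<^bsub>obj X (i + 2)\<^esub>"
begin

sublocale M: Module.module "Lambda n" "obj X i" for i by (rule module)

lemma bd_closed [simp]: "x \<in> carrier (obj X i) \<Longrightarrow> bd X i x \<in> carrier (obj X (i + 1))"
  using bd_hom[of i] by (auto simp: hom_def)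

lemma bd_add [simp]: "x \<in> carrier (obj X i) \<Longrightarrow> y \<in> carrier (obj X i) \<Longrightarrow>
    bd X i (x \<oplus>\<^bsub>obj X i\<^esub> y) = bd X i x \<oplus>\<^bsub>obj X (i + 1)\<^esub> bd X i y"
  using bd_hom[of i] by (auto simp: hom_def)

lemma bd_zero [simp]: "bd X i \<zero>\<^bsub>obj X i\<^esub> = \<zero>\<^bsub>obj X (i + 1)\<^esub>"
proof -
  have "bd X i (\<zero>\<^bsub>Lambda n\<^esub> \<odot>\<^bsub>obj X i\<^esub> \<zero>\<^bsub>obj X i\<^esub>) = \<zero>\<^bsub>obj X (i + 1)\<^esub>"
    by (subst bd_smult) simp_all
  then show ?thesis by simp
qed

lemma bd_pred_closed [simp]: "x \<in> carrier (obj X (i - 1)) \<Longrightarrow> bd X (i - 1) x \<in> carrier (obj X i)"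
  using bd_closed[of x "i - 1"] by simp

end

lemma lam_complex_if_is_complex: "is_complex n X \<Longrightarrow> lam_complex n X"
  by (rule lam_complex.intro) (simp_all add: is_complex_def graded_module_def graded_hom_def)

definition formal_map :: "(int \<Rightarrow> 'a \<Rightarrow> 'c) \<Rightarrow> (int \<Rightarrow> 'b \<Rightarrow> 'e) \<Rightarrow> int \<Rightarrow> ('a, 'b) formal_tensor \<Rightarrow> ('c, 'e) formal_tensor" where
  "formal_map f h m = frag_extend (\<lambda>(p, x, y). frag_of (p, f p x, h (m - p) y))"

lemma additive_frag_extend: "additive (frag_extend f)"
  by (simp add: additive_def frag_extend_add)

lemma additive_formal_map: "additive (formal_map f h m)"
  unfolding formal_map_def by (rule additive_frag_extend)

lemma formal_map_of [simp]: "formal_map f h m (frag_of (p, x, y)) = frag_of (p, f p x, h (m - p) y)"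
  by (simp add: formal_map_def)

lemma formal_map_comp:
  "formal_map f h m (formal_map f' h' m z) = formal_map (\<lambda>p. f p \<circ> f' p) (\<lambda>j. h j \<circ> h' j) m z"
proof -
  have "keys z \<subseteq> UNIV" by simp
  then show ?thesis
    by (induction z rule: frag_induction) (auto simp: formal_map_def frag_extend_diff)
qed

lemma formal_map_ident [simp]: "formal_map (\<lambda>p x. x) (\<lambda>j y. y) m z = z"
proof -
  have "keys z \<subseteq> UNIV" by simp
  then show ?thesis
    by (induction z rule: frag_induction) (auto simp: formal_map_def frag_extend_diff)
qed

lemma formal_map_pow:
  fixes f :: "int \<Rightarrow> 'a \<Rightarrow> 'a" and h :: "int \<Rightarrow> 'b \<Rightarrow> 'b"
  shows "(formal_map f h m ^^ k) z = formal_map (\<lambda>p. f p ^^ k) (\<lambda>j. h j ^^ k) m z"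
proof (induction k)
  case 0
  have "(\<lambda>p. f p ^^ 0) = (\<lambda>p x. x)" "(\<lambda>j. h j ^^ 0) = (\<lambda>j y. y)"
    by (simp_all add: fun_eq_iff)
  then show ?case by simp
next
  case (Suc k)
  then show ?case by (simp add: formal_map_comp comp_def)
qed

definition bilinear_relators :: "('l, 'a) gcomplex \<Rightarrow> ('l, 'b) gcomplex \<Rightarrow> int \<Rightarrow> ('a, 'b) formal_tensor set" where
  "bilinear_relators X Y m =
     {frag_of (p, x \<oplus>\<^bsub>obj X p\<^esub> x', y) - frag_of (p, x, y) - frag_of (p, x', y) | p x x' y.
        x \<in> carrier (obj X p) \<and> x' \<in> carrier (obj X p) \<and> y \<in> carrier (obj Y (m - p))} \<union>
     {frag_of (p, x, y \<oplus>\<^bsub>obj Y (m - p)\<^esub> y') - frag_of (p, x, y) - frag_of (p, x, y') | p x y y'.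
        x \<in> carrier (obj X p) \<and> y \<in> carrier (obj Y (m - p)) \<and> y' \<in> carrier (obj Y (m - p))}"

text \<open>
  Balancing only over a subset \<open>K\<close> of \<open>\<Lambda>\<close> presents the tensor product over the subring that \<open>K\<close>
  generates.
\<close>

definition balanced_relators ::
  "'l set \<Rightarrow> ('l, 'a) gcomplex \<Rightarrow> ('l, 'b) gcomplex \<Rightarrow> int \<Rightarrow> ('a, 'b) formal_tensor set" where
  "balanced_relators K X Y m =
     {frag_of (p, l \<odot>\<^bsub>obj X p\<^esub> x, y) - frag_of (p, x, l \<odot>\<^bsub>obj Y (m - p)\<^esub> y) | p l x y.
        l \<in> K \<and> x \<in> carrier (obj X p) \<and> y \<in> carrier (obj Y (m - p))}"

definition balanced_kernel ::
  "'l set \<Rightarrow> ('l, 'a) gcomplex \<Rightarrow> ('l, 'b) gcomplex \<Rightarrow> int \<Rightarrow> ('a, 'b) formal_tensor set" where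
  "balanced_kernel K X Y m = group_closure (bilinear_relators X Y m \<union> balanced_relators K X Y m)"

definition formal_tensors :: "('l, 'a) gcomplex \<Rightarrow> ('l, 'b) gcomplex \<Rightarrow> int \<Rightarrow> ('a, 'b) formal_tensor set" where
  "formal_tensors X Y m = {z. keys z \<subseteq> tensor_symbols X Y m}"

definition formal_bd :: "('l, 'a) gcomplex \<Rightarrow> ('l, 'b) gcomplex \<Rightarrow> int \<Rightarrow> ('a, 'b) formal_tensor \<Rightarrow> ('a, 'b) formal_tensor" where
  "formal_bd X Y m = frag_extend (\<lambda>(p, x, y).
     frag_of (p + 1, bd X p x, y) +
     frag_cmul (if even p then 1 else - 1) (frag_of (p, x, bd Y (m - p) y)))"

lemma subgp_formal_tensors: "subgp (formal_tensors X Y m)"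
  unfolding subgp_def formal_tensors_def using keys_diff by fastforce

lemma subgp_balanced_kernel: "subgp (balanced_kernel K X Y m)"
  unfolding balanced_kernel_def by (rule subgp_group_closure)

lemma additive_formal_bd: "additive (formal_bd X Y m)"
  unfolding formal_bd_def by (rule additive_frag_extend)

lemma formal_bd_of: "formal_bd X Y m (frag_of (p, x, y)) =
    frag_of (p + 1, bd X p x, y) + frag_cmul (if even p then 1 else - 1) (frag_of (p, x, bd Y (m - p) y))"
  by (simp add: formal_bd_def)

lemma frag_of_formal_tensors [simp]:
  "frag_of (p, x, y) \<in> formal_tensors X Y m \<longleftrightarrow> x \<in> carrier (obj X p) \<and> y \<in> carrier (obj Y (m - p))"
  by (auto simp: formal_tensors_def tensor_symbols_def)

lemma additive_formal_tensors:
  assumes "z \<in> formal_tensors X Y m" "additive f" "subgp A"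
    and "\<And>p x y. x \<in> carrier (obj X p) \<Longrightarrow> y \<in> carrier (obj Y (m - p)) \<Longrightarrow> f (frag_of (p, x, y)) \<in> A"
  shows "f z \<in> A"
proof -
  interpret additive f by fact
  have "keys z \<subseteq> tensor_symbols X Y m" using assms(1) by (simp add: formal_tensors_def)
  then show ?thesis
    by (induction z rule: frag_induction)
      (use assms in \<open>auto simp: zero diff subgp_zero subgp_diff tensor_symbols_def\<close>)
qed

lemma additive_balanced_kernel:
  assumes "z \<in> balanced_kernel K X Y m" "additive f" "subgp A"
    and "\<And>p x x' y. x \<in> carrier (obj X p) \<Longrightarrow> x' \<in> carrier (obj X p) \<Longrightarrow> y \<in> carrier (obj Y (m - p)) \<Longrightarrow>
        f (frag_of (p, x \<oplus>\<^bsub>obj X p\<^esub> x', y)) - f (frag_of (p, x, y)) - f (frag_of (p, x', y)) \<in> A"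
    and "\<And>p x y y'. x \<in> carrier (obj X p) \<Longrightarrow> y \<in> carrier (obj Y (m - p)) \<Longrightarrow> y' \<in> carrier (obj Y (m - p)) \<Longrightarrow>
        f (frag_of (p, x, y \<oplus>\<^bsub>obj Y (m - p)\<^esub> y')) - f (frag_of (p, x, y)) - f (frag_of (p, x, y')) \<in> A"
    and "\<And>p l x y. l \<in> K \<Longrightarrow> x \<in> carrier (obj X p) \<Longrightarrow> y \<in> carrier (obj Y (m - p)) \<Longrightarrow>
        f (frag_of (p, l \<odot>\<^bsub>obj X p\<^esub> x, y)) - f (frag_of (p, x, l \<odot>\<^bsub>obj Y (m - p)\<^esub> y)) \<in> A"
  shows "f z \<in> A"
proof -
  interpret additive f by fact
  show ?thesis
    by (rule additive_group_closure[OF assms(2) _ assms(3) assms(1)[unfolded balanced_kernel_def]])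
      (use assms(4-6) in \<open>auto simp: bilinear_relators_def balanced_relators_def diff\<close>)
qed

lemma balanced_kernel_mono:
  assumes "K \<subseteq> K'" shows "balanced_kernel K X Y m \<subseteq> balanced_kernel K' X Y m"
proof -
  have "balanced_relators K X Y m \<subseteq> balanced_relators K' X Y m"
    using assms unfolding balanced_relators_def by blast
  then show ?thesis
    unfolding balanced_kernel_def
    by (intro group_closure_least[OF subgp_group_closure] subsetI group_closure.base) blast
qed

locale tensor_pair = E: lam_complex n E + P: lam_complex n P
  for n and E :: "('k::field lam, 'a) gcomplex" and P :: "('k lam, 'b) gcomplex"
begin

abbreviation "X \<equiv> formal_tensors E P"
abbreviation "J K \<equiv> balanced_kernel K E P"
abbreviation "D \<equiv> formal_bd E P"

sublocale D: additive "D m" for m by (rule additive_formal_bd)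

lemma J_add_left: "x \<in> carrier (obj E p) \<Longrightarrow> x' \<in> carrier (obj E p) \<Longrightarrow> y \<in> carrier (obj P (m - p)) \<Longrightarrow>
    frag_of (p, x \<oplus>\<^bsub>obj E p\<^esub> x', y) - frag_of (p, x, y) - frag_of (p, x', y) \<in> J K m"
  unfolding balanced_kernel_def bilinear_relators_def by (intro group_closure.base) blast

lemma J_add_right: "x \<in> carrier (obj E p) \<Longrightarrow> y \<in> carrier (obj P (m - p)) \<Longrightarrow> y' \<in> carrier (obj P (m - p)) \<Longrightarrow>
    frag_of (p, x, y \<oplus>\<^bsub>obj P (m - p)\<^esub> y') - frag_of (p, x, y) - frag_of (p, x, y') \<in> J K m"
  unfolding balanced_kernel_def bilinear_relators_def by (intro group_closure.base) blast

lemma J_balanced: "l \<in> K \<Longrightarrow> x \<in> carrier (obj E p) \<Longrightarrow> y \<in> carrier (obj P (m - p)) \<Longrightarrow>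
    frag_of (p, l \<odot>\<^bsub>obj E p\<^esub> x, y) - frag_of (p, x, l \<odot>\<^bsub>obj P (m - p)\<^esub> y) \<in> J K m"
  unfolding balanced_kernel_def balanced_relators_def by (intro group_closure.base) blast

lemma J_zero_left: "y \<in> carrier (obj P (m - p)) \<Longrightarrow> frag_of (p, \<zero>\<^bsub>obj E p\<^esub>, y) \<in> J K m"
  using J_add_left[of "\<zero>\<^bsub>obj E p\<^esub>" p "\<zero>\<^bsub>obj E p\<^esub>" y m K]
    subgp_minus[OF subgp_balanced_kernel, of "- frag_of (p, \<zero>\<^bsub>obj E p\<^esub>, y)"] by simp

lemma J_zero_right: "x \<in> carrier (obj E p) \<Longrightarrow> frag_of (p, x, \<zero>\<^bsub>obj P (m - p)\<^esub>) \<in> J K m"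
  using J_add_right[of x p "\<zero>\<^bsub>obj P (m - p)\<^esub>" m "\<zero>\<^bsub>obj P (m - p)\<^esub>" K]
    subgp_minus[OF subgp_balanced_kernel, of "- frag_of (p, x, \<zero>\<^bsub>obj P (m - p)\<^esub>)"] by simp

lemma J_finsum_right:
  assumes "x \<in> carrier (obj E p)" "finite A" "f \<in> A \<rightarrow> carrier (obj P (m - p))"
  shows "frag_of (p, x, \<Oplus>\<^bsub>obj P (m - p)\<^esub>a\<in>A. f a) - (\<Sum>a\<in>A. frag_of (p, x, f a)) \<in> J K m"
  using assms(2,3)
proof (induction A rule: finite_induct)
  case empty
  then show ?case using J_zero_right[OF assms(1)] by simp
next
  case (insert a A)
  then have c: "f a \<in> carrier (obj P (m - p))" "f \<in> A \<rightarrow> carrier (obj P (m - p))" by auto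
  have "(\<Oplus>\<^bsub>obj P (m - p)\<^esub>a\<in>A. f a) \<in> carrier (obj P (m - p))" using c by simp
  from subgp_add[OF subgp_balanced_kernel J_add_right[OF assms(1) c(1) this] insert.IH[OF c(2)]]
  show ?case using insert c by (simp add: algebra_simps)
qed

lemma J_subset_X: "K \<subseteq> carrier (Lambda n) \<Longrightarrow> J K m \<subseteq> X m"
proof
  fix z assume K: "K \<subseteq> carrier (Lambda n)" and z: "z \<in> J K m"
  note sg = subgp_diff[OF subgp_formal_tensors]
  have "(\<lambda>z. z) z \<in> X m"
    by (rule additive_balanced_kernel[OF z _ subgp_formal_tensors])
      (use K in \<open>auto simp: additive_def intro!: sg\<close>)
  then show "z \<in> X m" .
qed

lemma formal_map_X:
  assumes "\<And>p x. x \<in> carrier (obj E p) \<Longrightarrow> f p x \<in> carrier (obj E p)"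
    and "\<And>j y. y \<in> carrier (obj P j) \<Longrightarrow> h j y \<in> carrier (obj P j)" and "u \<in> X m"
  shows "formal_map f h m u \<in> X m"
  by (rule additive_formal_tensors[OF assms(3) additive_formal_map subgp_formal_tensors])
    (use assms in auto)

lemma formal_map_J:
  assumes K: "K \<subseteq> carrier (Lambda n)"
    and f: "\<And>p x. x \<in> carrier (obj E p) \<Longrightarrow> f p x \<in> carrier (obj E p)"
      "\<And>p x x'. x \<in> carrier (obj E p) \<Longrightarrow> x' \<in> carrier (obj E p) \<Longrightarrow> f p (x \<oplus>\<^bsub>obj E p\<^esub> x') = f p x \<oplus>\<^bsub>obj E p\<^esub> f p x'"
      "\<And>p l x. l \<in> K \<Longrightarrow> x \<in> carrier (obj E p) \<Longrightarrow> f p (l \<odot>\<^bsub>obj E p\<^esub> x) = l \<odot>\<^bsub>obj E p\<^esub> f p x"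
    and h: "\<And>j y. y \<in> carrier (obj P j) \<Longrightarrow> h j y \<in> carrier (obj P j)"
      "\<And>j y y'. y \<in> carrier (obj P j) \<Longrightarrow> y' \<in> carrier (obj P j) \<Longrightarrow> h j (y \<oplus>\<^bsub>obj P j\<^esub> y') = h j y \<oplus>\<^bsub>obj P j\<^esub> h j y'"
      "\<And>j l y. l \<in> K \<Longrightarrow> y \<in> carrier (obj P j) \<Longrightarrow> h j (l \<odot>\<^bsub>obj P j\<^esub> y) = l \<odot>\<^bsub>obj P j\<^esub> h j y"
    and u: "u \<in> J K m"
  shows "formal_map f h m u \<in> J K m"
  by (rule additive_balanced_kernel[OF u additive_formal_map subgp_balanced_kernel])
    (use f h K in \<open>auto intro!: J_add_left J_add_right J_balanced\<close>)

lemma formal_map_D: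
  assumes f: "\<And>p x. x \<in> carrier (obj E p) \<Longrightarrow> bd E p (f p x) = f (p + 1) (bd E p x)"
    and h: "\<And>j y. y \<in> carrier (obj P j) \<Longrightarrow> bd P j (h j y) = h (j + 1) (bd P j y)"
    and u: "u \<in> X m"
  shows "D m (formal_map f h m u) = formal_map f h (m + 1) (D m u)"
proof -
  interpret fm: additive "formal_map f h i" for i by (rule additive_formal_map)
  have idx: "m + 1 - p = m - p + 1" for p :: int by simp
  have "D m (formal_map f h m u) - formal_map f h (m + 1) (D m u) \<in> {0}"
  proof (rule additive_formal_tensors[OF u, where f = "\<lambda>u. D m (formal_map f h m u) - formal_map f h (m + 1) (D m u)"])
    show "additive (\<lambda>u. D m (formal_map f h m u) - formal_map f h (m + 1) (D m u))"
      by (simp add: additive_def D.add fm.add)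
    fix p x y assume "x \<in> carrier (obj E p)" "y \<in> carrier (obj P (m - p))"
    then show "D m (formal_map f h m (frag_of (p, x, y))) - formal_map f h (m + 1) (D m (frag_of (p, x, y))) \<in> {0}"
      by (simp add: formal_bd_of f h fm.add fm.minus idx)
  qed (simp add: subgp_def)
  then show ?thesis by simp
qed

lemma D_X: "u \<in> X m \<Longrightarrow> D m u \<in> X (m + 1)"
proof (rule additive_formal_tensors[OF _ additive_formal_bd subgp_formal_tensors])
  fix p x y assume "x \<in> carrier (obj E p)" "y \<in> carrier (obj P (m - p))"
  then show "D m (frag_of (p, x, y)) \<in> X (m + 1)"
    using P.bd_closed[of y "m - p"]
    by (simp add: formal_bd_of diff_add_eq subgp_add[OF subgp_formal_tensors] subgp_minus[OF subgp_formal_tensors]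
        del: P.bd_closed)
qed

lemma J_signed: "a \<in> J K m \<Longrightarrow> frag_cmul (if even (p::int) then 1 else - 1) a \<in> J K m"
  using subgp_minus[OF subgp_balanced_kernel, of a K E P m] by simp

lemma D_J:
  assumes K: "K \<subseteq> carrier (Lambda n)" and u: "u \<in> J K m"
  shows "D m u \<in> J K (m + 1)"
proof (rule additive_balanced_kernel[OF u additive_formal_bd subgp_balanced_kernel])
  note sg = subgp_add[OF subgp_balanced_kernel]
  have idx: "m + 1 - p = m - p + 1" "m + 1 - (p + 1) = m - p" for p :: int by simp_all
  fix p y assume y: "y \<in> carrier (obj P (m - p))"
  show "D m (frag_of (p, x \<oplus>\<^bsub>obj E p\<^esub> x', y)) - D m (frag_of (p, x, y)) - D m (frag_of (p, x', y)) \<in> J K (m + 1)"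
    if c: "x \<in> carrier (obj E p)" "x' \<in> carrier (obj E p)" for x x'
  proof -
    have 1: "frag_of (p + 1, bd E p x \<oplus>\<^bsub>obj E (p + 1)\<^esub> bd E p x', y) - frag_of (p + 1, bd E p x, y) - frag_of (p + 1, bd E p x', y) \<in> J K (m + 1)"
      using c y by (intro J_add_left) (simp_all add: idx)
    have 2: "frag_of (p, x \<oplus>\<^bsub>obj E p\<^esub> x', bd P (m - p) y) - frag_of (p, x, bd P (m - p) y) - frag_of (p, x', bd P (m - p) y) \<in> J K (m + 1)"
      using c y by (intro J_add_left) (simp_all add: idx)
    show ?thesis
      using sg[OF 1 J_signed[OF 2, of p]] c y by (simp add: formal_bd_of algebra_simps split: if_splits)
  qed
  fix x assume x: "x \<in> carrier (obj E p)"
  show "D m (frag_of (p, x, y \<oplus>\<^bsub>obj P (m - p)\<^esub> y')) - D m (frag_of (p, x, y)) - D m (frag_of (p, x, y')) \<in> J K (m + 1)"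
    if c: "y' \<in> carrier (obj P (m - p))" for y'
  proof -
    have 1: "frag_of (p + 1, bd E p x, y \<oplus>\<^bsub>obj P (m - p)\<^esub> y') - frag_of (p + 1, bd E p x, y) - frag_of (p + 1, bd E p x, y') \<in> J K (m + 1)"
      using J_add_right[of "bd E p x" "p + 1" y "m + 1" y' K] c x y by (simp add: idx)
    have 2: "frag_of (p, x, bd P (m - p) y \<oplus>\<^bsub>obj P (m - p + 1)\<^esub> bd P (m - p) y') - frag_of (p, x, bd P (m - p) y) - frag_of (p, x, bd P (m - p) y') \<in> J K (m + 1)"
      using J_add_right[of x p "bd P (m - p) y" "m + 1" "bd P (m - p) y'" K] c x y by (simp add: idx)
    show ?thesis
      using sg[OF 1 J_signed[OF 2, of p]] c x y by (simp add: formal_bd_of algebra_simps split: if_splits)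
  qed
  show "D m (frag_of (p, l \<odot>\<^bsub>obj E p\<^esub> x, y)) - D m (frag_of (p, x, l \<odot>\<^bsub>obj P (m - p)\<^esub> y)) \<in> J K (m + 1)"
    if c: "l \<in> K" for l
  proof -
    have l: "l \<in> carrier (Lambda n)" using c K by blast
    have 1: "frag_of (p + 1, l \<odot>\<^bsub>obj E (p + 1)\<^esub> bd E p x, y) - frag_of (p + 1, bd E p x, l \<odot>\<^bsub>obj P (m - p)\<^esub> y) \<in> J K (m + 1)"
      using J_balanced[of l K "bd E p x" "p + 1" y "m + 1"] c x y by (simp add: idx)
    have 2: "frag_of (p, l \<odot>\<^bsub>obj E p\<^esub> x, bd P (m - p) y) - frag_of (p, x, l \<odot>\<^bsub>obj P (m - p + 1)\<^esub> bd P (m - p) y) \<in> J K (m + 1)"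
      using J_balanced[of l K x p "bd P (m - p) y" "m + 1"] c x y by (simp add: idx)
    show ?thesis
      using sg[OF 1 J_signed[OF 2, of p]] c l x y by (simp add: formal_bd_of algebra_simps split: if_splits)
  qed
qed

lemma D_D: "u \<in> X m \<Longrightarrow> D (m + 1) (D m u) \<in> J K (m + 2)"
proof (rule additive_formal_tensors[OF _ _ subgp_balanced_kernel, where f = "\<lambda>u. D (m + 1) (D m u)"])
  show "additive (\<lambda>u. D (m + 1) (D m u))"
    by (simp add: additive_def D.add)
  fix p x y assume c: "x \<in> carrier (obj E p)" "y \<in> carrier (obj P (m - p))"
  have idx: "m + 1 - p = m - p + 1" "m + 1 - (p + 1) = m - p" "p + 1 + 1 = p + 2" for p :: int by simp_all
  have "frag_of (p + 2, \<zero>\<^bsub>obj E (p + 2)\<^esub>, y) \<in> J K (m + 2)"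
    using c by (intro J_zero_left) (simp add: algebra_simps)
  moreover have "frag_of (p, x, \<zero>\<^bsub>obj P (m - p + 2)\<^esub>) \<in> J K (m + 2)"
    using J_zero_right[of x p "m + 2" K] c by (simp add: algebra_simps)
  ultimately have "frag_of (p + 2, \<zero>\<^bsub>obj E (p + 2)\<^esub>, y) + frag_of (p, x, \<zero>\<^bsub>obj P (m - p + 2)\<^esub>) \<in> J K (m + 2)"
    by (rule subgp_add[OF subgp_balanced_kernel])
  then show "D (m + 1) (D m (frag_of (p, x, y))) \<in> J K (m + 2)"
    using c by (simp add: formal_bd_of D.add D.minus idx)
qed

lemma quotient_complex: "K \<subseteq> carrier (Lambda n) \<Longrightarrow> quotient_complex X (J K) D"
  by unfold_locales
    (auto simp: D_X D_J D_D subgp_formal_tensors subgp_balanced_kernel D.add dest: J_subset_X)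


abbreviation left_smult :: "'k lam \<Rightarrow> int \<Rightarrow> ('a, 'b) formal_tensor \<Rightarrow> ('a, 'b) formal_tensor" where
  "left_smult l \<equiv> formal_map (\<lambda>p e. l \<odot>\<^bsub>obj E p\<^esub> e) (\<lambda>j q. q)"

abbreviation right_smult :: "'k lam \<Rightarrow> int \<Rightarrow> ('a, 'b) formal_tensor \<Rightarrow> ('a, 'b) formal_tensor" where
  "right_smult l \<equiv> formal_map (\<lambda>p e. e) (\<lambda>j q. l \<odot>\<^bsub>obj P j\<^esub> q)"

lemma J_diff_balanced:
  "l \<in> carrier (Lambda n) \<Longrightarrow> l \<in> K \<Longrightarrow> u \<in> X m \<Longrightarrow>
    left_smult l m u - right_smult l m u \<in> J K m"
proof -
  assume l: "l \<in> carrier (Lambda n)" "l \<in> K" and u: "u \<in> X m"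
  interpret L: additive "left_smult l i" for i
    by (rule additive_formal_map)
  interpret R: additive "right_smult l i" for i
    by (rule additive_formal_map)
  show ?thesis
    by (rule additive_formal_tensors[OF u, where f = "\<lambda>u. left_smult l m u - right_smult l m u", OF _ subgp_balanced_kernel])
      (use l in \<open>auto simp: additive_def L.add R.add intro!: J_balanced\<close>)
qed

text \<open>
  The new relators are the values of one operator on the generators. Adding a variable to the
  ground ring therefore means passing to the cokernel of the difference of its two actions.
\<close>

lemma J_insert:
  assumes "l \<in> carrier (Lambda n)" "K \<subseteq> carrier (Lambda n)"
  shows "J (insert l K) m = {j + (left_smult l m u
      - right_smult l m u) | j u. j \<in> J K m \<and> u \<in> X m}" (is "_ = ?A")
proof
  interpret L: additive "left_smult l i" for i
    by (rule additive_formal_map)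
  interpret R: additive "right_smult l i" for i
    by (rule additive_formal_map)
  let ?t = "\<lambda>u. left_smult l m u - right_smult l m u"
  have AI: "z \<in> ?A" if "z - ?t u \<in> J K m" "u \<in> X m" for z u
  proof -
    have "z = (z - ?t u) + ?t u" by simp
    then show ?thesis using that by blast
  qed
  have sub: "subgp ?A"
    unfolding subgp_def
  proof (intro conjI ballI)
    show "0 \<in> ?A"
      by (rule AI[of _ 0]) (simp_all add: L.zero R.zero subgp_zero subgp_formal_tensors subgp_balanced_kernel)
    fix a b assume "a \<in> ?A" "b \<in> ?A"
    then obtain j u j' u' where j: "a = j + ?t u" "b = j' + ?t u'" "j \<in> J K m" "j' \<in> J K m" "u \<in> X m" "u' \<in> X m"
      by blast
    show "a - b \<in> ?A"
      by (rule AI[of _ "u - u'"])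
        (use j in \<open>simp_all add: L.diff R.diff subgp_diff[OF subgp_formal_tensors] subgp_diff[OF subgp_balanced_kernel]\<close>)
  qed
  have JA: "z \<in> ?A" if "z \<in> J K m" for z
    by (rule AI[of _ 0]) (use that in \<open>simp_all add: L.zero R.zero subgp_zero subgp_formal_tensors\<close>)
  show "J (insert l K) m \<subseteq> ?A"
    unfolding balanced_kernel_def[of "insert l K"]
  proof (rule group_closure_least[OF sub], rule subsetI)
    fix z assume "z \<in> bilinear_relators E P m \<union> balanced_relators (insert l K) E P m"
    then consider "z \<in> bilinear_relators E P m \<union> balanced_relators K E P m"
      | p x y where "z = frag_of (p, l \<odot>\<^bsub>obj E p\<^esub> x, y) - frag_of (p, x, l \<odot>\<^bsub>obj P (m - p)\<^esub> y)"
        "x \<in> carrier (obj E p)" "y \<in> carrier (obj P (m - p))"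
      unfolding balanced_relators_def by blast
    then show "z \<in> ?A"
    proof cases
      case 1
      then show ?thesis
        by (intro JA) (auto simp: balanced_kernel_def intro: group_closure.base)
    next
      case 2
      then show ?thesis
        by (intro AI[of _ "frag_of (p, x, y)"]) (simp_all add: subgp_zero subgp_balanced_kernel)
    qed
  qed
  show "?A \<subseteq> J (insert l K) m"
  proof
    fix z assume "z \<in> ?A"
    then obtain j u where "z = j + ?t u" "j \<in> J K m" "u \<in> X m" by blast
    then show "z \<in> J (insert l K) m"
      using J_diff_balanced[OF assms(1), of "insert l K" u m] balanced_kernel_mono[of K "insert l K" E P m]
      by (auto intro!: subgp_add[OF subgp_balanced_kernel])
  qed
qed

text \<open>
  The scalars over which the tensor product is balanced form a subring, and \<open>\<Lambda>\<close> is generated by the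
  constants and the variables.
\<close>

lemma J_all:
  assumes K: "K \<subseteq> carrier (Lambda n)" and const: "range (Lambda_const n) \<subseteq> K" and var: "\<And>i. 1 \<le> i \<Longrightarrow> xvar n i \<in> K"
  shows "J (carrier (Lambda n)) m = J K m"
proof
  show "J K m \<subseteq> J (carrier (Lambda n)) m" using K by (rule balanced_kernel_mono)
  have bal: "\<forall>p. \<forall>x\<in>carrier (obj E p). \<forall>y\<in>carrier (obj P (m - p)).
      frag_of (p, l \<odot>\<^bsub>obj E p\<^esub> x, y) - frag_of (p, x, l \<odot>\<^bsub>obj P (m - p)\<^esub> y) \<in> J K m"
    if "l \<in> carrier (Lambda n)" for l
    using that
  proof (induction l rule: Lambda_induct)
    case (const c)
    then show ?case using assms(2) by (auto intro!: J_balanced)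
  next
    case (var i)
    then show ?case using assms(3) by (auto intro!: J_balanced)
  next
    case (add l l')
    show ?case
    proof (intro allI ballI)
      fix p x y assume c: "x \<in> carrier (obj E p)" "y \<in> carrier (obj P (m - p))"
      note sg = subgp_add[OF subgp_balanced_kernel] subgp_diff[OF subgp_balanced_kernel]
      have 1: "frag_of (p, l \<odot>\<^bsub>obj E p\<^esub> x \<oplus>\<^bsub>obj E p\<^esub> l' \<odot>\<^bsub>obj E p\<^esub> x, y) - frag_of (p, l \<odot>\<^bsub>obj E p\<^esub> x, y) - frag_of (p, l' \<odot>\<^bsub>obj E p\<^esub> x, y) \<in> J K m"
        using c add by (intro J_add_left) simp_all
      have 2: "frag_of (p, x, l \<odot>\<^bsub>obj P (m - p)\<^esub> y \<oplus>\<^bsub>obj P (m - p)\<^esub> l' \<odot>\<^bsub>obj P (m - p)\<^esub> y) - frag_of (p, x, l \<odot>\<^bsub>obj P (m - p)\<^esub> y) - frag_of (p, x, l' \<odot>\<^bsub>obj P (m - p)\<^esub> y) \<in> J K m"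
        using c add by (intro J_add_right) simp_all
      have 3: "frag_of (p, l \<odot>\<^bsub>obj E p\<^esub> x, y) - frag_of (p, x, l \<odot>\<^bsub>obj P (m - p)\<^esub> y) \<in> J K m"
        "frag_of (p, l' \<odot>\<^bsub>obj E p\<^esub> x, y) - frag_of (p, x, l' \<odot>\<^bsub>obj P (m - p)\<^esub> y) \<in> J K m"
        using add c by blast+
      from sg(2)[OF sg(1)[OF sg(1)[OF 1 3(1)] 3(2)] 2]
      show "frag_of (p, (l \<oplus>\<^bsub>Lambda n\<^esub> l') \<odot>\<^bsub>obj E p\<^esub> x, y) - frag_of (p, x, (l \<oplus>\<^bsub>Lambda n\<^esub> l') \<odot>\<^bsub>obj P (m - p)\<^esub> y) \<in> J K m"
        using c add by (simp add: E.M.smult_l_distr P.M.smult_l_distr)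
    qed
  next
    case (mult l l')
    show ?case
    proof (intro allI ballI)
      fix p x y assume c: "x \<in> carrier (obj E p)" "y \<in> carrier (obj P (m - p))"
      have 1: "frag_of (p, l \<odot>\<^bsub>obj E p\<^esub> (l' \<odot>\<^bsub>obj E p\<^esub> x), y) - frag_of (p, l' \<odot>\<^bsub>obj E p\<^esub> x, l \<odot>\<^bsub>obj P (m - p)\<^esub> y) \<in> J K m"
        using mult c by simp
      have 2: "frag_of (p, l' \<odot>\<^bsub>obj E p\<^esub> x, l \<odot>\<^bsub>obj P (m - p)\<^esub> y) - frag_of (p, x, l' \<odot>\<^bsub>obj P (m - p)\<^esub> (l \<odot>\<^bsub>obj P (m - p)\<^esub> y)) \<in> J K m"
        using mult c by simp
      have eq: "l' \<odot>\<^bsub>obj P (m - p)\<^esub> (l \<odot>\<^bsub>obj P (m - p)\<^esub> y) = (l \<otimes>\<^bsub>Lambda n\<^esub> l') \<odot>\<^bsub>obj P (m - p)\<^esub> y"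
        using mult c by (subst cring.cring_simprules(14)[OF cring_Lambda]) (simp_all add: P.M.smult_assoc1)
      from subgp_trans[OF subgp_balanced_kernel 1 2]
      show "frag_of (p, (l \<otimes>\<^bsub>Lambda n\<^esub> l') \<odot>\<^bsub>obj E p\<^esub> x, y) - frag_of (p, x, (l \<otimes>\<^bsub>Lambda n\<^esub> l') \<odot>\<^bsub>obj P (m - p)\<^esub> y) \<in> J K m"
        unfolding eq using c mult by (simp add: E.M.smult_assoc1)
    qed
  qed
  show "J (carrier (Lambda n)) m \<subseteq> J K m"
    unfolding balanced_kernel_def[of "carrier (Lambda n)"]
  proof (rule group_closure_least[OF subgp_balanced_kernel], rule subsetI)
    fix z assume "z \<in> bilinear_relators E P m \<union> balanced_relators (carrier (Lambda n)) E P m"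
    then show "z \<in> J K m"
      using bal by (auto simp: balanced_relators_def balanced_kernel_def intro: group_closure.base)
  qed
qed

lemma tensor_kernel_eq: "tensor_kernel n E P m = J (carrier (Lambda n)) m"
proof -
  let ?F = "free_Abelian_group (tensor_symbols E P m)"
  let ?R = "bilinear_relators E P m \<union> balanced_relators (carrier (Lambda n)) E P m"
  have R: "tensor_relators n E P m = ?R"
    unfolding tensor_relators_def bilinear_relators_def balanced_relators_def by (rule refl)
  have RX: "?R \<subseteq> X m"
    using J_subset_X[OF order.refl, of m] unfolding balanced_kernel_def by (auto intro: group_closure.base)
  interpret F: group ?F by simp
  have "group_closure ?R \<subseteq> generate ?F ?R"
  proof
    fix z assume "z \<in> group_closure ?R"
    then show "z \<in> generate ?F ?R"
    proof induction
      case (base s)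
      then show ?case using generate.one[of ?F ?R] generate.incl[of _ ?R ?F] by auto
    next
      case (diff s t)
      have RF: "?R \<subseteq> carrier ?F" using RX by (auto simp: formal_tensors_def)
      have "keys t \<subseteq> tensor_symbols E P m"
        using F.generate_in_carrier[OF RF diff(4)] by simp
      then show ?case
        using generate.eng[OF diff(3) F.generate_m_inv_closed[OF RF diff(4)]] by simp
    qed
  qed
  moreover have "generate ?F ?R \<subseteq> group_closure ?R"
  proof
    fix z assume "z \<in> generate ?F ?R"
    then show "z \<in> group_closure ?R"
    proof induction
      case (inv h)
      then have "keys h \<subseteq> tensor_symbols E P m" using RX by (auto simp: formal_tensors_def)
      then show ?case using inv by (auto intro: group_closure.base)
    qed (auto intro: group_closure.base group_closure_add)
  qed
  ultimately show ?thesis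
    unfolding tensor_kernel_def R balanced_kernel_def by blast
qed

lemma tensor_class_eq: "tensor_class n E P m z = {j + z | j. j \<in> J (carrier (Lambda n)) m}"
  by (auto simp: tensor_class_def r_coset_def tensor_kernel_eq)

lemma tensor_class_eq_iff: "tensor_class n E P m z = tensor_class n E P m w \<longleftrightarrow> z - w \<in> J (carrier (Lambda n)) m"
proof
  note sg = subgp_balanced_kernel[of "carrier (Lambda n)" E P m]
  have in_iff: "a \<in> tensor_class n E P m b \<longleftrightarrow> a - b \<in> J (carrier (Lambda n)) m" for a b
    unfolding tensor_class_eq by (auto intro!: exI[of _ "a - b"])
  {
    assume "tensor_class n E P m z = tensor_class n E P m w"
    moreover have "z \<in> tensor_class n E P m z" unfolding in_iff using subgp_zero[OF sg] by simp
    ultimately show "z - w \<in> J (carrier (Lambda n)) m" by (simp add: in_iff)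
  next
    assume zw: "z - w \<in> J (carrier (Lambda n)) m"
    have "a - z \<in> J (carrier (Lambda n)) m \<longleftrightarrow> a - w \<in> J (carrier (Lambda n)) m" for a
      using subgp_cong[OF sg, of "a - w" "a - z"] zw by simp
    then show "tensor_class n E P m z = tensor_class n E P m w"
      unfolding set_eq_iff in_iff by blast
  }
qed

lemma carrier_tensor_obj: "carrier (tensor_obj n E P m) = tensor_class n E P m ` X m"
  by (auto simp: tensor_obj_def tensor_group_def FactGroup_def RCOSETS_def tensor_class_def formal_tensors_def)

lemma tensor_class_zero: "tensor_class n E P m 0 = J (carrier (Lambda n)) m"
  by (auto simp: tensor_class_eq)

lemma zero_tensor_obj: "\<zero>\<^bsub>tensor_obj n E P m\<^esub> = tensor_class n E P m 0"
  by (simp add: tensor_obj_def tensor_group_def FactGroup_def tensor_kernel_eq tensor_class_zero)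

lemma tensor_bd_class: "tensor_bd n E P m (tensor_class n E P m z) = tensor_class n E P (m + 1) (D m z)"
proof -
  have eq: "tensor_class n E P (m + 1) (D m w) = tensor_class n E P (m + 1) (D m z)"
    if "w \<in> tensor_class n E P m z" for w
    using that D_J[OF order.refl] unfolding tensor_class_eq_iff by (auto simp: tensor_class_eq D.add)
  have "z \<in> tensor_class n E P m z"
    using subgp_zero[OF subgp_balanced_kernel] by (auto simp: tensor_class_eq)
  then show ?thesis
    unfolding tensor_bd_def formal_bd_def[symmetric] using eq by blast
qed

end

lemma zero_in_D_iff:
  fixes X :: "('k::field lam, 'a) gcomplex"
  shows "zero_in_D n X \<longleftrightarrow> (\<forall>i. cocycles X i \<noteq> {} \<and> cocycles X i \<subseteq> coboundaries X i)"
proof -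
  have hom: "graded_hom n (obj X i) (obj zero_complex i) (\<lambda>_. ())" for i
    by (auto simp: graded_hom_def hom_def zero_complex_def zero_gmod_def)
  then have cm: "chain_map n X zero_complex (\<lambda>_ _. ())"
    by (auto simp: chain_map_def)
  have cob: "() \<in> coboundaries (zero_complex :: ('k lam, unit) gcomplex) i" for i
    by (auto simp: coboundaries_def zero_complex_def zero_gmod_def)
  have coc: "() \<in> cocycles (zero_complex :: ('k lam, unit) gcomplex) i" for i
    by (auto simp: cocycles_def zero_complex_def zero_gmod_def)
  show ?thesis
    unfolding zero_in_D_def quasi_iso_def using cm cob coc by (auto simp: subset_iff)
qed

lemma (in tensor_pair) zero_in_D_tensor_iff:
  "zero_in_D n (tensor_complex n E P) \<longleftrightarrow> acyclic_mod X (J (carrier (Lambda n))) D"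
proof -
  have coc: "cocycles (tensor_complex n E P) m = tensor_class n E P m ` {z \<in> X m. D m z \<in> J (carrier (Lambda n)) (m + 1)}" for m
  proof -
    have "cocycles (tensor_complex n E P) m =
        tensor_class n E P m ` {z \<in> X m. tensor_bd n E P m (tensor_class n E P m z) = tensor_class n E P (m + 1) 0}"
      unfolding cocycles_def by (auto simp: tensor_complex_def carrier_tensor_obj zero_tensor_obj)
    then show ?thesis by (simp only: tensor_bd_class tensor_class_eq_iff diff_zero)
  qed
  have cob: "coboundaries (tensor_complex n E P) m = (\<lambda>u. tensor_class n E P m (D (m - 1) u)) ` X (m - 1)" for m
    unfolding coboundaries_def tensor_complex_def
    using tensor_bd_class[of "m - 1"] by (auto simp: carrier_tensor_obj image_image)
  have "0 \<in> {z \<in> X m. D m z \<in> J (carrier (Lambda n)) (m + 1)}" for m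
    by (simp add: D.zero subgp_zero[OF subgp_formal_tensors] subgp_zero[OF subgp_balanced_kernel])
  then have "cocycles (tensor_complex n E P) m \<noteq> {}" for m
    unfolding coc by blast
  then show ?thesis
    unfolding zero_in_D_iff acyclic_mod_def coc cob
    by (fastforce simp: tensor_class_eq_iff image_iff subset_iff)
qed

section \<open>Free modules and the Frobenius structure\<close>

locale free_module = Module.module "Lambda n" M
  for n and M :: "('k::field lam, 'a) gmod" (structure) +
  fixes B :: "'a set"
  assumes B: "B \<subseteq> carrier M" and span: "lin_span n M B = carrier M" and indep: "lin_indep n M B"
begin

definition comb :: "('a \<Rightarrow> 'k lam) \<Rightarrow> 'a set \<Rightarrow> 'a" where
  "comb c A = (\<Oplus>b\<in>A. c b \<odot> b)"

definition coordinates :: "('a \<Rightarrow> 'k lam) \<Rightarrow> 'a \<Rightarrow> bool" where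
  "coordinates c x \<longleftrightarrow> (\<forall>b. c b \<in> carrier (Lambda n)) \<and>
     (\<exists>A. finite A \<and> A \<subseteq> B \<and> (\<forall>b. b \<notin> A \<longrightarrow> c b = \<zero>\<^bsub>Lambda n\<^esub>) \<and> x = comb c A)"

lemma comb_closed: "A \<subseteq> B \<Longrightarrow> (\<And>b. b \<in> A \<Longrightarrow> c b \<in> carrier (Lambda n)) \<Longrightarrow> comb c A \<in> carrier M"
  unfolding comb_def using B by (intro M.finsum_closed) auto

lemma comb_mono:
  assumes "finite A'" "A \<subseteq> A'" "A' \<subseteq> B" "\<And>b. c b \<in> carrier (Lambda n)" "\<And>b. b \<notin> A \<Longrightarrow> c b = \<zero>\<^bsub>Lambda n\<^esub>"
  shows "comb c A = comb c A'"
  unfolding comb_def using assms B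
  by (intro M.add.finprod_mono_neutral_cong_left) auto

lemma comb_add:
  assumes "finite A" "A \<subseteq> B" "\<And>b. c b \<in> carrier (Lambda n)" "\<And>b. c' b \<in> carrier (Lambda n)"
  shows "comb (\<lambda>b. c b \<oplus>\<^bsub>Lambda n\<^esub> c' b) A = comb c A \<oplus> comb c' A"
proof -
  have *: "b \<in> carrier M" if "b \<in> A" for b using that assms B by blast
  have "comb (\<lambda>b. c b \<oplus>\<^bsub>Lambda n\<^esub> c' b) A = (\<Oplus>b\<in>A. c b \<odot> b \<oplus> c' b \<odot> b)"
    unfolding comb_def using assms * by (intro M.finsum_cong') (auto simp: smult_l_distr)
  then show ?thesis unfolding comb_def using assms * by (simp add: M.finsum_addf Pi_def)
qed

lemma comb_smult:
  assumes "finite A" "A \<subseteq> B" "\<And>b. c b \<in> carrier (Lambda n)" "l \<in> carrier (Lambda n)"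
  shows "comb (\<lambda>b. l \<otimes>\<^bsub>Lambda n\<^esub> c b) A = l \<odot> comb c A"
proof -
  have *: "b \<in> carrier M" if "b \<in> A" for b using that assms B by blast
  have "comb (\<lambda>b. l \<otimes>\<^bsub>Lambda n\<^esub> c b) A = (\<Oplus>b\<in>A. l \<odot> (c b \<odot> b))"
    unfolding comb_def using assms * by (intro M.finsum_cong') (auto simp: smult_assoc1)
  then show ?thesis unfolding comb_def using assms * by (simp add: finsum_smult_ldistr Pi_def)
qed

lemma ex_coordinates:
  assumes "x \<in> carrier M" shows "\<exists>c. coordinates c x"
proof -
  obtain A c where A: "finite A" "A \<subseteq> B" "c \<in> A \<rightarrow> carrier (Lambda n)" "x = (\<Oplus>b\<in>A. c b \<odot> b)"
    using assms unfolding span[symmetric] lin_span_def by blast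
  define c' where "c' b = (if b \<in> A then c b else \<zero>\<^bsub>Lambda n\<^esub>)" for b
  have "c b \<odot> b \<in> carrier M" if "b \<in> A" for b
    using that A B by (auto simp: Pi_iff)
  then have "x = comb c' A"
    unfolding A(4) comb_def c'_def using A(3) by (intro M.finsum_cong') (auto simp: Pi_iff)
  then show ?thesis
    using A unfolding coordinates_def by (intro exI[of _ c'] conjI exI[of _ A]) (auto simp: c'_def)
qed

lemma coordinates_add:
  assumes "coordinates c x" "coordinates c' x'"
  shows "coordinates (\<lambda>b. c b \<oplus>\<^bsub>Lambda n\<^esub> c' b) (x \<oplus> x')"
proof -
  obtain A A' where A: "finite A" "A \<subseteq> B" "\<And>b. b \<notin> A \<Longrightarrow> c b = \<zero>\<^bsub>Lambda n\<^esub>" "x = comb c A"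
    and A': "finite A'" "A' \<subseteq> B" "\<And>b. b \<notin> A' \<Longrightarrow> c' b = \<zero>\<^bsub>Lambda n\<^esub>" "x' = comb c' A'"
    using assms unfolding coordinates_def by metis
  have c: "c b \<in> carrier (Lambda n)" "c' b \<in> carrier (Lambda n)" for b
    using assms by (auto simp: coordinates_def)
  have "x = comb c (A \<union> A')" "x' = comb c' (A \<union> A')"
    unfolding A(4) A'(4) using A(1-3) A'(1-3) c by (auto intro!: comb_mono)
  then have "x \<oplus> x' = comb (\<lambda>b. c b \<oplus>\<^bsub>Lambda n\<^esub> c' b) (A \<union> A')"
    using A(1,2) A'(1,2) c by (simp add: comb_add)
  then show ?thesis
    using A A' c unfolding coordinates_def by (intro conjI exI[of _ "A \<union> A'"]) auto
qed

lemma coordinates_smult: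
  assumes "coordinates c x" "l \<in> carrier (Lambda n)"
  shows "coordinates (\<lambda>b. l \<otimes>\<^bsub>Lambda n\<^esub> c b) (l \<odot> x)"
proof -
  obtain A where A: "finite A" "A \<subseteq> B" "\<And>b. b \<notin> A \<Longrightarrow> c b = \<zero>\<^bsub>Lambda n\<^esub>" "x = comb c A"
    using assms unfolding coordinates_def by metis
  have c: "c b \<in> carrier (Lambda n)" for b
    using assms by (auto simp: coordinates_def)
  show ?thesis
    using A c assms(2) unfolding coordinates_def by (intro conjI exI[of _ A]) (auto simp: comb_smult)
qed

lemma coordinates_unique:
  assumes "coordinates c x" "coordinates c' x" shows "c = c'"
proof
  fix b
  have cc: "c b \<in> carrier (Lambda n)" "c' b \<in> carrier (Lambda n)" for b
    using assms by (auto simp: coordinates_def)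
  have x: "x \<in> carrier M" using assms(1) unfolding coordinates_def by (auto intro!: comb_closed)
  define l :: "'k lam" where "l = \<ominus>\<^bsub>Lambda n\<^esub> \<one>\<^bsub>Lambda n\<^esub>"
  have l: "l \<in> carrier (Lambda n)" "l \<odot> x = \<ominus> x" "l \<otimes>\<^bsub>Lambda n\<^esub> y = \<ominus>\<^bsub>Lambda n\<^esub> y"
    if "y \<in> carrier (Lambda n)" for y
    using x that by (simp_all add: l_def smult_l_minus R.l_minus)
  let ?d = "\<lambda>b. c b \<oplus>\<^bsub>Lambda n\<^esub> l \<otimes>\<^bsub>Lambda n\<^esub> c' b"
  have "coordinates ?d (x \<oplus> l \<odot> x)"
    using l(1)[OF cc(1)] by (intro coordinates_add assms coordinates_smult)
  moreover have "x \<oplus> l \<odot> x = \<zero>" using x l(2)[OF cc(1)] by (simp add: M.r_neg)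
  ultimately obtain A where A: "finite A" "A \<subseteq> B" "\<And>b. b \<notin> A \<Longrightarrow> ?d b = \<zero>\<^bsub>Lambda n\<^esub>" "\<zero> = comb ?d A"
    unfolding coordinates_def by auto
  have "?d \<in> A \<rightarrow> carrier (Lambda n)" using cc l(1)[OF cc(1)] by auto
  then have "\<forall>b\<in>A. ?d b = \<zero>\<^bsub>Lambda n\<^esub>"
    using indep[unfolded lin_indep_def] A(1,2) A(4)[symmetric] unfolding comb_def by blast
  then have "?d b = \<zero>\<^bsub>Lambda n\<^esub>" using A(3) by blast
  then have "c b \<ominus>\<^bsub>Lambda n\<^esub> c' b = \<zero>\<^bsub>Lambda n\<^esub>"
    using l(3)[OF cc(2), of b] by (simp add: a_minus_def)
  moreover have "c b = (c b \<ominus>\<^bsub>Lambda n\<^esub> c' b) \<oplus>\<^bsub>Lambda n\<^esub> c' b"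
    using cc[of b] by (simp add: a_minus_def R.a_assoc R.l_neg)
  ultimately show "c b = c' b" using cc(2)[of b] by simp
qed

definition coord :: "'a \<Rightarrow> 'a \<Rightarrow> 'k lam" where
  "coord x = (SOME c. coordinates c x)"

lemma coordinates_coord: "x \<in> carrier M \<Longrightarrow> coordinates (coord x) x"
  unfolding coord_def using ex_coordinates by (rule someI_ex)

lemma coord_eqI: "x \<in> carrier M \<Longrightarrow> coordinates c x \<Longrightarrow> coord x = c"
  by (rule coordinates_unique[OF coordinates_coord])

lemma coord_closed [simp]: "x \<in> carrier M \<Longrightarrow> coord x b \<in> carrier (Lambda n)"
  using coordinates_coord[of x] by (auto simp: coordinates_def)

lemma coord_finite: "x \<in> carrier M \<Longrightarrow> \<exists>A. finite A \<and> (\<forall>b. b \<notin> A \<longrightarrow> coord x b = \<zero>\<^bsub>Lambda n\<^esub>)"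
  using coordinates_coord[of x] by (auto simp: coordinates_def)

lemma coord_add: "x \<in> carrier M \<Longrightarrow> y \<in> carrier M \<Longrightarrow> coord (x \<oplus> y) b = coord x b \<oplus>\<^bsub>Lambda n\<^esub> coord y b"
  by (subst coord_eqI[OF _ coordinates_add[OF coordinates_coord coordinates_coord]]) simp_all

lemma coord_smult: "x \<in> carrier M \<Longrightarrow> l \<in> carrier (Lambda n) \<Longrightarrow> coord (l \<odot> x) b = l \<otimes>\<^bsub>Lambda n\<^esub> coord x b"
  by (subst coord_eqI[OF _ coordinates_smult[OF coordinates_coord]]) simp_all

lemma coord_zero: "coord \<zero> b = \<zero>\<^bsub>Lambda n\<^esub>"
  using coord_smult[of "\<zero>" "\<zero>\<^bsub>Lambda n\<^esub>" b] by simp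

lemma eq_if_coord_eq:
  assumes "x \<in> carrier M" "y \<in> carrier M" "\<And>b. coord x b = coord y b" shows "x = y"
proof -
  have c: "coordinates (coord x) x" "coordinates (coord x) y"
    using coordinates_coord assms by (metis ext)+
  then obtain A A' where A: "finite A" "A \<subseteq> B" "\<And>b. b \<notin> A \<Longrightarrow> coord x b = \<zero>\<^bsub>Lambda n\<^esub>" "x = comb (coord x) A"
    and A': "finite A'" "A' \<subseteq> B" "\<And>b. b \<notin> A' \<Longrightarrow> coord x b = \<zero>\<^bsub>Lambda n\<^esub>" "y = comb (coord x) A'"
    unfolding coordinates_def by metis
  have "comb (coord x) A = comb (coord x) (A \<union> A')" "comb (coord x) A' = comb (coord x) (A \<union> A')"
    using A(1-3) A'(1-3) assms(1) by (auto intro!: comb_mono)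
  then show ?thesis using A(4) A'(4) by simp
qed

lemma coord_finsum:
  assumes "finite I" "f \<in> I \<rightarrow> carrier M"
  shows "coord (\<Oplus>i\<in>I. f i) b = (\<Oplus>\<^bsub>Lambda n\<^esub>i\<in>I. coord (f i) b)"
  using assms by (induction I rule: finite_induct) (auto simp: coord_zero coord_add Pi_def)

definition coordwise :: "('k lam \<Rightarrow> 'k lam) \<Rightarrow> 'a \<Rightarrow> 'a" where
  "coordwise \<phi> x = (SOME y. coordinates (\<lambda>b. \<phi> (coord x b)) y)"

context
  fixes \<phi> :: "'k lam \<Rightarrow> 'k lam"
  assumes \<phi>: "\<And>l. l \<in> carrier (Lambda n) \<Longrightarrow> \<phi> l \<in> carrier (Lambda n)" "\<phi> \<zero>\<^bsub>Lambda n\<^esub> = \<zero>\<^bsub>Lambda n\<^esub>"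
begin

lemma coordinates_coordwise: "x \<in> carrier M \<Longrightarrow> coordinates (\<lambda>b. \<phi> (coord x b)) (coordwise \<phi> x)"
proof -
  assume x: "x \<in> carrier M"
  then obtain A where "finite A" "A \<subseteq> B" "\<And>b. b \<notin> A \<Longrightarrow> coord x b = \<zero>\<^bsub>Lambda n\<^esub>"
    using coordinates_coord[of x] unfolding coordinates_def by metis
  then have "coordinates (\<lambda>b. \<phi> (coord x b)) (comb (\<lambda>b. \<phi> (coord x b)) A)"
    unfolding coordinates_def using \<phi> x by auto
  then show ?thesis unfolding coordwise_def by (rule someI)
qed

lemma coordwise_closed [simp]: "x \<in> carrier M \<Longrightarrow> coordwise \<phi> x \<in> carrier M"
  using coordinates_coordwise[of x] unfolding coordinates_def by (auto intro!: comb_closed)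

lemma coord_coordwise [simp]: "x \<in> carrier M \<Longrightarrow> coord (coordwise \<phi> x) b = \<phi> (coord x b)"
  using coord_eqI[OF _ coordinates_coordwise, of x] by simp

end

end

text \<open>
  A map that is linear over the constants and the variables other than \<open>x\<^sub>i\<close>, and for which the powers
  of \<open>x\<^sub>i\<close> and their complements are dual bases.
\<close>

definition frobenius_form :: "(nat \<Rightarrow> nat) \<Rightarrow> nat \<Rightarrow> ('k::field lam, 'a) gmod \<Rightarrow> ('a \<Rightarrow> 'a) \<Rightarrow> bool" where
  "frobenius_form n i M \<epsilon> \<longleftrightarrow>
     (\<forall>y\<in>carrier M. \<epsilon> y \<in> carrier M) \<and>
     (\<forall>y\<in>carrier M. \<forall>y'\<in>carrier M. \<epsilon> (y \<oplus>\<^bsub>M\<^esub> y') = \<epsilon> y \<oplus>\<^bsub>M\<^esub> \<epsilon> y') \<and>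
     (\<forall>c. \<forall>y\<in>carrier M. \<epsilon> (Lambda_const n c \<odot>\<^bsub>M\<^esub> y) = Lambda_const n c \<odot>\<^bsub>M\<^esub> \<epsilon> y) \<and>
     (\<forall>j\<ge>1. j \<noteq> i \<longrightarrow> (\<forall>y\<in>carrier M. \<epsilon> (xvar n j \<odot>\<^bsub>M\<^esub> y) = xvar n j \<odot>\<^bsub>M\<^esub> \<epsilon> y)) \<and>
     (\<forall>y\<in>carrier M. (\<Oplus>\<^bsub>M\<^esub>a\<in>{..<n i}. xvar n i [^]\<^bsub>Lambda n\<^esub> a \<odot>\<^bsub>M\<^esub>
        \<epsilon> (xvar n i [^]\<^bsub>Lambda n\<^esub> (n i - 1 - a) \<odot>\<^bsub>M\<^esub> y)) = y)"

lemma (in free_module) frobenius_form_coordwise: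
  assumes i: "1 \<le> i" "0 < n i"
  shows "frobenius_form n i M (coordwise (top_coeff n i))"
proof -
  have tz: "top_coeff n i \<zero>\<^bsub>Lambda n\<^esub> = (\<zero>\<^bsub>Lambda n\<^esub> :: 'k lam)" by (rule top_coeff_zero[of i n, OF i])
  note closed = coordwise_closed[of "top_coeff n i", OF top_coeff_closed tz]
  note coordw = coord_coordwise[of "top_coeff n i", OF top_coeff_closed tz]
  have x: "(xvar n i :: 'k lam) [^]\<^bsub>Lambda n\<^esub> (a :: nat) \<in> carrier (Lambda n)" for a by simp
  show ?thesis
    unfolding frobenius_form_def
  proof (intro conjI ballI allI impI)
    fix y assume y: "y \<in> carrier M"
    show "coordwise (top_coeff n i) y \<in> carrier M" using y by (rule closed)
    show "coordwise (top_coeff n i) (y \<oplus> y') = coordwise (top_coeff n i) y \<oplus> coordwise (top_coeff n i) y'"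
      if "y' \<in> carrier M" for y'
      using y that by (intro eq_if_coord_eq) (simp_all add: closed coordw coord_add top_coeff_add[of i n, OF i])
    show "coordwise (top_coeff n i) (Lambda_const n c \<odot> y) = Lambda_const n c \<odot> coordwise (top_coeff n i) y" for c
      using y by (intro eq_if_coord_eq) (simp_all add: closed coordw coord_smult top_coeff_const[of i n, OF i])
    show "coordwise (top_coeff n i) (xvar n j \<odot> y) = xvar n j \<odot> coordwise (top_coeff n i) y"
      if "1 \<le> j" "j \<noteq> i" for j
      using y that by (intro eq_if_coord_eq) (simp_all add: closed coordw coord_smult top_coeff_xvar[of i n, OF i])
    show "(\<Oplus>a\<in>{..<n i}. xvar n i [^]\<^bsub>Lambda n\<^esub> a \<odot>
        coordwise (top_coeff n i) (xvar n i [^]\<^bsub>Lambda n\<^esub> (n i - 1 - a) \<odot> y)) = y"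
    proof (rule eq_if_coord_eq)
      show "coord (\<Oplus>a\<in>{..<n i}. xvar n i [^]\<^bsub>Lambda n\<^esub> a \<odot>
          coordwise (top_coeff n i) (xvar n i [^]\<^bsub>Lambda n\<^esub> (n i - 1 - a) \<odot> y)) b = coord y b" for b
        using top_coeff_frobenius[of i n "coord y b", OF i] y
        by (simp add: coord_finsum closed coordw coord_smult x Pi_def)
    qed (use y in \<open>auto simp: closed x intro!: M.finsum_closed\<close>)
  qed
qed

lemma (in Module.module) smult_funpow:
  assumes "l \<in> carrier R" "x \<in> carrier M"
  shows "((\<lambda>x. l \<odot>\<^bsub>M\<^esub> x) ^^ k) x = (l [^]\<^bsub>R\<^esub> k) \<odot>\<^bsub>M\<^esub> x"
proof (induction k)
  case (Suc k)
  have "l [^]\<^bsub>R\<^esub> Suc k = l \<otimes>\<^bsub>R\<^esub> l [^]\<^bsub>R\<^esub> k"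
    using assms by (simp add: R.m_comm)
  then show ?case using Suc assms by (simp add: smult_assoc1 del: R.nat_pow_Suc)
qed (use assms in simp)

section \<open>Descent to fewer variables\<close>

definition subring_gens :: "(nat \<Rightarrow> nat) \<Rightarrow> nat set \<Rightarrow> 'k::field lam set" where
  "subring_gens n S = range (Lambda_const n) \<union> xvar n ` S"

lemma subring_gens_closed: "subring_gens n S \<subseteq> carrier (Lambda n)"
  by (auto simp: subring_gens_def)

lemma subring_gens_insert: "subring_gens n (insert i S) = insert (xvar n i) (subring_gens n S)"
  by (auto simp: subring_gens_def)

lemma funpow_ident [simp]: "((\<lambda>y. y) ^^ k) z = z"
  by (induction k) auto

context tensor_pair
begin

lemma smult_commute:
  assumes "l \<in> carrier (Lambda n)" "l' \<in> carrier (Lambda n)"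
  shows "e \<in> carrier (obj E p) \<Longrightarrow> l \<odot>\<^bsub>obj E p\<^esub> (l' \<odot>\<^bsub>obj E p\<^esub> e) = l' \<odot>\<^bsub>obj E p\<^esub> (l \<odot>\<^bsub>obj E p\<^esub> e)"
    and "q \<in> carrier (obj P j) \<Longrightarrow> l \<odot>\<^bsub>obj P j\<^esub> (l' \<odot>\<^bsub>obj P j\<^esub> q) = l' \<odot>\<^bsub>obj P j\<^esub> (l \<odot>\<^bsub>obj P j\<^esub> q)"
  using assms cring.cring_simprules(14)[OF cring_Lambda assms]
  by (metis (no_types, lifting) E.M.smult_assoc1, metis (no_types, lifting) P.M.smult_assoc1)

lemma right_smult_pow:
  assumes "l \<in> carrier (Lambda n)" "q \<in> carrier (obj P (m - p))"
  shows "(right_smult l m ^^ k) (frag_of (p, e, q)) = frag_of (p, e, l [^]\<^bsub>Lambda n\<^esub> k \<odot>\<^bsub>obj P (m - p)\<^esub> q)"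
  using assms by (simp add: formal_map_pow P.M.smult_funpow)

lemma left_smult_pow:
  assumes "l \<in> carrier (Lambda n)" "e \<in> carrier (obj E p)"
  shows "(left_smult l m ^^ k) (frag_of (p, e, q)) = frag_of (p, l [^]\<^bsub>Lambda n\<^esub> k \<odot>\<^bsub>obj E p\<^esub> e, q)"
  using assms by (simp add: formal_map_pow E.M.smult_funpow)

lemma nilpotent_pair_xvar:
  assumes i: "1 \<le> i" and K: "K \<subseteq> carrier (Lambda n)"
  shows "nilpotent_pair X (J K) D (left_smult (xvar n i)) (right_smult (xvar n i)) (n i)"
proof -
  define x :: "'k lam" where "x = xvar n i"
  have x: "x \<in> carrier (Lambda n)" by (simp add: x_def)
  interpret Q: quotient_complex X "J K" D by (rule quotient_complex[OF K])
  have pow0: "x [^]\<^bsub>Lambda n\<^esub> n i = \<zero>\<^bsub>Lambda n\<^esub>"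
    unfolding x_def by (rule xvar_pow_zero) (use i in auto)
  have addi: "additive (left_smult x m)" "additive (right_smult x m)" for m
    by (rule additive_formal_map)+
  have addk: "additive (left_smult x m ^^ k)" "additive (right_smult x m ^^ k)" for m k
    by (induction k) (use addi in \<open>auto simp: additive_def\<close>)
  have "nilpotent_pair X (J K) D (left_smult x) (right_smult x) (n i)"
  proof unfold_locales
    fix m u v
    show "left_smult x m (u + v) = left_smult x m u + left_smult x m v"
      "right_smult x m (u + v) = right_smult x m u + right_smult x m v"
      using addi by (simp_all add: additive_def)
    show "left_smult x m (right_smult x m u) = right_smult x m (left_smult x m u)"
      by (simp add: formal_map_comp comp_def)
  next
    fix m u assume u: "u \<in> J K m"
    have K': "l \<in> carrier (Lambda n)" if "l \<in> K" for l using that K by blast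
    show "left_smult x m u \<in> J K m"
      by (rule formal_map_J[OF K _ _ _ _ _ _ u])
        (use x smult_commute(1)[OF x K'] in \<open>auto simp: E.M.smult_r_distr\<close>)
    show "right_smult x m u \<in> J K m"
      by (rule formal_map_J[OF K _ _ _ _ _ _ u])
        (use x smult_commute(2)[OF x K'] in \<open>auto simp: P.M.smult_r_distr\<close>)
  next
    fix m u assume u: "u \<in> X m"
    show "left_smult x m u \<in> X m" "right_smult x m u \<in> X m"
      by (rule formal_map_X[OF _ _ u]; use x in auto)+
    show "D m (left_smult x m u) = left_smult x (m + 1) (D m u)"
      "D m (right_smult x m u) = right_smult x (m + 1) (D m u)"
      by (rule formal_map_D[OF _ _ u]; use x in auto)+
    show "(left_smult x m ^^ n i) u \<in> J K m"
      by (rule additive_formal_tensors[OF u addk(1) subgp_balanced_kernel])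
        (simp add: left_smult_pow x pow0 J_zero_left)
    show "(right_smult x m ^^ n i) u \<in> J K m"
      by (rule additive_formal_tensors[OF u addk(2) subgp_balanced_kernel])
        (simp add: right_smult_pow x pow0 J_zero_right)
  qed
  then show ?thesis by (simp add: x_def)
qed

text \<open>
  Write \<open>\<Lambda>\<close> as an extension of a subring by one variable. Tensoring over the subring gives a
  complex with two actions of the variable, whose difference has cokernel the tensor product over
  the larger ring, and a Frobenius form on the second factor extends to that complex.
\<close>

lemma acyclic_mod_remove_variable:
  assumes i: "1 \<le> i" and S: "S \<subseteq> {1..}" "i \<notin> S"
    and \<epsilon>: "\<And>j. frobenius_form n i (obj P j) (\<epsilon> j)"
    and acyc: "acyclic_mod X (J (subring_gens n (insert i S))) D"
  shows "acyclic_mod X (J (subring_gens n S)) D"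
proof -
  let ?K = "subring_gens n S :: 'k lam set"
  define x :: "'k lam" where "x = xvar n i"
  have x: "x \<in> carrier (Lambda n)" by (simp add: x_def)
  note K = subring_gens_closed[of n S]
  let ?L = "left_smult x" and ?R = "right_smult x"
  interpret nilpotent_pair X "J ?K" D ?L ?R "n i"
    unfolding x_def by (rule nilpotent_pair_xvar[OF i K])
  define \<E> where "\<E> = formal_map (\<lambda>p (e :: 'a). e) \<epsilon>"
  have e1: "\<epsilon> j y \<in> carrier (obj P j)" if "y \<in> carrier (obj P j)" for j y
    using \<epsilon>[of j] that by (auto simp: frobenius_form_def)
  have addi: "additive (\<E> m)" for m
    unfolding \<E>_def by (rule additive_formal_map)
  have "frobenius_pair X (J ?K) D ?L ?R (n i) \<E>"
  proof unfold_locales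
    fix m u v
    show "\<E> m (u + v) = \<E> m u + \<E> m v"
      using addi by (simp add: additive_def)
    show "?L m (\<E> m u) = \<E> m (?L m u)"
      unfolding \<E>_def by (simp add: formal_map_comp comp_def)
  next
    fix m u assume u: "u \<in> J ?K m"
    show "\<E> m u \<in> J ?K m"
      unfolding \<E>_def
    proof (rule formal_map_J[OF K _ _ _ _ _ _ u])
      fix j l y assume l: "l \<in> ?K" and y: "y \<in> carrier (obj P j)"
      show "\<epsilon> j (l \<odot>\<^bsub>obj P j\<^esub> y) = l \<odot>\<^bsub>obj P j\<^esub> \<epsilon> j y"
        using l S \<epsilon>[of j] y unfolding subring_gens_def frobenius_form_def by auto
    qed (use \<epsilon> in \<open>auto simp: frobenius_form_def\<close>)
  next
    fix m u assume u: "u \<in> X m"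
    show "\<E> m u \<in> X m"
      unfolding \<E>_def by (rule formal_map_X[OF _ _ u]; use e1 in auto)
    show "u - (\<Sum>a<n i. (?R m ^^ a) (\<E> m ((?R m ^^ (n i - 1 - a)) u))) \<in> J ?K m"
    proof (rule additive_formal_tensors[OF u _ subgp_balanced_kernel,
          where f = "\<lambda>u. u - (\<Sum>a<n i. (?R m ^^ a) (\<E> m ((?R m ^^ (n i - 1 - a)) u)))"])
      show "additive (\<lambda>u. u - (\<Sum>a<n i. (?R m ^^ a) (\<E> m ((?R m ^^ (n i - 1 - a)) u))))"
        using addi by (simp add: additive_def sum.distrib Rk.add)
      fix p e y assume e: "e \<in> carrier (obj E p)" and y: "y \<in> carrier (obj P (m - p))"
      let ?f = "\<lambda>a. x [^]\<^bsub>Lambda n\<^esub> a \<odot>\<^bsub>obj P (m - p)\<^esub> \<epsilon> (m - p) (x [^]\<^bsub>Lambda n\<^esub> (n i - 1 - a) \<odot>\<^bsub>obj P (m - p)\<^esub> y)"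
      have "(?R m ^^ a) (\<E> m ((?R m ^^ (n i - 1 - a)) (frag_of (p, e, y)))) = frag_of (p, e, ?f a)" for a
        using y x e1 by (simp add: right_smult_pow \<E>_def)
      moreover have "(\<Oplus>\<^bsub>obj P (m - p)\<^esub>a\<in>{..<n i}. ?f a) = y"
        using \<epsilon>[of "m - p"] y by (simp add: frobenius_form_def x_def)
      moreover have "frag_of (p, e, \<Oplus>\<^bsub>obj P (m - p)\<^esub>a\<in>{..<n i}. ?f a) - (\<Sum>a\<in>{..<n i}. frag_of (p, e, ?f a)) \<in> J ?K m"
        using e y x e1 by (intro J_finsum_right) auto
      ultimately show "frag_of (p, e, y) - (\<Sum>a<n i. (?R m ^^ a) (\<E> m ((?R m ^^ (n i - 1 - a)) (frag_of (p, e, y))))) \<in> J ?K m"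
        by simp
    qed
  qed
  moreover have "J (subring_gens n (insert i S)) = (\<lambda>m. {j + (?L m u - ?R m u) | j u. j \<in> J ?K m \<and> u \<in> X m})"
    unfolding subring_gens_insert x_def[symmetric] by (rule ext, rule J_insert[OF x K])
  ultimately show ?thesis
    using frobenius_pair.acyclic_mod_lift_frobenius acyc by fastforce
qed

text \<open>The first \<open>M\<close> variables are removed from the ground ring one after the other.\<close>

lemma acyclic_mod_tail:
  assumes \<epsilon>: "\<And>i. 1 \<le> i \<Longrightarrow> \<exists>\<epsilon>. \<forall>j. frobenius_form n i (obj P j) (\<epsilon> j)"
    and acyc: "acyclic_mod X (J (carrier (Lambda n))) D"
  shows "acyclic_mod X (J (subring_gens n {M<..})) D"
proof (induction M)
  case 0
  have "J (carrier (Lambda n)) = J (subring_gens n {0<..})"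
    by (rule ext, rule J_all) (auto simp: subring_gens_def)
  then show ?case using acyc by simp
next
  case (Suc M)
  have eq: "{M<..} = insert (Suc M) {Suc M<..}" by auto
  obtain \<epsilon> where \<epsilon>: "\<And>j. frobenius_form n (Suc M) (obj P j) (\<epsilon> j)" using \<epsilon>[of "Suc M"] by auto
  have sub: "{Suc M<..} \<subseteq> {1..}" by auto
  show ?case
    by (rule acyclic_mod_remove_variable[OF _ sub _ \<epsilon> Suc[unfolded eq]]) simp_all
qed

end

section \<open>Detecting nonzero products\<close>

context Module.module
begin

definition subspace_over :: "'a set \<Rightarrow> 'c set \<Rightarrow> bool" where
  "subspace_over K U \<longleftrightarrow> U \<subseteq> carrier M \<and> \<zero>\<^bsub>M\<^esub> \<in> U \<and> (\<forall>u\<in>U. \<forall>v\<in>U. u \<oplus>\<^bsub>M\<^esub> v \<in> U) \<and> (\<forall>l\<in>K. \<forall>u\<in>U. l \<odot>\<^bsub>M\<^esub> u \<in> U)"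

end

lemma Lambda_const_simps:
  "Lambda_const n a \<oplus>\<^bsub>Lambda n\<^esub> Lambda_const n b = Lambda_const n (a + b)"
  "Lambda_const n a \<otimes>\<^bsub>Lambda n\<^esub> Lambda_const n b = Lambda_const n (a * b)"
  "Lambda_const n 0 = \<zero>\<^bsub>Lambda n\<^esub>" "Lambda_const n 1 = \<one>\<^bsub>Lambda n\<^esub>"
  by (simp_all add: Lambda_const_eq cls_add cls_mult mult_single zero_Lambda one_Lambda single_add)

text \<open>
  Linear functionals over the base field separate points from subspaces. By Zorn's lemma there is
  a largest subspace that contains \<open>U\<^sub>0\<close> but not \<open>x\<close>; it is a hyperplane complementary to \<open>x\<close>.
\<close>

lemma ex_separating_functional:
  fixes M :: "('k::field lam, 'a) gmod" (structure)
  assumes M: "Module.module (Lambda n) M"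
    and U0: "module.subspace_over M (range (Lambda_const n)) U0" and x: "x \<in> carrier M" "x \<notin> U0"
  obtains F :: "'a \<Rightarrow> 'k" where
    "\<And>u v. u \<in> carrier M \<Longrightarrow> v \<in> carrier M \<Longrightarrow> F (u \<oplus> v) = F u + F v"
    "\<And>c u. u \<in> carrier M \<Longrightarrow> F (Lambda_const n c \<odot> u) = c * F u"
    "\<And>u. u \<in> U0 \<Longrightarrow> F u = 0" "F x = 1"
proof -
  interpret Module.module "Lambda n" M by (rule M)
  let ?k = "Lambda_const n :: 'k \<Rightarrow> 'k lam"
  let ?S = "subspace_over (range ?k)"
  define C where "C = {U. ?S U \<and> U0 \<subseteq> U \<and> x \<notin> U}"
  have "U0 \<in> C" using U0 x by (simp add: C_def)
  have "\<exists>U\<in>C. \<forall>V\<in>C. U \<subseteq> V \<longrightarrow> V = U"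
  proof (rule subset_Zorn_nonempty)
    show "C \<noteq> {}" using \<open>U0 \<in> C\<close> by blast
    fix \<C> assume ne: "\<C> \<noteq> {}" and ch: "subset.chain C \<C>"
    have sub: "\<And>U. U \<in> \<C> \<Longrightarrow> ?S U \<and> U0 \<subseteq> U \<and> x \<notin> U"
      using ch by (auto simp: subset.chain_def C_def)
    have add: "u \<oplus> v \<in> \<Union>\<C>" if u: "u \<in> \<Union>\<C>" "v \<in> \<Union>\<C>" for u v
    proof -
      obtain U V where UV: "U \<in> \<C>" "u \<in> U" "V \<in> \<C>" "v \<in> V" using u by blast
      then have "U \<subseteq> V \<or> V \<subseteq> U" using ch unfolding subset.chain_def by blast
      then obtain W where W: "W \<in> \<C>" "u \<in> W" "v \<in> W" using UV by blast
      then have "u \<oplus> v \<in> W" using sub[OF W(1)] unfolding subspace_over_def by blast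
      then show ?thesis using W by blast
    qed
    have "?S (\<Union>\<C>)"
      unfolding subspace_over_def
    proof (intro conjI ballI)
      show "\<Union>\<C> \<subseteq> carrier M" using sub unfolding subspace_over_def by blast
      show "\<zero> \<in> \<Union>\<C>" using ne sub unfolding subspace_over_def by blast
      show "l \<odot> u \<in> \<Union>\<C>" if "l \<in> range ?k" "u \<in> \<Union>\<C>" for l u
        using that sub unfolding subspace_over_def by blast
    qed (rule add)
    then show "\<Union>\<C> \<in> C" using ne sub unfolding C_def by blast
  qed
  then obtain U where UC: "U \<in> C" and maxC: "\<forall>V\<in>C. U \<subseteq> V \<longrightarrow> V = U" ..
  then have U: "?S U" "U0 \<subseteq> U" "x \<notin> U" by (simp_all add: C_def)
  have max: "V = U" if "?S V" "U \<subseteq> V" "x \<notin> V" for V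
    using maxC that U(2) by (simp add: C_def)
  have Uc: "u \<in> carrier M" if "u \<in> U" for u using U(1) that by (auto simp: subspace_over_def)
  have Ua: "u \<oplus> v \<in> U" if "u \<in> U" "v \<in> U" for u v using U(1) that by (auto simp: subspace_over_def)
  have Us: "?k c \<odot> u \<in> U" if "u \<in> U" for c u using U(1) that by (auto simp: subspace_over_def)
  have kk: "?k a \<odot> (?k b \<odot> u) = ?k (a * b) \<odot> u" if "u \<in> carrier M" for a b u
    using that smult_assoc1[of "?k a" "?k b" u] by (simp add: Lambda_const_simps)
  have ka: "?k a \<odot> u \<oplus> ?k b \<odot> u = ?k (a + b) \<odot> u" if "u \<in> carrier M" for a b u
    using that smult_l_distr[of "?k a" "?k b" u] by (simp add: Lambda_const_simps)
  have k0: "?k 0 \<odot> u = \<zero>" and k1: "?k 1 \<odot> u = u" if "u \<in> carrier M" for u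
    using that by (simp_all add: Lambda_const_simps)
  have kd: "?k a \<odot> (u \<oplus> v) = ?k a \<odot> u \<oplus> ?k a \<odot> v"
    if "u \<in> carrier M" "v \<in> carrier M" for a u v
    using that by (simp add: smult_r_distr)
  let ?rel = "\<lambda>u c. u \<oplus> ?k (- c) \<odot> x \<in> U"
  have ex: "\<exists>c. ?rel u c" if u: "u \<in> carrier M" for u
  proof (cases "u \<in> U")
    case True
    then show ?thesis using u x k0 by (intro exI[of _ 0]) simp
  next
    case False
    define V where "V = {v \<oplus> ?k a \<odot> u | v a. v \<in> U}"
    have "?S V"
      unfolding subspace_over_def
    proof (intro conjI ballI)
      show "V \<subseteq> carrier M" using Uc u by (auto simp: V_def)
      show "\<zero> \<in> V"
        using U(1) u k0 unfolding V_def subspace_over_def by (auto intro!: exI[of _ "\<zero>"] exI[of _ 0])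
      fix v w assume "v \<in> V"
      then obtain v' a where v: "v = v' \<oplus> ?k a \<odot> u" "v' \<in> U" by (auto simp: V_def)
      {
        assume "w \<in> V"
        then obtain w' b where w: "w = w' \<oplus> ?k b \<odot> u" "w' \<in> U" by (auto simp: V_def)
        have "v \<oplus> w = (v' \<oplus> w') \<oplus> (?k a \<odot> u \<oplus> ?k b \<odot> u)"
          using v w u Uc[OF v(2)] Uc[OF w(2)] by (simp add: M.a_ac)
        also have "\<dots> = (v' \<oplus> w') \<oplus> ?k (a + b) \<odot> u"
          using u by (simp add: ka)
        finally show "v \<oplus> w \<in> V" using Ua[OF v(2) w(2)] unfolding V_def by blast
      }
      fix l assume "l \<in> range ?k"
      then obtain c where l: "l = ?k c" by blast
      have "l \<odot> v = ?k c \<odot> v' \<oplus> ?k (c * a) \<odot> u"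
        using v u Uc[OF v(2)] by (simp add: l kd kk)
      then show "l \<odot> v \<in> V" using Us[OF v(2)] unfolding V_def by blast
    qed
    moreover have "U \<subseteq> V"
    proof
      fix v assume "v \<in> U"
      then have "v = v \<oplus> ?k 0 \<odot> u" using Uc u k0 by simp
      then show "v \<in> V" using \<open>v \<in> U\<close> unfolding V_def by blast
    qed
    moreover have "u \<in> V"
      using u k1[OF u] U(1) unfolding V_def subspace_over_def
      by (auto intro!: exI[of _ "\<zero>"] exI[of _ 1])
    ultimately have "x \<in> V" using max False by blast
    then obtain v a where v: "x = v \<oplus> ?k a \<odot> u" "v \<in> U" by (auto simp: V_def)
    \<comment> \<open>Solving \<open>x = v + a u\<close> for \<open>u\<close> modulo \<open>U\<close>.\<close>
    have a: "a \<noteq> 0" using v U(3) u Uc k0 by auto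
    have "?k (- (1 / a)) \<odot> x = ?k (- (1 / a)) \<odot> v \<oplus> ?k (- 1) \<odot> u"
      using v u Uc[OF v(2)] a by (simp add: kd kk)
    then have "u \<oplus> ?k (- (1 / a)) \<odot> x = ?k (- (1 / a)) \<odot> v \<oplus> (?k 1 \<odot> u \<oplus> ?k (- 1) \<odot> u)"
      using u Uc[OF v(2)] k1[OF u] by (simp add: M.a_ac)
    also have "\<dots> = ?k (- (1 / a)) \<odot> v"
      using u Uc[OF v(2)] by (simp only: ka) (simp add: k0)
    finally show ?thesis using Us[OF v(2)] by (intro exI[of _ "1 / a"]) simp
  qed
  have uniq: "c = c'" if u: "u \<in> carrier M" and c: "?rel u c" "?rel u c'" for u c c'
  proof (rule ccontr)
    assume ne: "c \<noteq> c'"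
    have "(u \<oplus> ?k (- c) \<odot> x) \<oplus> ?k (- 1) \<odot> (u \<oplus> ?k (- c') \<odot> x)
        = (?k 1 \<odot> u \<oplus> ?k (- 1) \<odot> u) \<oplus> (?k (- c) \<odot> x \<oplus> ?k c' \<odot> x)"
      using u x k1[OF u] by (simp add: kd kk M.a_ac)
    also have "\<dots> = ?k (c' - c) \<odot> x"
      using u x by (simp only: ka) (simp add: k0)
    finally have "?k (c' - c) \<odot> x \<in> U" using Ua[OF c(1) Us[OF c(2), of "- 1"]] by simp
    then have "?k (1 / (c' - c)) \<odot> (?k (c' - c) \<odot> x) \<in> U" by (rule Us)
    then show False using ne x U(3) k1[OF x(1)] by (simp add: kk)
  qed
  define F where "F u = (THE c. ?rel u c)" for u
  have F: "?rel u (F u)" if "u \<in> carrier M" for u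
    unfolding F_def by (rule theI') (use ex[OF that] uniq[OF that] in blast)
  show thesis
  proof (rule that[of F])
    fix u v assume uv: "u \<in> carrier M" "v \<in> carrier M"
    have "(u \<oplus> ?k (- F u) \<odot> x) \<oplus> (v \<oplus> ?k (- F v) \<odot> x)
        = (u \<oplus> v) \<oplus> (?k (- F u) \<odot> x \<oplus> ?k (- F v) \<odot> x)"
      using uv x by (simp add: M.a_ac)
    then have "?rel (u \<oplus> v) (F u + F v)"
      using Ua[OF F[OF uv(1)] F[OF uv(2)]] x by (simp add: ka)
    then show "F (u \<oplus> v) = F u + F v"
      using uniq[OF _ F] uv by simp
  next
    fix c u assume u: "u \<in> carrier M"
    have "?k c \<odot> (u \<oplus> ?k (- F u) \<odot> x) = ?k c \<odot> u \<oplus> ?k (- (c * F u)) \<odot> x"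
      using u x by (simp add: kd kk)
    then have "?rel (?k c \<odot> u) (c * F u)"
      using Us[OF F[OF u], of c] by simp
    then show "F (?k c \<odot> u) = c * F u"
      using uniq[OF _ F] u by simp
  next
    fix u assume "u \<in> U0"
    then have "u \<in> U" using U(2) by blast
    then have "?rel u 0" using Uc x k0 by simp
    then show "F u = 0" using uniq[OF _ F] Uc[OF \<open>u \<in> U\<close>] by simp
  next
    have "x \<oplus> ?k (- 1) \<odot> x = \<zero>"
      using ka[OF x(1), of 1 "- 1"] k0 k1 x by simp
    then have "?rel x 1" using U(1) by (simp add: subspace_over_def)
    then show "F x = 1" using uniq[OF _ F] x by simp
  qed
qed

context lam_complex
begin

lemma coboundaries_smult:
  assumes l: "l \<in> carrier (Lambda n)" and x: "x \<in> coboundaries X i"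
  shows "l \<odot>\<^bsub>obj X i\<^esub> x \<in> coboundaries X i"
proof -
  obtain e where e: "e \<in> carrier (obj X (i - 1))" "x = bd X (i - 1) e"
    using x by (auto simp: coboundaries_def)
  then have "l \<odot>\<^bsub>obj X i\<^esub> x = bd X (i - 1) (l \<odot>\<^bsub>obj X (i - 1)\<^esub> e)"
    using bd_smult[OF l e(1)] by simp
  then show ?thesis using e l unfolding coboundaries_def by blast
qed

lemma coboundaries_subset: "coboundaries X i \<subseteq> carrier (obj X i)"
  by (auto simp: coboundaries_def)

lemma coboundaries_add:
  assumes "x \<in> coboundaries X i" "y \<in> coboundaries X i"
  shows "x \<oplus>\<^bsub>obj X i\<^esub> y \<in> coboundaries X i"
proof -
  obtain e e' where e: "e \<in> carrier (obj X (i - 1))" "x = bd X (i - 1) e"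
    "e' \<in> carrier (obj X (i - 1))" "y = bd X (i - 1) e'"
    using assms by (auto simp: coboundaries_def)
  then have "x \<oplus>\<^bsub>obj X i\<^esub> y = bd X (i - 1) (e \<oplus>\<^bsub>obj X (i - 1)\<^esub> e')"
    using bd_add[OF e(1,3)] by simp
  then show ?thesis using e unfolding coboundaries_def by blast
qed

lemma zero_coboundaries: "\<zero>\<^bsub>obj X i\<^esub> \<in> coboundaries X i"
proof -
  have "\<zero>\<^bsub>obj X i\<^esub> = bd X (i - 1) \<zero>\<^bsub>obj X (i - 1)\<^esub>" using bd_zero[of "i - 1"] by simp
  then show ?thesis unfolding coboundaries_def by blast
qed

lemma cocycles_smult:
  "l \<in> carrier (Lambda n) \<Longrightarrow> x \<in> cocycles X i \<Longrightarrow> l \<odot>\<^bsub>obj X i\<^esub> x \<in> cocycles X i"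
  by (auto simp: cocycles_def)

lemma ex_functional:
  assumes "x \<in> carrier (obj X i)" "x \<notin> coboundaries X i"
  obtains F :: "'a \<Rightarrow> 'k" where
    "\<And>u v. u \<in> carrier (obj X i) \<Longrightarrow> v \<in> carrier (obj X i) \<Longrightarrow> F (u \<oplus>\<^bsub>obj X i\<^esub> v) = F u + F v"
    "\<And>c u. u \<in> carrier (obj X i) \<Longrightarrow> F (Lambda_const n c \<odot>\<^bsub>obj X i\<^esub> u) = c * F u"
    "\<And>u. u \<in> coboundaries X i \<Longrightarrow> F u = 0" "F x = 1"
proof (rule ex_separating_functional[OF module[of i] _ assms])
  show "M.subspace_over i (range (Lambda_const n)) (coboundaries X i)"
    unfolding M.subspace_over_def
    using coboundaries_subset zero_coboundaries coboundaries_add coboundaries_smult by auto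
qed (rule that)

end

definition linear_extension :: "('s \<Rightarrow> 'k::ring_1) \<Rightarrow> ('s \<Rightarrow>\<^sub>0 int) \<Rightarrow> 'k" where
  "linear_extension \<theta> z = (\<Sum>s\<in>keys z. of_int (lookup z s) * \<theta> s)"

lemma linear_extension_frag_of [simp]: "linear_extension \<theta> (frag_of s) = \<theta> s"
  by (simp add: linear_extension_def)

lemma additive_linear_extension: "additive (linear_extension \<theta>)"
  unfolding additive_def linear_extension_def
  by (intro allI setsum_keys_plus_distrib) (auto simp: distrib_right)

text \<open>The largest reduced monomial in the variables \<open>x\<^sub>i\<close> with \<open>i \<in> S\<close>.\<close>

definition socle :: "(nat \<Rightarrow> nat) \<Rightarrow> nat set \<Rightarrow> monomial" where
  "socle n S = (\<Sum>i\<in>S. single (i - 1) (n i - 1))"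

definition socle_elt :: "(nat \<Rightarrow> nat) \<Rightarrow> nat set \<Rightarrow> 'k::field lam" where
  "socle_elt n S = cls n (single (socle n S) 1)"

lemma socle_elt_closed [simp]: "socle_elt n S \<in> carrier (Lambda n)"
  by (simp add: socle_elt_def)

lemma socle_elt_empty: "socle_elt n {} = \<one>\<^bsub>Lambda n\<^esub>"
  by (simp add: socle_elt_def socle_def one_Lambda)

lemma socle_elt_insert:
  "finite S \<Longrightarrow> i \<notin> S \<Longrightarrow> socle_elt n (insert i S) = socle_elt n S \<otimes>\<^bsub>Lambda n\<^esub> (xvar n i [^]\<^bsub>Lambda n\<^esub> (n i - 1))"
  by (simp add: socle_elt_def socle_def xvar_pow var_power cls_mult mult_single add.commute)

context tensor_pair
begin

definition boundaries :: "'k lam set \<Rightarrow> int \<Rightarrow> ('a, 'b) formal_tensor set" where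
  "boundaries K m = {z. \<exists>u\<in>X (m - 1). z - D (m - 1) u \<in> J K m}"

lemma subgp_boundaries: "subgp (boundaries K m)"
  unfolding subgp_def
proof (intro conjI ballI)
  show "0 \<in> boundaries K m"
    unfolding boundaries_def
    by (auto intro!: bexI[of _ 0] simp: D.zero subgp_zero subgp_formal_tensors subgp_balanced_kernel)
  fix a b assume "a \<in> boundaries K m" "b \<in> boundaries K m"
  then obtain u v where uv: "u \<in> X (m - 1)" "v \<in> X (m - 1)" "a - D (m - 1) u \<in> J K m" "b - D (m - 1) v \<in> J K m"
    unfolding boundaries_def by blast
  have "a - b - D (m - 1) (u - v) = (a - D (m - 1) u) - (b - D (m - 1) v)" by (simp add: D.diff)
  then have "a - b - D (m - 1) (u - v) \<in> J K m" using uv subgp_diff[OF subgp_balanced_kernel] by metis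
  then show "a - b \<in> boundaries K m"
    unfolding boundaries_def using subgp_diff[OF subgp_formal_tensors uv(1,2)] by blast
qed

lemma J_boundaries: "z \<in> J K m \<Longrightarrow> z \<in> boundaries K m"
  unfolding boundaries_def
  by (auto intro!: bexI[of _ 0] simp: D.zero subgp_zero subgp_formal_tensors)

lemma D_boundaries: "u \<in> X (m - 1) \<Longrightarrow> D (m - 1) u \<in> boundaries K m"
  unfolding boundaries_def by (auto simp: subgp_zero subgp_balanced_kernel intro!: bexI[of _ u])

lemma boundaries_cong: "a - b \<in> boundaries K m \<Longrightarrow> a \<in> boundaries K m \<longleftrightarrow> b \<in> boundaries K m"
  by (rule subgp_cong[OF subgp_boundaries])

lemma tensor_coboundary_left:
  assumes "e \<in> coboundaries E i" "q \<in> cocycles P (m - i)"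
  shows "frag_of (i, e, q) \<in> boundaries K m"
proof -
  obtain e' where e': "e' \<in> carrier (obj E (i - 1))" "e = bd E (i - 1) e'"
    using assms(1) by (auto simp: coboundaries_def)
  have q: "q \<in> carrier (obj P (m - i))" "bd P (m - i) q = \<zero>\<^bsub>obj P (m - i + 1)\<^esub>"
    using assms(2) by (auto simp: cocycles_def)
  have idx: "m - 1 - (i - 1) = m - i" "m - (i - 1) = m - i + 1" by simp_all
  have u: "frag_of (i - 1, e', q) \<in> X (m - 1)" using e' q by (simp add: idx)
  have "frag_of (i - 1, e', \<zero>\<^bsub>obj P (m - (i - 1))\<^esub>) \<in> J K m" using e'(1) by (rule J_zero_right)
  from J_signed[OF this, of "i - 1"]
  have "D (m - 1) (frag_of (i - 1, e', q)) - frag_of (i, e, q) \<in> J K m"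
    using e' q by (simp add: formal_bd_of idx)
  from boundaries_cong[OF J_boundaries[OF this]] show ?thesis
    using D_boundaries[OF u] by simp
qed

text \<open>
  Over the base field alone, the product of two linear functionals that vanish on coboundaries
  vanishes on all boundaries of the tensor product, and it detects \<open>y \<otimes> p\<close>.
\<close>

lemma tensor_not_boundary_field:
  assumes y: "y \<in> carrier (obj E i)" "y \<notin> coboundaries E i"
    and p: "p \<in> carrier (obj P j)" "p \<notin> coboundaries P j"
  shows "frag_of (i, y, p) \<notin> boundaries (range (Lambda_const n)) (i + j)"
proof
  assume "frag_of (i, y, p) \<in> boundaries (range (Lambda_const n)) (i + j)"
  then obtain u where u: "u \<in> X (i + j - 1)" "frag_of (i, y, p) - D (i + j - 1) u \<in> J (range (Lambda_const n)) (i + j)"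
    unfolding boundaries_def by blast
  obtain F where F: "\<And>u v. u \<in> carrier (obj E i) \<Longrightarrow> v \<in> carrier (obj E i) \<Longrightarrow> F (u \<oplus>\<^bsub>obj E i\<^esub> v) = F u + F v"
    "\<And>c u. u \<in> carrier (obj E i) \<Longrightarrow> F (Lambda_const n c \<odot>\<^bsub>obj E i\<^esub> u) = c * F u"
    "\<And>u. u \<in> coboundaries E i \<Longrightarrow> F u = 0" "F y = (1 :: 'k)"
    using E.ex_functional[OF y] by blast
  obtain G where G: "\<And>u v. u \<in> carrier (obj P j) \<Longrightarrow> v \<in> carrier (obj P j) \<Longrightarrow> G (u \<oplus>\<^bsub>obj P j\<^esub> v) = G u + G v"
    "\<And>c u. u \<in> carrier (obj P j) \<Longrightarrow> G (Lambda_const n c \<odot>\<^bsub>obj P j\<^esub> u) = c * G u"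
    "\<And>u. u \<in> coboundaries P j \<Longrightarrow> G u = 0" "G p = (1 :: 'k)"
    using P.ex_functional[OF p] by blast
  \<comment> \<open>The product functional on the summand with index \<open>i\<close>, and 0 on the other summands.\<close>
  define \<theta> where "\<theta> = (\<lambda>(q :: int, e, w). if q = i then F e * G w else 0)"
  interpret \<theta>: additive "linear_extension \<theta>" by (rule additive_linear_extension)
  have "linear_extension \<theta> (frag_of (i, y, p) - D (i + j - 1) u) \<in> {0}"
    by (rule additive_balanced_kernel[OF u(2) additive_linear_extension])
      (auto simp: \<theta>_def F G subgp_def algebra_simps)
  moreover have "linear_extension \<theta> (D (i + j - 1) u) \<in> {0}"
  proof (rule additive_formal_tensors[OF u(1), where f = "\<lambda>u. linear_extension \<theta> (D (i + j - 1) u)"])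
    show "additive (\<lambda>u. linear_extension \<theta> (D (i + j - 1) u))"
      by (simp add: additive_def D.add \<theta>.add)
    fix q e w assume ew: "e \<in> carrier (obj E q)" "w \<in> carrier (obj P (i + j - 1 - q))"
    have "F (bd E q e) = 0" if "q + 1 = i"
      using F(3)[of "bd E q e"] ew that by (auto simp: coboundaries_def)
    moreover have "G (bd P (i + j - 1 - q) w) = 0" if "q = i"
      using G(3)[of "bd P (j - 1) w"] ew that by (auto simp: coboundaries_def)
    ultimately show "linear_extension \<theta> (D (i + j - 1) (frag_of (q, e, w))) \<in> {0}"
      by (simp add: formal_bd_of \<theta>.add \<theta>.minus) (auto simp: \<theta>_def)
  qed (simp add: subgp_def)
  ultimately have "linear_extension \<theta> (frag_of (i, y, p)) = 0" by (simp add: \<theta>.diff)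
  then show False using F(4) G(4) by (simp add: \<theta>_def)
qed

text \<open>
  Restoring the scalars one variable at a time: if \<open>y \<otimes> p\<close> bounds after \<open>x\<close> has been made balanced,
  then \<open>\<Sum> x\<^sup>a y \<otimes> x\<^sup>b p\<close>, summed over \<open>a + b = n - 1\<close>, bounds before. Multiplying by the last power
  of \<open>x\<close> that does not kill the class of \<open>y\<close> leaves only the term with \<open>b = n - 1\<close>.
\<close>

lemma socle_coboundary_if_tensor_boundary:
  assumes "finite S" "S \<subseteq> {1..}" "\<And>i. 1 \<le> i \<Longrightarrow> 0 < n i"
    and "y \<in> cocycles E i" "y \<notin> coboundaries E i" "p \<in> cocycles P j"
    and "frag_of (i, y, p) \<in> boundaries (subring_gens n S) (i + j)"
  shows "socle_elt n S \<odot>\<^bsub>obj P j\<^esub> p \<in> coboundaries P j"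
  using assms
proof (induction S arbitrary: y p rule: finite_induct)
  case empty
  then show ?case
    using tensor_not_boundary_field[of y i p j]
    by (auto simp: socle_elt_empty subring_gens_def cocycles_def)
next
  case (insert v S)
  let ?K = "subring_gens n S :: 'k lam set"
  define x :: "'k lam" where "x = xvar n v"
  have x: "x \<in> carrier (Lambda n)" by (simp add: x_def)
  have v: "1 \<le> v" "0 < n v" using insert by auto
  note K = subring_gens_closed[of n S]
  let ?L = "left_smult x" and ?R = "right_smult x"
  interpret nilpotent_pair X "J ?K" D ?L ?R "n v"
    unfolding x_def by (rule nilpotent_pair_xvar[OF v(1) K])
  let ?m = "i + j"
  have y: "y \<in> carrier (obj E i)" and p: "p \<in> carrier (obj P j)"
    using insert.prems by (auto simp: cocycles_def)
  \<comment> \<open>The last power of \<open>x\<close> that does not kill the class of \<open>y\<close>.\<close>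
  obtain a where a: "a < n v" "x [^]\<^bsub>Lambda n\<^esub> a \<odot>\<^bsub>obj E i\<^esub> y \<notin> coboundaries E i"
      "x [^]\<^bsub>Lambda n\<^esub> Suc a \<odot>\<^bsub>obj E i\<^esub> y \<in> coboundaries E i"
  proof -
    let ?Q = "\<lambda>a :: nat. x [^]\<^bsub>Lambda n\<^esub> a \<odot>\<^bsub>obj E i\<^esub> y \<in> coboundaries E i"
    have "?Q (n v)"
      using y E.zero_coboundaries v unfolding x_def by (simp add: xvar_pow_zero)
    moreover have "\<not> ?Q 0" using y insert.prems by simp
    ultimately obtain a where "a < n v" "\<forall>b\<le>a. \<not> ?Q b" "?Q (Suc a)"
      using ex_least_nat_less[of ?Q "n v"] by blast
    then show thesis by (intro that[of a]) auto
  qed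
  have high: "x [^]\<^bsub>Lambda n\<^esub> (a + c) \<odot>\<^bsub>obj E i\<^esub> y \<in> coboundaries E i" if "1 \<le> c" for c
    using that
  proof (induction c rule: dec_induct)
    case (step c)
    have "x [^]\<^bsub>Lambda n\<^esub> (a + Suc c) = x \<otimes>\<^bsub>Lambda n\<^esub> x [^]\<^bsub>Lambda n\<^esub> (a + c)"
      using x by (simp add: E.M.R.m_comm)
    then show ?case
      using E.coboundaries_smult[OF x step.IH] x y by (simp add: E.M.smult_assoc1)
  qed (use a in simp)
  let ?z = "frag_of (i, y, p)"
  have z: "?z \<in> X ?m" using y p by simp
  let ?T = "\<lambda>u. (?L ?m ^^ a) (G (n v) ?m u)"
  have "?T ?z \<in> boundaries ?K ?m"
  proof -
    obtain u where u: "u \<in> X (?m - 1)" "?z - D (?m - 1) u \<in> J (subring_gens n (insert v S)) ?m"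
      using insert.prems unfolding boundaries_def by blast
    have ins: "subring_gens n (insert v S) = insert x ?K" by (simp add: subring_gens_insert x_def)
    obtain k w where kw: "?z - D (?m - 1) u = k + (?L ?m w - ?R ?m w)" "k \<in> J ?K ?m" "w \<in> X ?m"
      using u(2) unfolding ins J_insert[OF x K] by blast
    interpret T: additive ?T by (simp add: additive_def G.add Lk.add)
    have "?T ?z - ?T (D (?m - 1) u) = ?T k + (?L ?m ^^ a) (G (n v) ?m (?L ?m w - ?R ?m w))"
      unfolding T.diff[symmetric] kw(1) T.add by (rule refl)
    also have "\<dots> \<in> J ?K ?m"
      using kw by (intro subgp_add[OF subgp_balanced_kernel] Lk G_J G_diff_J)
    finally have "?T ?z - ?T (D (?m - 1) u) \<in> J ?K ?m" .
    moreover have "?T (D (?m - 1) u) = D (?m - 1) ((?L (?m - 1) ^^ a) (G (n v) (?m - 1) u))"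
      using G_d[OF u(1)] Lk(3)[OF G_X[OF u(1)]] by simp
    ultimately show ?thesis
      using D_boundaries[OF Lk(1)[OF G_X[OF u(1)]]] boundaries_cong[OF J_boundaries] by simp
  qed
  \<comment> \<open>Only the term \<open>f 0\<close> survives: in the others the left factor is a coboundary.\<close>
  moreover define f where "f c = frag_of (i, x [^]\<^bsub>Lambda n\<^esub> (a + c) \<odot>\<^bsub>obj E i\<^esub> y, x [^]\<^bsub>Lambda n\<^esub> (n v - 1 - c) \<odot>\<^bsub>obj P j\<^esub> p)" for c
  have "?T ?z = (\<Sum>c<n v. f c)"
    unfolding G_def Lk.sum
  proof (intro sum.cong refl)
    fix c assume "c \<in> {..<n v}"
    have "x [^]\<^bsub>Lambda n\<^esub> a \<odot>\<^bsub>obj E i\<^esub> (x [^]\<^bsub>Lambda n\<^esub> c \<odot>\<^bsub>obj E i\<^esub> y) = x [^]\<^bsub>Lambda n\<^esub> (a + c) \<odot>\<^bsub>obj E i\<^esub> y"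
      using x y by (simp add: E.M.R.nat_pow_mult flip: E.M.smult_assoc1)
    then show "(?L ?m ^^ a) ((?L ?m ^^ c) ((?R ?m ^^ (n v - 1 - c)) ?z)) = f c"
      using x y p by (simp add: right_smult_pow left_smult_pow f_def)
  qed
  moreover have "(\<Sum>c\<in>{..<n v} - {0}. f c) \<in> boundaries ?K ?m"
    unfolding f_def
    by (rule subgp_sum[OF subgp_boundaries], rule tensor_coboundary_left)
      (use high x insert.prems in \<open>auto intro!: P.cocycles_smult\<close>)
  moreover have "(\<Sum>c<n v. f c) - (\<Sum>c\<in>{..<n v} - {0}. f c) = f 0"
    using v(2) by (simp add: sum_diff1)
  ultimately have "f 0 \<in> boundaries ?K ?m"
    using subgp_diff[OF subgp_boundaries] by metis
  then have "frag_of (i, x [^]\<^bsub>Lambda n\<^esub> a \<odot>\<^bsub>obj E i\<^esub> y, x [^]\<^bsub>Lambda n\<^esub> (n v - 1) \<odot>\<^bsub>obj P j\<^esub> p) \<in> boundaries ?K ?m"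
    by (simp add: f_def)
  then have "socle_elt n S \<odot>\<^bsub>obj P j\<^esub> (x [^]\<^bsub>Lambda n\<^esub> (n v - 1) \<odot>\<^bsub>obj P j\<^esub> p) \<in> coboundaries P j"
    using a x insert.prems by (intro insert.IH) (auto intro!: P.cocycles_smult E.cocycles_smult)
  then show ?case
    using insert.hyps p x by (simp add: socle_elt_insert x_def P.M.smult_assoc1)
qed

end

section \<open>The graded dual\<close>

lemma mono_deg_add: "mono_deg (a + b) = mono_deg a + mono_deg b"
  unfolding mono_deg_def by (rule setsum_keys_plus_distrib) (auto simp: distrib_right)

lemma mono_deg_ge: "lookup m j \<noteq> 0 \<Longrightarrow> 2 ^ (j + 1) \<le> mono_deg m"
proof -
  assume j: "lookup m j \<noteq> 0"
  have "2 ^ (j + 1) \<le> lookup m j * 2 ^ (j + 1)" using j by simp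
  also have "\<dots> \<le> mono_deg m"
    unfolding mono_deg_def using j by (intro member_le_sum) (auto simp: in_keys_iff)
  finally show ?thesis .
qed

lemma dual_carrier_add:
  "f \<in> dual_carrier n \<Longrightarrow> a \<in> carrier (Lambda n) \<Longrightarrow> b \<in> carrier (Lambda n) \<Longrightarrow> f (a \<oplus>\<^bsub>Lambda n\<^esub> b) = f a + f b"
  by (simp add: dual_carrier_def)

lemma dual_carrier_const:
  "f \<in> dual_carrier n \<Longrightarrow> a \<in> carrier (Lambda n) \<Longrightarrow> f (Lambda_const n c \<otimes>\<^bsub>Lambda n\<^esub> a) = c * f a"
  by (simp add: dual_carrier_def)

lemma dual_carrier_zero: "f \<in> dual_carrier n \<Longrightarrow> f \<zero>\<^bsub>Lambda n\<^esub> = 0"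
  using dual_carrier_const[of f n "\<zero>\<^bsub>Lambda n\<^esub>" 0] by (simp add: Lambda_const_eq zero_Lambda cls_mult)

lemma dual_carrier_finite: "f \<in> dual_carrier n \<Longrightarrow> finite {e. \<exists>a\<in>Lambda_piece n e. f a \<noteq> 0}"
  by (simp add: dual_carrier_def)

lemma Lambda_piece_subset: "Lambda_piece n e \<subseteq> carrier (Lambda n)"
  by (auto simp: Lambda_piece_eq)

lemma dual_carrierI:
  assumes "f \<in> extensional (carrier (Lambda n))"
    "\<And>a b. a \<in> carrier (Lambda n) \<Longrightarrow> b \<in> carrier (Lambda n) \<Longrightarrow> f (a \<oplus>\<^bsub>Lambda n\<^esub> b) = f a + f b"
    "\<And>c a. a \<in> carrier (Lambda n) \<Longrightarrow> f (Lambda_const n c \<otimes>\<^bsub>Lambda n\<^esub> a) = c * f a"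
    "finite {e. \<exists>a\<in>Lambda_piece n e. f a \<noteq> 0}"
  shows "f \<in> dual_carrier n"
  using assms by (simp add: dual_carrier_def)

lemma dual_carrier_eqI:
  assumes "f \<in> dual_carrier n" "g \<in> dual_carrier n"
    and "\<And>\<nu>. reduced n \<nu> \<Longrightarrow> f (cls n (single \<nu> 1)) = g (cls n (single \<nu> 1))"
  shows "f = g"
proof (rule extensionalityI)
  show "f \<in> extensional (carrier (Lambda n))" "g \<in> extensional (carrier (Lambda n))"
    using assms by (simp_all add: dual_carrier_def)
  fix a :: "'a lam" assume "a \<in> carrier (Lambda n)"
  then obtain p where a: "a = cls n p" by (rule Lambda_cases)
  have one: "f (cls n (single \<nu> 1)) = g (cls n (single \<nu> 1))" for \<nu>
    using assms dual_carrier_zero[OF assms(1)] dual_carrier_zero[OF assms(2)]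
    by (cases "reduced n \<nu>") (simp_all add: cls_single_zero)
  have "f (cls n p) = g (cls n p)"
  proof (induction p rule: mpoly_induct)
    case zero
    then show ?case using dual_carrier_zero[OF assms(1)] dual_carrier_zero[OF assms(2)] by (simp add: zero_Lambda)
  next
    case (single m c)
    have "cls n (single m c) = Lambda_const n c \<otimes>\<^bsub>Lambda n\<^esub> cls n (single m 1)"
      by (simp add: Lambda_const_eq cls_mult mult_single)
    then show ?case using one by (simp add: dual_carrier_const[OF assms(1)] dual_carrier_const[OF assms(2)])
  next
    case (add p q)
    then show ?case
      by (simp add: dual_carrier_add[OF assms(1)] dual_carrier_add[OF assms(2)] flip: cls_add)
  qed
  then show "f a = g a" by (simp add: a)
qed

text \<open>
  Finiteness of the set of degrees is preserved because multiplication by a variable shifts degrees;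
  general scalars are reached by sums and products.
\<close>

lemma dual_smult_closed:
  assumes "l \<in> carrier (Lambda n)" "f \<in> dual_carrier n"
  shows "(\<lambda>a\<in>carrier (Lambda n). f (l \<otimes>\<^bsub>Lambda n\<^esub> a)) \<in> (dual_carrier n :: ('k::field lam \<Rightarrow> 'k) set)"
  using assms
proof (induction l arbitrary: f rule: Lambda_induct)
  interpret cring "Lambda n :: 'k lam ring" by (rule cring_Lambda)
  have swap: "l \<otimes>\<^bsub>Lambda n\<^esub> (Lambda_const n c \<otimes>\<^bsub>Lambda n\<^esub> a) = Lambda_const n c \<otimes>\<^bsub>Lambda n\<^esub> (l \<otimes>\<^bsub>Lambda n\<^esub> a)"
    if "l \<in> carrier (Lambda n)" "a \<in> carrier (Lambda n)" for l a and c :: 'k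
    using that by (intro m_lcomm) auto
  have lin: "(\<lambda>a\<in>carrier (Lambda n). f (l \<otimes>\<^bsub>Lambda n\<^esub> a)) \<in> dual_carrier n"
    if "l \<in> carrier (Lambda n)" "f \<in> dual_carrier n"
      "finite {e. \<exists>a\<in>Lambda_piece n e. f (l \<otimes>\<^bsub>Lambda n\<^esub> a) \<noteq> 0}" for l and f :: "'k lam \<Rightarrow> 'k"
  proof (rule dual_carrierI)
    have "{e. \<exists>a\<in>Lambda_piece n e. (\<lambda>a\<in>carrier (Lambda n). f (l \<otimes>\<^bsub>Lambda n\<^esub> a)) a \<noteq> 0}
        \<subseteq> {e. \<exists>a\<in>Lambda_piece n e. f (l \<otimes>\<^bsub>Lambda n\<^esub> a) \<noteq> 0}"
      using Lambda_piece_subset by fastforce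
    then show "finite {e. \<exists>a\<in>Lambda_piece n e. (\<lambda>a\<in>carrier (Lambda n). f (l \<otimes>\<^bsub>Lambda n\<^esub> a)) a \<noteq> 0}"
      using that(3) by (rule finite_subset)
  qed (use that in \<open>auto simp: dual_carrier_add dual_carrier_const r_distr swap\<close>)
  {
    case (const c)
    have "{e. \<exists>a\<in>Lambda_piece n e. f (Lambda_const n c \<otimes>\<^bsub>Lambda n\<^esub> a) \<noteq> 0} \<subseteq> {e. \<exists>a\<in>Lambda_piece n e. f a \<noteq> 0}"
      using const Lambda_piece_subset[of n] by (fastforce simp: dual_carrier_const)
    from finite_subset[OF this dual_carrier_finite] show ?case using const by (intro lin) auto
  next
    case (var i)
    have piece: "xvar n i \<otimes>\<^bsub>Lambda n\<^esub> a \<in> Lambda_piece n (e + int (mono_deg (single (i - 1) 1)))"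
      if a: "a \<in> Lambda_piece n e" for a :: "'k lam" and e
    proof -
      obtain p where p: "a = cls n p" "\<forall>m\<in>keys p. int (mono_deg m) = e"
        using a unfolding Lambda_piece_eq by blast
      have "\<forall>m\<in>keys (var i * p). int (mono_deg m) = e + int (mono_deg (single (i - 1) 1))"
        using keys_mult[of "var i" p] p(2) by (force simp: var_def mono_deg_add)
      then show ?thesis by (auto simp: p xvar_def cls_mult Lambda_piece_eq)
    qed
    have "{e. \<exists>a\<in>Lambda_piece n e. f (xvar n i \<otimes>\<^bsub>Lambda n\<^esub> a) \<noteq> 0}
        \<subseteq> (\<lambda>e. e - int (mono_deg (single (i - 1) 1))) ` {e. \<exists>a\<in>Lambda_piece n e. f a \<noteq> 0}"
      using piece by (force simp: image_iff)
    from finite_subset[OF this finite_imageI[OF dual_carrier_finite]] show ?case using var by (intro lin) auto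
  next
    case (add l l')
    let ?g = "\<lambda>l. \<lambda>a\<in>carrier (Lambda n). f (l \<otimes>\<^bsub>Lambda n\<^esub> a)"
    have "{e. \<exists>a\<in>Lambda_piece n e. f ((l \<oplus>\<^bsub>Lambda n\<^esub> l') \<otimes>\<^bsub>Lambda n\<^esub> a) \<noteq> 0}
        \<subseteq> {e. \<exists>a\<in>Lambda_piece n e. ?g l a \<noteq> 0} \<union> {e. \<exists>a\<in>Lambda_piece n e. ?g l' a \<noteq> 0}"
      using add Lambda_piece_subset[of n] by (fastforce simp: l_distr dual_carrier_add)
    from finite_subset[OF this finite_UnI[OF dual_carrier_finite[OF add.IH(1)] dual_carrier_finite[OF add.IH(2)]]]
    show ?case using add by (intro lin) auto
  next
    case (mult l l')
    let ?g = "\<lambda>a\<in>carrier (Lambda n). f (l \<otimes>\<^bsub>Lambda n\<^esub> a)"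
    have "?g \<in> dual_carrier n" using mult by blast
    then have "(\<lambda>a\<in>carrier (Lambda n). ?g (l' \<otimes>\<^bsub>Lambda n\<^esub> a)) \<in> dual_carrier n" using mult by blast
    moreover have "(\<lambda>a\<in>carrier (Lambda n). ?g (l' \<otimes>\<^bsub>Lambda n\<^esub> a)) = (\<lambda>a\<in>carrier (Lambda n). f (l \<otimes>\<^bsub>Lambda n\<^esub> l' \<otimes>\<^bsub>Lambda n\<^esub> a))"
      using mult by (intro restrict_ext) (simp add: m_assoc)
    ultimately show ?case by (simp only:)
  }
qed

lemma dual_gmod_simps [simp]:
  "carrier (dual_gmod n) = dual_carrier n" "\<zero>\<^bsub>dual_gmod n\<^esub> = (\<lambda>a\<in>carrier (Lambda n). 0)"
  "f \<oplus>\<^bsub>dual_gmod n\<^esub> g = (\<lambda>a\<in>carrier (Lambda n). f a + g a)"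
  "l \<odot>\<^bsub>dual_gmod n\<^esub> f = (\<lambda>a\<in>carrier (Lambda n). f (l \<otimes>\<^bsub>Lambda n\<^esub> a))"
  by (simp_all add: dual_gmod_def)

lemma zero_dual_carrier: "(\<lambda>a\<in>carrier (Lambda n). 0) \<in> (dual_carrier n :: ('k::field lam \<Rightarrow> 'k) set)"
proof -
  interpret cring "Lambda n :: 'k lam ring" by (rule cring_Lambda)
  show ?thesis
  proof (rule dual_carrierI)
    have "{e. \<exists>a\<in>Lambda_piece n e. (\<lambda>a\<in>carrier (Lambda n). 0 :: 'k) (a :: 'k lam) \<noteq> 0} \<subseteq> {}"
      using Lambda_piece_subset by fastforce
    then show "finite {e. \<exists>a\<in>Lambda_piece n e. (\<lambda>a\<in>carrier (Lambda n). 0 :: 'k) (a :: 'k lam) \<noteq> 0}"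
      by (rule finite_subset) (rule finite.emptyI)
  qed auto
qed

lemma add_dual_carrier:
  assumes "f \<in> dual_carrier n" "g \<in> dual_carrier n"
  shows "(\<lambda>a\<in>carrier (Lambda n). f a + g a) \<in> dual_carrier n"
proof -
  interpret cring "Lambda n" by (rule cring_Lambda)
  show ?thesis
  proof (rule dual_carrierI)
    have "{e. \<exists>a\<in>Lambda_piece n e. (\<lambda>a\<in>carrier (Lambda n). f a + g a) a \<noteq> 0}
        \<subseteq> {e. \<exists>a\<in>Lambda_piece n e. f a \<noteq> 0} \<union> {e. \<exists>a\<in>Lambda_piece n e. g a \<noteq> 0}"
      using Lambda_piece_subset by fastforce
    then show "finite {e. \<exists>a\<in>Lambda_piece n e. (\<lambda>a\<in>carrier (Lambda n). f a + g a) a \<noteq> 0}"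
      by (rule finite_subset[OF _ finite_UnI[OF assms[THEN dual_carrier_finite]]])
  qed (use assms in \<open>auto simp: dual_carrier_add dual_carrier_const algebra_simps\<close>)
qed

lemma module_dual_gmod: "Module.module (Lambda n) (dual_gmod n :: ('k::field lam, 'k lam \<Rightarrow> 'k) gmod)"
proof (rule moduleI)
  show "cring (Lambda n :: 'k lam ring)" by (rule cring_Lambda)
  interpret cring "Lambda n :: 'k lam ring" by (rule cring_Lambda)
  have ext: "f \<in> extensional (carrier (Lambda n))" if "f \<in> dual_carrier n" for f :: "'k lam \<Rightarrow> 'k"
    using that by (simp add: dual_carrier_def)
  show "abelian_group (dual_gmod n :: ('k lam, 'k lam \<Rightarrow> 'k) gmod)"
  proof (rule abelian_groupI)
    fix f :: "'k lam \<Rightarrow> 'k" assume f: "f \<in> carrier (dual_gmod n)"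
    let ?g = "Lambda_const n (- 1) \<odot>\<^bsub>dual_gmod n\<^esub> f"
    have "?g \<in> carrier (dual_gmod n)"
      using f by (simp add: dual_smult_closed)
    moreover have "?g \<oplus>\<^bsub>dual_gmod n\<^esub> f = \<zero>\<^bsub>dual_gmod n\<^esub>"
      using f by (auto simp: dual_carrier_const intro!: restrict_ext)
    ultimately show "\<exists>g\<in>carrier (dual_gmod n). g \<oplus>\<^bsub>dual_gmod n\<^esub> f = \<zero>\<^bsub>dual_gmod n\<^esub>"
      by (intro bexI[of _ ?g])
  next
    fix f :: "'k lam \<Rightarrow> 'k" assume f: "f \<in> carrier (dual_gmod n)"
    show "\<zero>\<^bsub>dual_gmod n\<^esub> \<oplus>\<^bsub>dual_gmod n\<^esub> f = f"
      by (rule extensionalityI[OF _ ext]) (use f in auto)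
  qed (auto simp: zero_dual_carrier add_dual_carrier intro!: restrict_ext)
  fix l l' :: "'k lam" and f g :: "'k lam \<Rightarrow> 'k"
  assume f: "f \<in> carrier (dual_gmod n)"
  show "\<one>\<^bsub>Lambda n\<^esub> \<odot>\<^bsub>dual_gmod n\<^esub> f = f"
    by (rule extensionalityI[OF _ ext]) (use f in auto)
  assume l: "l \<in> carrier (Lambda n)"
  show "l \<odot>\<^bsub>dual_gmod n\<^esub> f \<in> carrier (dual_gmod n)"
    using l f by (simp add: dual_smult_closed)
  show "l \<odot>\<^bsub>dual_gmod n\<^esub> (f \<oplus>\<^bsub>dual_gmod n\<^esub> g) = l \<odot>\<^bsub>dual_gmod n\<^esub> f \<oplus>\<^bsub>dual_gmod n\<^esub> l \<odot>\<^bsub>dual_gmod n\<^esub> g"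
    using l by (auto intro!: restrict_ext)
  assume l': "l' \<in> carrier (Lambda n)"
  show "(l \<oplus>\<^bsub>Lambda n\<^esub> l') \<odot>\<^bsub>dual_gmod n\<^esub> f = l \<odot>\<^bsub>dual_gmod n\<^esub> f \<oplus>\<^bsub>dual_gmod n\<^esub> l' \<odot>\<^bsub>dual_gmod n\<^esub> f"
    using l l' f by (auto intro!: restrict_ext simp: l_distr dual_carrier_add)
  show "(l \<otimes>\<^bsub>Lambda n\<^esub> l') \<odot>\<^bsub>dual_gmod n\<^esub> f = l \<odot>\<^bsub>dual_gmod n\<^esub> (l' \<odot>\<^bsub>dual_gmod n\<^esub> f)"
    using l l' by (auto intro!: restrict_ext simp: m_assoc m_lcomm)
qed

lemma module_zero_part:
  assumes "Module.module R M"
  shows "Module.module R (M\<lparr>carrier := {\<zero>\<^bsub>M\<^esub>}, piece := f\<rparr>)"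
proof -
  interpret Module.module R M by fact
  show ?thesis
    by (rule moduleI) (auto intro!: abelian_groupI is_cring simp: R.is_cring)
qed

lemma obj_stalk_complex:
  "obj (stalk_complex M) i = (if i = 0 then M else M\<lparr>carrier := {\<zero>\<^bsub>M\<^esub>}, piece := (\<lambda>_. {\<zero>\<^bsub>M\<^esub>})\<rparr>)"
  "bd (stalk_complex M) i x = \<zero>\<^bsub>M\<^esub>"
  by (simp_all add: stalk_complex_def)

lemma lam_complex_stalk:
  assumes "Module.module (Lambda n) M" shows "lam_complex n (stalk_complex M)"
proof -
  interpret Module.module "Lambda n" M by fact
  show ?thesis
    by (rule lam_complex.intro)
      (auto simp: obj_stalk_complex hom_def assms module_zero_part)
qed

lemma lam_complex_dual: "lam_complex n (dual_complex n)"
  unfolding dual_complex_def by (rule lam_complex_stalk[OF module_dual_gmod])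

lemma lookup_socle:
  assumes "finite S" "S \<subseteq> {1..}"
  shows "lookup (socle n S) j = (if Suc j \<in> S then n (Suc j) - 1 else 0)"
proof -
  have "lookup (socle n S) j = (\<Sum>i\<in>S. if i = Suc j then n (Suc j) - 1 else 0)"
    unfolding socle_def lookup_sum using assms(2)
    by (intro sum.cong) (auto simp: lookup_single when_def)
  then show ?thesis using assms(1) by simp
qed

text \<open>
  The functional that reads off the coefficient of the largest reduced monomial in the first \<open>M\<close>
  variables; outside of the carrier it is undefined, as extensionality demands.
\<close>

definition socle_functional :: "(nat \<Rightarrow> nat) \<Rightarrow> nat \<Rightarrow> 'k::field lam \<Rightarrow> 'k" where
  "socle_functional n M = (\<lambda>a\<in>carrier (Lambda n). coef n a (socle n {0<..M}))"

context
  fixes n :: "nat \<Rightarrow> nat"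
  assumes n_pos: "\<And>i. 1 \<le> i \<Longrightarrow> 0 < n i"
begin

lemma reduced_socle: "reduced n (socle n {0<..M})"
  unfolding reduced_def using n_pos by (subst lookup_socle) auto

lemma socle_split: "M \<le> M' \<Longrightarrow> socle n {0<..M'} = socle n {0<..M} + socle n {M<..M'}"
  unfolding socle_def by (subst sum.union_disjoint[symmetric]) (auto intro!: sum.cong)

lemma socle_functional_cls:
  "socle_functional n M (cls n p) = lookup p (socle n {0<..M})"
  by (simp add: socle_functional_def reduced_socle)

lemma socle_functional_dual: "socle_functional n M \<in> dual_carrier n"
proof (rule dual_carrierI)
  have "{e. \<exists>a\<in>Lambda_piece n e. socle_functional n M a \<noteq> (0 :: 'a)} \<subseteq> {int (mono_deg (socle n {0<..M}))}"
    by (auto simp: Lambda_piece_eq socle_functional_cls in_keys_iff)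
  then show "finite {e. \<exists>a\<in>Lambda_piece n e. socle_functional n M a \<noteq> (0 :: 'a)}"
    by (rule finite_subset) simp
  fix c :: 'a and a :: "'a lam" assume "a \<in> carrier (Lambda n)"
  then obtain p where p: "a = cls n p" by (rule Lambda_cases)
  show "socle_functional n M (Lambda_const n c \<otimes>\<^bsub>Lambda n\<^esub> a) = c * socle_functional n M a"
    using lookup_mult_single_add[of p 0 c "socle n {0<..M}"]
    by (simp add: p Lambda_const_eq cls_mult socle_functional_cls mult.commute)
next
  fix a b :: "'a lam" assume ab: "a \<in> carrier (Lambda n)" "b \<in> carrier (Lambda n)"
  then have "a \<oplus>\<^bsub>Lambda n\<^esub> b \<in> carrier (Lambda n)"
    by (elim Lambda_cases) (simp add: cls_add)
  then show "socle_functional n M (a \<oplus>\<^bsub>Lambda n\<^esub> b) = socle_functional n M a + socle_functional n M b"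
    using ab by (simp add: socle_functional_def coef_add reduced_socle)
qed (simp add: socle_functional_def)

lemma socle_functional_smult:
  assumes "M \<le> M'"
  shows "socle_elt n {M<..M'} \<odot>\<^bsub>dual_gmod n\<^esub> socle_functional n M' = socle_functional n M"
proof (rule extensionalityI[of _ "carrier (Lambda n)"])
  fix a :: "'a lam" assume a: "a \<in> carrier (Lambda n)"
  then obtain p where p: "a = cls n p" by (rule Lambda_cases)
  show "(socle_elt n {M<..M'} \<odot>\<^bsub>dual_gmod n\<^esub> socle_functional n M') a = socle_functional n M a"
    using lookup_mult_single_add[of p "socle n {M<..M'}" 1 "socle n {0<..M}"] a
    by (simp add: p socle_elt_def cls_mult socle_functional_cls mult.commute socle_split[OF assms])
qed (auto simp: socle_functional_def)

lemma finite_divisors: "finite {\<kappa> :: monomial. \<exists>\<rho>. \<tau> = \<rho> + \<kappa>}"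
proof -
  let ?F = "{f. \<forall>x. (x \<in> keys \<tau> \<longrightarrow> f x \<in> {..Max (lookup \<tau> ` keys \<tau>)}) \<and> (x \<notin> keys \<tau> \<longrightarrow> f x = 0)}"
  have "lookup \<kappa> \<in> ?F" if "\<tau> = \<rho> + \<kappa>" for \<rho> \<kappa> :: monomial
  proof -
    have le: "lookup \<kappa> x \<le> lookup \<tau> x" for x
      using that by (simp add: lookup_add)
    have "lookup \<kappa> x \<le> Max (lookup \<tau> ` keys \<tau>)" if "x \<in> keys \<tau>" for x
      using le[of x] that by (meson Max_ge finite_imageI finite_keys imageI order_trans)
    moreover have "lookup \<kappa> x = 0" if "x \<notin> keys \<tau>" for x
      using le[of x] that by (simp add: in_keys_iff)
    ultimately show ?thesis by auto
  qed
  then have "lookup ` {\<kappa>. \<exists>\<rho>. \<tau> = \<rho> + \<kappa>} \<subseteq> ?F"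
    by (intro image_subsetI) (elim CollectE exE)
  moreover have "finite ?F" by (rule finite_set_of_finite_funs) simp_all
  ultimately have "finite (lookup ` {\<kappa>. \<exists>\<rho>. \<tau> = \<rho> + \<kappa>})"
    by (rule finite_subset)
  then show ?thesis
    by (rule finite_imageD) (rule inj_onI, simp only: lookup_inject)
qed

text \<open>
  The dual is the union of the cyclic submodules generated by these functionals: a functional that
  vanishes in degrees above \<open>2\<^sup>M\<close> only sees the first \<open>M\<close> variables, and on the subring that they
  generate every functional is a multiple of the coefficient of the socle monomial, because pairing
  complementary monomials is perfect.
\<close>

lemma dual_eq_smult_socle_functional:
  assumes f: "f \<in> (dual_carrier n :: ('k::field lam \<Rightarrow> 'k) set)"
  shows "\<exists>M0. \<forall>M\<ge>M0. \<exists>l\<in>carrier (Lambda n). f = l \<odot>\<^bsub>dual_gmod n\<^esub> socle_functional n M"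
proof -
  let ?mon = "\<lambda>\<nu>. cls n (single \<nu> 1) :: 'k lam"
  have "finite {e. \<exists>a\<in>Lambda_piece n e. f a \<noteq> 0}" using f by (rule dual_carrier_finite)
  then obtain M0 :: int where M0: "\<And>e a. a \<in> Lambda_piece n e \<Longrightarrow> f a \<noteq> 0 \<Longrightarrow> e \<le> M0"
    by (metis (mono_tags, lifting) Max_ge mem_Collect_eq)
  have high: "f (?mon \<nu>) = 0" if "lookup \<nu> j \<noteq> 0" "nat M0 \<le> j" for \<nu> j
  proof (rule ccontr)
    assume "f (?mon \<nu>) \<noteq> 0"
    moreover have "?mon \<nu> \<in> Lambda_piece n (int (mono_deg \<nu>))" by (auto simp: Lambda_piece_eq)
    ultimately have "int (mono_deg \<nu>) \<le> M0" using M0 by blast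
    moreover have "2 ^ (j + 1) \<le> mono_deg \<nu>" using that(1) by (rule mono_deg_ge)
    moreover have "j + 1 < 2 ^ (j + 1)" by (rule less_exp)
    ultimately show False using that(2) by linarith
  qed
  have "\<exists>l\<in>carrier (Lambda n). f = l \<odot>\<^bsub>dual_gmod n\<^esub> socle_functional n M" if M: "nat M0 \<le> M" for M
  proof -
    let ?\<tau> = "socle n {0<..M}"
    define A where "A = {\<kappa>. \<exists>\<rho>. ?\<tau> = \<rho> + \<kappa>}"
    have A: "finite A" unfolding A_def by (rule finite_divisors)
    \<comment> \<open>The multiplier has as its coefficient at \<open>\<kappa>\<close> the value of \<open>f\<close> at the complement of \<open>\<kappa>\<close>.\<close>
    define r where "r = (\<Sum>\<kappa>\<in>A. single \<kappa> (f (?mon (?\<tau> - \<kappa>))))"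
    have r: "lookup r \<kappa> = f (?mon (?\<tau> - \<kappa>))" if "\<kappa> \<in> A" for \<kappa>
      unfolding r_def lookup_sum using that A by (simp add: lookup_single when_def)
    have "f = cls n r \<odot>\<^bsub>dual_gmod n\<^esub> socle_functional n M"
    proof (rule dual_carrier_eqI[OF f])
      show "cls n r \<odot>\<^bsub>dual_gmod n\<^esub> socle_functional n M \<in> dual_carrier n"
        by (simp add: dual_smult_closed socle_functional_dual)
      fix \<nu> assume \<nu>: "reduced n \<nu>"
      have val: "(cls n r \<odot>\<^bsub>dual_gmod n\<^esub> socle_functional n M) (?mon \<nu>) = lookup (r * single \<nu> 1) ?\<tau>"
        by (simp add: cls_mult socle_functional_cls)
      show "f (?mon \<nu>) = (cls n r \<odot>\<^bsub>dual_gmod n\<^esub> socle_functional n M) (?mon \<nu>)"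
      proof (cases "\<exists>\<kappa>. ?\<tau> = \<kappa> + \<nu>")
        case True
        then obtain \<kappa> where \<kappa>: "?\<tau> = \<kappa> + \<nu>" by blast
        then have "\<kappa> \<in> A" unfolding A_def by (auto simp: add.commute)
        then have "lookup r \<kappa> = f (?mon \<nu>)" using r \<kappa> by simp
        then show ?thesis unfolding val \<kappa> by (simp add: lookup_mult_single_add)
      next
        case False
        have "\<exists>j. M \<le> j \<and> lookup \<nu> j \<noteq> 0"
        proof (rule ccontr)
          assume none: "\<not> ?thesis"
          have "?\<tau> = (?\<tau> - \<nu>) + \<nu>"
          proof (rule poly_mapping_eqI)
            fix j
            have "lookup \<nu> j \<le> lookup ?\<tau> j"
              using none \<nu>[unfolded reduced_def, rule_format, of j] by (subst lookup_socle) auto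
            then show "lookup ?\<tau> j = lookup (?\<tau> - \<nu> + \<nu>) j"
              by (simp add: lookup_add lookup_minus)
          qed
          then show False using False by blast
        qed
        then show ?thesis
          unfolding val using high M False lookup_mult_single_zero[of ?\<tau> \<nu> r 1] by force
      qed
    qed
    then show ?thesis by (intro bexI[of _ "cls n r"]) auto
  qed
  then show ?thesis by blast
qed

text \<open>
  If \<open>c\<close> had a monomial in the first \<open>M\<close> variables alone, multiplying it by the complementary monomial
  would be seen by the socle functional. So all reduced monomials of \<open>c\<close> involve a later variable, and the
  top power of that variable kills them.
\<close>

lemma socle_elt_kills_annihilator:
  assumes c: "c \<in> carrier (Lambda n)"
    and ann: "\<And>a. a \<in> carrier (Lambda n) \<Longrightarrow> socle_functional n M (c \<otimes>\<^bsub>Lambda n\<^esub> a) = (0 :: 'k::field)"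
  shows "\<exists>M0. \<forall>M'\<ge>M0. socle_elt n {M<..M'} \<otimes>\<^bsub>Lambda n\<^esub> c = \<zero>\<^bsub>Lambda n\<^esub>"
proof -
  obtain p where p: "c = cls n p" using c by (rule Lambda_cases)
  have "finite (\<Union>\<mu>\<in>keys p. keys \<mu>)" by simp
  then obtain M0 where M0: "\<And>\<mu> j. \<mu> \<in> keys p \<Longrightarrow> j \<in> keys \<mu> \<Longrightarrow> j < M0"
    unfolding finite_nat_set_iff_bounded by blast
  have "socle_elt n {M<..M'} \<otimes>\<^bsub>Lambda n\<^esub> c = \<zero>\<^bsub>Lambda n\<^esub>" if M': "M0 \<le> M'" for M'
  proof -
    let ?\<sigma> = "socle n {M<..M'}"
    have sub: "{M<..M'} \<subseteq> {1..}" by auto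
    have "lookup (p * single ?\<sigma> 1) \<tau> = 0" if \<tau>: "reduced n \<tau>" for \<tau>
    proof (cases "\<exists>\<kappa>. \<tau> = \<kappa> + ?\<sigma>")
      case True
      then obtain \<kappa> where \<kappa>: "\<tau> = \<kappa> + ?\<sigma>" by blast
      have "lookup p \<kappa> = 0"
      proof (rule ccontr)
        assume nz: "lookup p \<kappa> \<noteq> 0"
        have lt: "lookup \<kappa> j < n (Suc j)" for j
          using \<tau>[unfolded reduced_def, rule_format, of j] by (simp add: \<kappa> lookup_add)
        have "lookup \<kappa> j = 0" if j: "M \<le> j" for j
        proof (cases "j < M'")
          case True
          then show ?thesis
            using \<tau>[unfolded reduced_def, rule_format, of j] j by (simp add: \<kappa> lookup_add lookup_socle[OF _ sub])
        next
          case False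
          then show ?thesis using M0[of \<kappa> j] nz M' by (auto simp: in_keys_iff)
        qed
        then have "lookup \<kappa> j \<le> lookup (socle n {0<..M}) j" for j
          using lt[of j] by (subst lookup_socle) (auto simp: not_le)
        then have "socle n {0<..M} = \<kappa> + (socle n {0<..M} - \<kappa>)"
          by (intro poly_mapping_eqI) (simp add: lookup_add lookup_minus)
        then show False
          using ann[of "cls n (single (socle n {0<..M} - \<kappa>) 1)"] nz
            lookup_mult_single_add[of p "socle n {0<..M} - \<kappa>" 1 \<kappa>]
          by (simp add: p cls_mult socle_functional_cls)
      qed
      then show ?thesis unfolding \<kappa> by (simp add: lookup_mult_single_add)
    next
      case False
      then show ?thesis by (intro lookup_mult_single_zero) blast
    qed
    then show ?thesis
      by (simp add: p socle_elt_def cls_mult zero_Lambda cls_eq_iff mult.commute)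
  qed
  then show ?thesis by blast
qed

end

section \<open>Minimality\<close>

lemma obj_dual_complex:
  "obj (dual_complex n) 0 = dual_gmod n"
  "i \<noteq> 0 \<Longrightarrow> carrier (obj (dual_complex n) i) = {\<zero>\<^bsub>obj (dual_complex n) i\<^esub>}"
  "bd (dual_complex n) i f = \<zero>\<^bsub>obj (dual_complex n) (i + 1)\<^esub>"
  by (simp_all add: dual_complex_def obj_stalk_complex)

text \<open>
  Every element of \<open>I \<otimes> P\<close> is a single tensor \<open>e \<otimes> p\<close> with \<open>e\<close> a socle functional, and since
  \<open>e \<otimes> q = 0\<close> forces a socle element to kill \<open>q\<close> when \<open>P\<close> is free, a cocycle can be written with
  \<open>p\<close> a cocycle. It bounds as soon as some further socle element takes \<open>p\<close> to a coboundary.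
\<close>

lemma acyclic_dual_tensor:
  fixes P :: "('k::field lam, 'b) gcomplex"
  assumes n_pos: "\<And>i. 1 \<le> i \<Longrightarrow> 0 < n i" and P: "lam_complex n P"
    and free: "\<And>j. free_module n (obj P j) (B j)"
    and bound: "\<And>m p M. p \<in> cocycles P m \<Longrightarrow> \<exists>M'\<ge>M. socle_elt n {M<..M'} \<odot>\<^bsub>obj P m\<^esub> p \<in> coboundaries P m"
  shows "acyclic_mod (formal_tensors (dual_complex n) P) (balanced_kernel (carrier (Lambda n)) (dual_complex n) P)
    (formal_bd (dual_complex n) P)"
proof -
  interpret E: lam_complex n "dual_complex n :: ('k lam, 'k lam \<Rightarrow> 'k) gcomplex" by (rule lam_complex_dual)
  interpret P: lam_complex n P by (rule P)
  interpret tensor_pair n "dual_complex n :: ('k lam, 'k lam \<Rightarrow> 'k) gcomplex" P ..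
  interpret free: free_module n "obj P j" "B j" for j by (rule free)
  let ?\<Lambda> = "carrier (Lambda n) :: 'k lam set"
  let ?J = "J ?\<Lambda>"
  let ?e = "socle_functional n :: nat \<Rightarrow> 'k lam \<Rightarrow> 'k"
  note sg = subgp_balanced_kernel[of ?\<Lambda> "dual_complex n :: ('k lam, 'k lam \<Rightarrow> 'k) gcomplex" P]
  have e: "?e M \<in> carrier (obj (dual_complex n) 0)" for M
    using socle_functional_dual[OF n_pos] by (simp add: obj_dual_complex)
  have shift: "frag_of (0, ?e M, q) - frag_of (0, ?e M', socle_elt n {M<..M'} \<odot>\<^bsub>obj P m\<^esub> q) \<in> ?J m"
    if "M \<le> M'" "q \<in> carrier (obj P m)" for M M' q m
  proof -
    have "socle_elt n {M<..M'} \<odot>\<^bsub>obj (dual_complex n) 0\<^esub> ?e M' = ?e M"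
      using socle_functional_smult[OF n_pos that(1)] by (simp add: obj_dual_complex)
    then show ?thesis
      using J_balanced[of "socle_elt n {M<..M'}" ?\<Lambda> "?e M'" 0 q m] e that(2) by simp
  qed
  have single: "\<exists>M. \<forall>M'\<ge>M. \<exists>q\<in>carrier (obj P m). z - frag_of (0, ?e M', q) \<in> ?J m"
    if "z \<in> X m" for z m
  proof -
    have "keys z \<subseteq> tensor_symbols (dual_complex n) P m"
      using that by (simp add: formal_tensors_def)
    then show ?thesis
    proof (induction z rule: frag_induction)
      case zero
      have "0 - frag_of (0, ?e M, \<zero>\<^bsub>obj P m\<^esub>) \<in> ?J m" for M
        using J_zero_right[OF e, of M m ?\<Lambda>] subgp_minus[OF sg] by simp
      then show ?case by (intro exI[of _ 0] allI impI bexI[of _ "\<zero>\<^bsub>obj P m\<^esub>"]) auto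
    next
      case (one s)
      then obtain p f q where s: "s = (p, f, q)" "f \<in> carrier (obj (dual_complex n) p)" "q \<in> carrier (obj P (m - p))"
        by (auto simp: tensor_symbols_def)
      show ?case
      proof (cases "p = 0")
        case True
        then have f: "f \<in> dual_carrier n" and q: "q \<in> carrier (obj P m)" using s by (simp_all add: obj_dual_complex)
        obtain M0 where M0: "\<And>M. M0 \<le> M \<Longrightarrow> \<exists>l\<in>?\<Lambda>. f = l \<odot>\<^bsub>dual_gmod n\<^esub> ?e M"
          using dual_eq_smult_socle_functional[OF n_pos f] by blast
        have "\<exists>q\<in>carrier (obj P m). frag_of s - frag_of (0, ?e M, q) \<in> ?J m" if M: "M0 \<le> M" for M
        proof -
          obtain l where l: "l \<in> ?\<Lambda>" "f = l \<odot>\<^bsub>dual_gmod n\<^esub> ?e M" using M0[OF M] by blast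
          then show ?thesis
            using J_balanced[of l ?\<Lambda> "?e M" 0 q m] e q s True
            by (intro bexI[of _ "l \<odot>\<^bsub>obj P m\<^esub> q"]) (simp_all add: obj_dual_complex del: dual_gmod_simps)
        qed
        then show ?thesis by blast
      next
        case False
        then have "f = \<zero>\<^bsub>obj (dual_complex n) p\<^esub>" using s(2) obj_dual_complex(2)[OF False] by blast
        then have "frag_of s \<in> ?J m" using s J_zero_left by simp
        moreover have "frag_of (0, ?e M, \<zero>\<^bsub>obj P m\<^esub>) \<in> ?J m" for M
          using J_zero_right[OF e, of M m ?\<Lambda>] by simp
        ultimately have "frag_of s - frag_of (0, ?e M, \<zero>\<^bsub>obj P m\<^esub>) \<in> ?J m" for M
          by (rule subgp_diff[OF sg])
        then show ?thesis by (intro exI[of _ 0] allI impI bexI[of _ "\<zero>\<^bsub>obj P m\<^esub>"]) auto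
      qed
    next
      case (diff a b)
      then obtain Ma Mb where M: "\<And>M. Ma \<le> M \<Longrightarrow> \<exists>q\<in>carrier (obj P m). a - frag_of (0, ?e M, q) \<in> ?J m"
        "\<And>M. Mb \<le> M \<Longrightarrow> \<exists>q\<in>carrier (obj P m). b - frag_of (0, ?e M, q) \<in> ?J m" by blast
      have "\<exists>q\<in>carrier (obj P m). a - b - frag_of (0, ?e M, q) \<in> ?J m" if M': "max Ma Mb \<le> M" for M
      proof -
        obtain q q' where q: "q \<in> carrier (obj P m)" "q' \<in> carrier (obj P m)"
          "a - frag_of (0, ?e M, q) \<in> ?J m" "b - frag_of (0, ?e M, q') \<in> ?J m"
          using M[of M] M' by auto
        let ?q = "q \<ominus>\<^bsub>obj P m\<^esub> q'"
        have qc: "?q \<in> carrier (obj P m)" using q by simp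
        have "frag_of (0, ?e M, ?q \<oplus>\<^bsub>obj P m\<^esub> q') - frag_of (0, ?e M, ?q) - frag_of (0, ?e M, q') \<in> ?J m"
          using J_add_right[OF e, of ?q m q' M ?\<Lambda>] q qc by simp
        moreover have "?q \<oplus>\<^bsub>obj P m\<^esub> q' = q"
          using q by (simp add: a_minus_def P.M.a_assoc P.M.l_neg)
        ultimately have "frag_of (0, ?e M, q) - frag_of (0, ?e M, ?q) - frag_of (0, ?e M, q') \<in> ?J m" by simp
        from subgp_add[OF sg subgp_diff[OF sg q(3,4)] this]
        show ?thesis using qc by (intro bexI[of _ ?q]) (simp_all add: algebra_simps)
      qed
      then show ?case by blast
    qed
  qed
  have kills: "\<exists>M'\<ge>M. socle_elt n {M<..M'} \<odot>\<^bsub>obj P m\<^esub> q = \<zero>\<^bsub>obj P m\<^esub>"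
    if q: "q \<in> carrier (obj P m)" and qJ: "frag_of (0, ?e M, q) \<in> ?J m" for M q m
  proof -
    have zero: "?e M (free.coord m q b \<otimes>\<^bsub>Lambda n\<^esub> a) = 0" if a: "a \<in> ?\<Lambda>" for b a
    proof -
      \<comment> \<open>Multiplying \<open>f\<close> by a fixed coordinate of \<open>w\<close> and evaluating at \<open>a\<close> is balanced.\<close>
      define \<theta> where "\<theta> = (\<lambda>(p :: int, f, w). if p = 0 then f (free.coord m w b \<otimes>\<^bsub>Lambda n\<^esub> a) else (0 :: 'k))"
      have "linear_extension \<theta> (frag_of (0, ?e M, q)) \<in> {0}"
      proof (rule additive_balanced_kernel[OF qJ additive_linear_extension])
        show "linear_extension \<theta> (frag_of (p, f, w \<oplus>\<^bsub>obj P (m - p)\<^esub> w')) - linear_extension \<theta> (frag_of (p, f, w)) -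
            linear_extension \<theta> (frag_of (p, f, w')) \<in> {0}"
          if "f \<in> carrier (obj (dual_complex n) p)" "w \<in> carrier (obj P (m - p))" "w' \<in> carrier (obj P (m - p))" for p f w w'
          using that a by (auto simp: \<theta>_def obj_dual_complex free.coord_add E.M.R.l_distr dual_carrier_add)
        show "linear_extension \<theta> (frag_of (p, l \<odot>\<^bsub>obj (dual_complex n) p\<^esub> f, w)) -
            linear_extension \<theta> (frag_of (p, f, l \<odot>\<^bsub>obj P (m - p)\<^esub> w)) \<in> {0}"
          if "l \<in> ?\<Lambda>" "f \<in> carrier (obj (dual_complex n) p)" "w \<in> carrier (obj P (m - p))" for p l f w
          using that a by (auto simp: \<theta>_def obj_dual_complex free.coord_smult E.M.R.m_assoc)
      qed (use a in \<open>auto simp: \<theta>_def obj_dual_complex subgp_def\<close>)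
      then show ?thesis by (simp add: \<theta>_def)
    qed
    obtain A where A: "finite A" "\<And>b. b \<notin> A \<Longrightarrow> free.coord m q b = \<zero>\<^bsub>Lambda n\<^esub>"
      using free.coord_finite[OF q] by blast
    have "\<forall>b. \<exists>M0. \<forall>M'\<ge>M0. socle_elt n {M<..M'} \<otimes>\<^bsub>Lambda n\<^esub> free.coord m q b = \<zero>\<^bsub>Lambda n\<^esub>"
      using socle_elt_kills_annihilator[OF n_pos free.coord_closed[OF q] zero] by blast
    then obtain M0 where M0: "\<And>b M'. M0 b \<le> M' \<Longrightarrow> socle_elt n {M<..M'} \<otimes>\<^bsub>Lambda n\<^esub> free.coord m q b = \<zero>\<^bsub>Lambda n\<^esub>"
      by metis
    define M' where "M' = Max (insert M (M0 ` A))"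
    have M': "M \<le> M'" "\<And>b. b \<in> A \<Longrightarrow> M0 b \<le> M'" using A(1) by (auto simp: M'_def)
    have "socle_elt n {M<..M'} \<odot>\<^bsub>obj P m\<^esub> q = \<zero>\<^bsub>obj P m\<^esub>"
    proof (rule free.eq_if_coord_eq[of _ m])
      fix b
      show "free.coord m (socle_elt n {M<..M'} \<odot>\<^bsub>obj P m\<^esub> q) b = free.coord m \<zero>\<^bsub>obj P m\<^esub> b"
        using M0[OF M'(2)] A(2) q by (cases "b \<in> A") (simp_all add: free.coord_smult free.coord_zero)
    qed (use q in simp_all)
    then show ?thesis using M'(1) by blast
  qed
  have D_single: "D m (frag_of (0, ?e M, q)) - frag_of (0, ?e M, bd P m q) \<in> ?J (m + 1)"
    if "q \<in> carrier (obj P m)" for q m M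
    using J_zero_left[of q "m + 1" 1 ?\<Lambda>] that by (simp add: formal_bd_of obj_dual_complex)
  show ?thesis
    unfolding acyclic_mod_def
  proof (intro allI ballI impI)
    fix m z assume z: "z \<in> X m" "D m z \<in> ?J (m + 1)"
    obtain M q where q: "q \<in> carrier (obj P m)" "z - frag_of (0, ?e M, q) \<in> ?J m"
      using single[OF z(1)] by blast
    have "D m z - D m (frag_of (0, ?e M, q)) \<in> ?J (m + 1)"
      using D_J[OF order.refl q(2)] by (simp add: D.diff)
    then have "D m (frag_of (0, ?e M, q)) \<in> ?J (m + 1)" using z(2) subgp_cong[OF sg] by blast
    then have "frag_of (0, ?e M, bd P m q) \<in> ?J (m + 1)"
      using D_single[OF q(1), of M] subgp_cong[OF sg] by blast
    then obtain M1 where M1: "M \<le> M1" "socle_elt n {M<..M1} \<odot>\<^bsub>obj P (m + 1)\<^esub> bd P m q = \<zero>\<^bsub>obj P (m + 1)\<^esub>"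
      using kills q(1) P.bd_closed by blast
    define q1 where "q1 = socle_elt n {M<..M1} \<odot>\<^bsub>obj P m\<^esub> q"
    have q1: "q1 \<in> cocycles P m" using M1 q by (simp add: q1_def cocycles_def)
    then have q1c: "q1 \<in> carrier (obj P m)" by (simp add: cocycles_def)
    obtain M2 where M2: "M1 \<le> M2" "socle_elt n {M1<..M2} \<odot>\<^bsub>obj P m\<^esub> q1 \<in> coboundaries P m"
      using bound[OF q1] by blast
    then obtain w where w: "w \<in> carrier (obj P (m - 1))" "socle_elt n {M1<..M2} \<odot>\<^bsub>obj P m\<^esub> q1 = bd P (m - 1) w"
      unfolding coboundaries_def by auto
    have "z - frag_of (0, ?e M1, q1) \<in> ?J m"
      using subgp_trans[OF sg q(2) shift[OF M1(1) q(1)]] by (simp add: q1_def)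
    from subgp_trans[OF sg this shift[OF M2(1) q1c]]
    have "z - frag_of (0, ?e M2, bd P (m - 1) w) \<in> ?J m" by (simp add: w(2))
    moreover have "frag_of (0, ?e M2, bd P (m - 1) w) - D (m - 1) (frag_of (0, ?e M2, w)) \<in> ?J m"
      using subgp_minus[OF sg D_single[OF w(1), of M2]] by simp
    ultimately have "z - D (m - 1) (frag_of (0, ?e M2, w)) \<in> ?J m"
      by (rule subgp_trans[OF sg])
    moreover have "frag_of (0, ?e M2, w) \<in> X (m - 1)" using e w by simp
    ultimately show "\<exists>u\<in>X (m - 1). z - D (m - 1) u \<in> ?J m" by blast
  qed
qed

text \<open>
  An element of a generated subgroup is a combination of finitely many generators, and each relator
  involves at most one variable.
\<close>

lemma balanced_kernel_finite_variables:
  assumes "z \<in> balanced_kernel (subring_gens n {M<..}) X Y m"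
  shows "\<exists>M'\<ge>M. z \<in> balanced_kernel (subring_gens n {M<..M'}) X Y m"
proof -
  let ?A = "\<Union>M'\<in>{M..}. balanced_kernel (subring_gens n {M<..M'}) X Y m"
  have mono: "balanced_kernel (subring_gens n {M<..a}) X Y m \<subseteq> balanced_kernel (subring_gens n {M<..b}) X Y m"
    if "a \<le> b" for a b
    by (rule balanced_kernel_mono) (use that in \<open>auto simp: subring_gens_def\<close>)
  have A: "subgp ?A"
    unfolding subgp_def
  proof (intro conjI ballI)
    show "0 \<in> ?A" using subgp_zero[OF subgp_balanced_kernel] by (intro UN_I[of M]) auto
    fix a b assume "a \<in> ?A" "b \<in> ?A"
    then obtain i j where ij: "i \<ge> M" "a \<in> balanced_kernel (subring_gens n {M<..i}) X Y m"
      "j \<ge> M" "b \<in> balanced_kernel (subring_gens n {M<..j}) X Y m" by blast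
    have "a - b \<in> balanced_kernel (subring_gens n {M<..max i j}) X Y m"
      using ij mono[of i "max i j"] mono[of j "max i j"] by (intro subgp_diff[OF subgp_balanced_kernel]) auto
    then show "a - b \<in> ?A" using ij(1) by (intro UN_I[of "max i j"]) auto
  qed
  have "balanced_kernel (subring_gens n {M<..}) X Y m \<subseteq> ?A"
    unfolding balanced_kernel_def[of "subring_gens n {M<..}"]
  proof (rule group_closure_least[OF A], rule subsetI)
    fix r assume "r \<in> bilinear_relators X Y m \<union> balanced_relators (subring_gens n {M<..}) X Y m"
    then obtain M' where "M \<le> M'" "r \<in> bilinear_relators X Y m \<union> balanced_relators (subring_gens n {M<..M'}) X Y m"
    proof
      assume r: "r \<in> balanced_relators (subring_gens n {M<..}) X Y m"
      then obtain p l x y where l: "l \<in> subring_gens n {M<..}" and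
        rr: "r = frag_of (p, l \<odot>\<^bsub>obj X p\<^esub> x, y) - frag_of (p, x, l \<odot>\<^bsub>obj Y (m - p)\<^esub> y)"
          "x \<in> carrier (obj X p)" "y \<in> carrier (obj Y (m - p))"
        unfolding balanced_relators_def by blast
      have "\<exists>M'\<ge>M. l \<in> subring_gens n {M<..M'}"
      proof (cases "l \<in> range (Lambda_const n)")
        case False
        then obtain i where "M < i" "l = xvar n i" using l by (auto simp: subring_gens_def)
        then show ?thesis by (intro exI[of _ i]) (auto simp: subring_gens_def)
      qed (auto simp: subring_gens_def)
      then obtain M' where "M \<le> M'" "l \<in> subring_gens n {M<..M'}" by blast
      with rr show thesis by (intro that[of M']) (auto simp: balanced_relators_def)
    qed (use that[of M] in auto)
    then show "r \<in> ?A"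
      by (intro UN_I[of M']) (auto simp: balanced_kernel_def intro!: group_closure.base)
  qed
  then show ?thesis using assms by blast
qed

lemma free_module_if_semifree:
  assumes "semifree n P" obtains B where "\<And>j. free_module n (obj P j) (B j)"
proof -
  obtain B where B: "\<And>i. B i \<subseteq> (\<Union>d. piece (obj P i) d)" "\<And>i. lin_span n (obj P i) (B i) = carrier (obj P i)"
    "\<And>i. lin_indep n (obj P i) (B i)"
    using assms unfolding semifree_def by blast
  have c: "is_complex n P" using assms by (simp add: semifree_def)
  then have "lam_complex n P" by (rule lam_complex_if_is_complex)
  then have m: "Module.module (Lambda n) (obj P j)" for j by (rule lam_complex.module)
  have "piece (obj P j) d \<subseteq> carrier (obj P j)" for j d
    using c subgroup.subset[of "piece (obj P j) d" "add_monoid (obj P j)"]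
    by (auto simp: is_complex_def graded_module_def)
  then have "B j \<subseteq> carrier (obj P j)" for j
    by (intro order_trans[OF B(1)] UN_least)
  then have "free_module n (obj P j) (B j)" for j
    using B[of j] by (intro free_module.intro[OF m] free_module_axioms.intro)
  then show thesis by (rule that)
qed

text \<open>
  If \<open>I \<otimes> P\<close> has cohomology then some cocycle \<open>p\<close> of \<open>P\<close> survives multiplication by all socle
  elements in the variables after \<open>x\<^sub>M\<close>. Over the subring of these variables \<open>y \<otimes> p\<close> is then not a
  coboundary, for any nonzero class \<open>y\<close> of \<open>E\<close>, although descent makes that tensor product acyclic.
\<close>

lemma zero_dual_tensor_if_zero_tensor:
  fixes E :: "('k::field lam, 'e) gcomplex" and P :: "('k lam, 'b) gcomplex"
  assumes n_pos: "\<And>i. 1 \<le> i \<Longrightarrow> 0 < n i"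
    and E: "is_complex n E" "\<not> zero_in_D n E" and P: "semifree n P"
    and zero: "zero_in_D n (tensor_complex n E P)"
  shows "zero_in_D n (tensor_complex n (dual_complex n :: ('k lam, 'k lam \<Rightarrow> 'k) gcomplex) P)"
proof (rule ccontr)
  assume nonzero: "\<not> ?thesis"
  interpret E: lam_complex n E by (rule lam_complex_if_is_complex[OF E(1)])
  interpret P: lam_complex n P using P by (intro lam_complex_if_is_complex) (simp add: semifree_def)
  interpret I: lam_complex n "dual_complex n :: ('k lam, 'k lam \<Rightarrow> 'k) gcomplex" by (rule lam_complex_dual)
  interpret EP: tensor_pair n E P ..
  interpret IP: tensor_pair n "dual_complex n :: ('k lam, 'k lam \<Rightarrow> 'k) gcomplex" P ..
  obtain B where B: "\<And>j. free_module n (obj P j) (B j)"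
    using free_module_if_semifree[OF P] by blast
  have "\<zero>\<^bsub>obj E i\<^esub> \<in> cocycles E i" for i by (simp add: cocycles_def)
  then obtain i y where y: "y \<in> cocycles E i" "y \<notin> coboundaries E i"
    using E(2) unfolding zero_in_D_iff by blast
  obtain m p M where p: "p \<in> cocycles P m"
    and surv: "\<And>M'. M \<le> M' \<Longrightarrow> socle_elt n {M<..M'} \<odot>\<^bsub>obj P m\<^esub> p \<notin> coboundaries P m"
    using nonzero acyclic_dual_tensor[OF n_pos P.lam_complex_axioms B]
    unfolding IP.zero_in_D_tensor_iff by blast
  have "acyclic_mod EP.X (EP.J (subring_gens n {M<..})) EP.D"
  proof (rule EP.acyclic_mod_tail)
    fix i :: nat assume "1 \<le> i"
    then have "frobenius_form n i (obj P j) (free_module.coordwise n (obj P j) (B j) (top_coeff n i))" for j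
      using free_module.frobenius_form_coordwise[OF B] n_pos by blast
    then show "\<exists>\<epsilon>. \<forall>j. frobenius_form n i (obj P j) (\<epsilon> j)"
      by (intro exI[of _ "\<lambda>j. free_module.coordwise n (obj P j) (B j) (top_coeff n i)"]) blast
  qed (use zero EP.zero_in_D_tensor_iff in blast)
  moreover have "frag_of (i, y, p) \<in> EP.X (i + m)" using y p by (simp add: cocycles_def)
  moreover have "EP.D (i + m) (frag_of (i, y, p)) \<in> EP.J (subring_gens n {M<..}) (i + m + 1)"
  proof -
    have "y \<in> carrier (obj E i)" "p \<in> carrier (obj P m)" "bd E i y = \<zero>\<^bsub>obj E (i + 1)\<^esub>" "bd P m p = \<zero>\<^bsub>obj P (m + 1)\<^esub>"
      using y p by (simp_all add: cocycles_def)
    then show ?thesis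
      using EP.J_zero_left[of p "i + m + 1" "i + 1"] EP.J_zero_right[of y i "i + m + 1"]
      by (simp add: formal_bd_of add.commute[of m 1] subgp_add[OF subgp_balanced_kernel] subgp_diff[OF subgp_balanced_kernel])
  qed
  ultimately obtain u where u: "u \<in> EP.X (i + m - 1)"
    "frag_of (i, y, p) - EP.D (i + m - 1) u \<in> EP.J (subring_gens n {M<..}) (i + m)"
    unfolding acyclic_mod_def by blast
  obtain M' where M': "M \<le> M'" "frag_of (i, y, p) - EP.D (i + m - 1) u \<in> EP.J (subring_gens n {M<..M'}) (i + m)"
    using balanced_kernel_finite_variables[OF u(2)] by blast
  have "frag_of (i, y, p) \<in> EP.boundaries (subring_gens n {M<..M'}) (i + m)"
    unfolding EP.boundaries_def using u(1) M'(2) by blast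
  moreover have "{M<..M'} \<subseteq> {1..}" by auto
  ultimately have "socle_elt n {M<..M'} \<odot>\<^bsub>obj P m\<^esub> p \<in> coboundaries P m"
    using EP.socle_coboundary_if_tensor_boundary[of "{M<..M'}" y i p m] n_pos y p by blast
  then show False using surv M'(1) by blast
qed

section \<open>The dual is nonzero\<close>

text \<open>
  The free module of rank one, transported along an injection \<open>j\<close> with left inverse \<open>r\<close>: the elements
  of a resolution have a prescribed function type, which is not the type of \<open>\<Lambda>\<close>.
\<close>

definition Lambda_gmod :: "(nat \<Rightarrow> nat) \<Rightarrow> ('k::field lam \<Rightarrow> 'a) \<Rightarrow> ('a \<Rightarrow> 'k lam) \<Rightarrow> ('k lam, 'a) gmod" where
  "Lambda_gmod n j r =
     \<lparr>carrier = j ` carrier (Lambda n), monoid.mult = undefined, one = undefined,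
      ring.zero = j \<zero>\<^bsub>Lambda n\<^esub>, add = (\<lambda>x y. j (r x \<oplus>\<^bsub>Lambda n\<^esub> r y)),
      smult = (\<lambda>l x. j (l \<otimes>\<^bsub>Lambda n\<^esub> r x)), piece = (\<lambda>d. j ` Lambda_piece n d)\<rparr>"

definition homogeneous_part :: "int \<Rightarrow> 'k::field mpoly \<Rightarrow> 'k mpoly" where
  "homogeneous_part d p =
     (\<Sum>m\<in>{m \<in> keys p. int (mono_deg m) = d}. single m (lookup p m))"

lemma lookup_homogeneous_part:
  "lookup (homogeneous_part d p) m = (if int (mono_deg m) = d then lookup p m else 0)"
proof -
  have "lookup (homogeneous_part d p) m
      = (\<Sum>m'\<in>{m \<in> keys p. int (mono_deg m) = d}. if m = m' then lookup p m else 0)"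
    unfolding homogeneous_part_def lookup_sum by (intro sum.cong) (auto simp: lookup_single)
  then show ?thesis by (auto simp: in_keys_iff)
qed

lemma homogeneous_part_keys: "m \<in> keys (homogeneous_part d p) \<Longrightarrow> int (mono_deg m) = d"
  by (auto simp: in_keys_iff lookup_homogeneous_part split: if_splits)

lemma Lambda_pieceI: "(\<And>m. m \<in> keys p \<Longrightarrow> int (mono_deg m) = d) \<Longrightarrow> cls n p \<in> Lambda_piece n d"
  by (auto simp: Lambda_piece_eq)

context
  fixes n :: "nat \<Rightarrow> nat" and j :: "'k::field lam \<Rightarrow> 'a" and r :: "'a \<Rightarrow> 'k lam"
  assumes rj [simp]: "\<And>l. r (j l) = l"
begin

private abbreviation (input) "M \<equiv> Lambda_gmod n j r"

lemma Lambda_gmod_simps [simp]: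
  "carrier M = j ` carrier (Lambda n)" "\<zero>\<^bsub>M\<^esub> = j \<zero>\<^bsub>Lambda n\<^esub>"
  "x \<oplus>\<^bsub>M\<^esub> y = j (r x \<oplus>\<^bsub>Lambda n\<^esub> r y)" "l \<odot>\<^bsub>M\<^esub> x = j (l \<otimes>\<^bsub>Lambda n\<^esub> r x)"
  "piece M d = j ` Lambda_piece n d"
  by (simp_all add: Lambda_gmod_def)

lemma j_eq_iff [simp]: "j l = j l' \<longleftrightarrow> l = l'"
  by (metis rj)

lemma module_Lambda_gmod: "Module.module (Lambda n) M"
proof -
  interpret R: cring "Lambda n :: 'k lam ring" by (rule cring_Lambda)
  have "abelian_group M"
  proof (rule abelian_groupI)
    fix x assume "x \<in> carrier M"
    then obtain l where "x = j l" "l \<in> carrier (Lambda n)" by auto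
    then show "\<exists>y\<in>carrier M. y \<oplus>\<^bsub>M\<^esub> x = \<zero>\<^bsub>M\<^esub>"
      by (intro bexI[of _ "j (\<ominus>\<^bsub>Lambda n\<^esub> l)"]) (simp_all add: R.l_neg)
  qed (auto simp: R.a_ac)
  then show ?thesis
    by (intro moduleI) (auto simp: cring_Lambda R.l_distr R.r_distr R.m_assoc)
qed

lemma finsum_Lambda_gmod:
  "finite D \<Longrightarrow> finsum M (\<lambda>d. j (cls n (f d))) D = j (cls n (\<Sum>d\<in>D. f d))"
proof (induction D rule: finite_induct)
  interpret Module.module "Lambda n" M by (rule module_Lambda_gmod)
  {
    case empty
    then show ?case using M.finsum_empty by (simp add: zero_Lambda)
  next
    case (insert d D)
    have "finsum M (\<lambda>d. j (cls n (f d))) (insert d D) = j (cls n (f d)) \<oplus>\<^bsub>M\<^esub> finsum M (\<lambda>d. j (cls n (f d))) D"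
      using insert by (intro M.finsum_insert) auto
    then show ?case using insert by (simp add: cls_add)
  }
qed

lemma subgroup_Lambda_piece: "subgroup (piece M d) (add_monoid M)"
proof -
  interpret Module.module "Lambda n" M by (rule module_Lambda_gmod)
  show ?thesis
  proof (rule group.subgroupI[OF M.a_group])
    show "piece M d \<subseteq> carrier (add_monoid M)" using Lambda_piece_subset by auto
    show "piece M d \<noteq> {}" by (auto simp: Lambda_piece_eq intro!: exI[of _ 0])
    fix x assume "x \<in> piece M d"
    then obtain p where p: "x = j (cls n p)" "\<forall>m\<in>keys p. int (mono_deg m) = d"
      by (auto simp: Lambda_piece_eq)
    have "j (cls n (- p)) \<oplus>\<^bsub>M\<^esub> x = \<zero>\<^bsub>M\<^esub>" by (simp add: p cls_add zero_Lambda)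
    then have "\<ominus>\<^bsub>M\<^esub> x = j (cls n (- p))"
      using p by (intro M.minus_equality) auto
    moreover have "\<forall>m\<in>keys (- p). int (mono_deg m) = d"
      using p(2) by (simp add: in_keys_iff)
    then have "j (cls n (- p)) \<in> piece M d" by (auto intro!: imageI Lambda_pieceI)
    ultimately have "\<ominus>\<^bsub>M\<^esub> x \<in> piece M d" by (simp only:)
    then show "inv\<^bsub>add_monoid M\<^esub> x \<in> piece M d" by (simp only: a_inv_def)
    fix y assume "y \<in> piece M d"
    then obtain q where q: "y = j (cls n q)" "\<forall>m\<in>keys q. int (mono_deg m) = d"
      by (auto simp: Lambda_piece_eq)
    have "\<forall>m\<in>keys (p + q). int (mono_deg m) = d"
      using p(2) q(2) keys_add[of p q] by blast
    then have "x \<oplus>\<^bsub>M\<^esub> y \<in> piece M d" by (simp add: p q cls_add imageI Lambda_pieceI)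
    then show "x \<otimes>\<^bsub>add_monoid M\<^esub> y \<in> piece M d" by simp
  qed
qed

text \<open>
  A decomposition into homogeneous parts is unique because the degrees of reduced monomials separate
  the coordinates of the parts.
\<close>

lemma graded_module_Lambda_gmod: "graded_module n M"
  unfolding graded_module_def
proof (intro conjI allI ballI)
  interpret Module.module "Lambda n" M by (rule module_Lambda_gmod)
  show "Module.module (Lambda n) M" by (rule module_Lambda_gmod)
  show "subgroup (piece M d) (add_monoid M)" for d by (rule subgroup_Lambda_piece)
  show "l \<odot>\<^bsub>M\<^esub> x \<in> piece M (e + d)" if lx: "l \<in> Lambda_piece n e" "x \<in> piece M d" for e d l x
  proof -
    obtain p where p: "l = cls n p" "\<forall>m\<in>keys p. int (mono_deg m) = e"
      using lx by (auto simp: Lambda_piece_eq)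
    obtain q where q: "x = j (cls n q)" "\<forall>m\<in>keys q. int (mono_deg m) = d"
      using lx by (auto simp: Lambda_piece_eq)
    have "\<forall>m\<in>keys (p * q). int (mono_deg m) = e + d"
    proof
      fix m assume "m \<in> keys (p * q)"
      then obtain a b where "m = a + b" "a \<in> keys p" "b \<in> keys q"
        using keys_mult[of p q] by blast
      then show "int (mono_deg m) = e + d" using p(2) q(2) by (simp add: mono_deg_add)
    qed
    then show ?thesis by (simp add: p q cls_mult imageI Lambda_pieceI)
  qed
  fix x assume "x \<in> carrier M"
  then obtain p where p: "x = j (cls n p)" by (auto elim: Lambda_cases)
  let ?P = "\<lambda>c. (\<forall>d. c d \<in> piece M d) \<and> finite {d. c d \<noteq> \<zero>\<^bsub>M\<^esub>} \<and> x = finsum M c {d. c d \<noteq> \<zero>\<^bsub>M\<^esub>}"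
  let ?c = "\<lambda>d. j (cls n (homogeneous_part d p))"
  show "\<exists>!c. ?P c"
  proof (rule ex1I[of _ ?c])
    have sub: "{d. ?c d \<noteq> \<zero>\<^bsub>M\<^esub>} \<subseteq> (\<lambda>m. int (mono_deg m)) ` keys p"
    proof
      fix d assume "d \<in> {d. ?c d \<noteq> \<zero>\<^bsub>M\<^esub>}"
      then obtain \<mu> where "lookup (homogeneous_part d p) \<mu> \<noteq> 0" by (auto simp: zero_Lambda cls_eq_iff)
      then show "d \<in> (\<lambda>m. int (mono_deg m)) ` keys p"
        by (auto simp: lookup_homogeneous_part in_keys_iff split: if_splits)
    qed
    then have fin: "finite {d. ?c d \<noteq> \<zero>\<^bsub>M\<^esub>}" by (rule finite_subset) simp
    have "lookup (\<Sum>d\<in>{d. ?c d \<noteq> \<zero>\<^bsub>M\<^esub>}. homogeneous_part d p) \<mu> = lookup p \<mu>"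
      if \<mu>: "reduced n \<mu>" for \<mu>
    proof -
      let ?d = "int (mono_deg \<mu>)"
      have "lookup p \<mu> = 0" if "?c ?d = \<zero>\<^bsub>M\<^esub>"
        using that \<mu> by (auto simp: zero_Lambda cls_eq_iff lookup_homogeneous_part)
      then show ?thesis
        unfolding lookup_sum lookup_homogeneous_part using fin by (auto simp: sum.delta')
    qed
    then have "x = finsum M ?c {d. ?c d \<noteq> \<zero>\<^bsub>M\<^esub>}"
      unfolding finsum_Lambda_gmod[OF fin] by (simp add: p cls_eq_iff)
    moreover have "?c d \<in> piece M d" for d
      by (simp add: imageI Lambda_pieceI homogeneous_part_keys)
    ultimately show "?P ?c" using fin by blast
    fix c assume c: "?P c"
    then have "\<forall>d. \<exists>q. c d = j (cls n q) \<and> (\<forall>m\<in>keys q. int (mono_deg m) = d)"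
      by (auto simp: Lambda_piece_eq image_iff)
    then obtain q where q: "\<And>d. c d = j (cls n (q d))" "\<And>d m. m \<in> keys (q d) \<Longrightarrow> int (mono_deg m) = d"
      by metis
    let ?D = "{d. c d \<noteq> \<zero>\<^bsub>M\<^esub>}"
    have finD: "finite ?D" and x: "x = finsum M c ?D" using c by blast+
    have "x = j (cls n (\<Sum>d\<in>?D. q d))"
      unfolding x q(1) by (rule finsum_Lambda_gmod) (use finD in \<open>simp only: q(1)\<close>)
    then have eq: "lookup p \<mu> = (\<Sum>d\<in>?D. lookup (q d) \<mu>)" if "reduced n \<mu>" for \<mu>
      using that by (simp add: p cls_eq_iff lookup_sum)
    have "lookup (q d) \<mu> = lookup (homogeneous_part d p) \<mu>" if \<mu>: "reduced n \<mu>" for d \<mu>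
    proof (cases "int (mono_deg \<mu>) = d")
      case True
      have "lookup (q d') \<mu> = (if d' = d then lookup (q d) \<mu> else 0)" for d'
        using q(2)[of \<mu> d'] True by (auto simp: in_keys_iff)
      then have "lookup p \<mu> = (\<Sum>d'\<in>?D. if d' = d then lookup (q d) \<mu> else 0)"
        using eq[OF \<mu>] by simp
      also have "\<dots> = (if d \<in> ?D then lookup (q d) \<mu> else 0)"
        using finD by simp
      also have "\<dots> = lookup (q d) \<mu>"
        using \<mu> q(1)[of d] by (auto simp: zero_Lambda cls_eq_iff)
      finally show ?thesis using True by (simp add: lookup_homogeneous_part)
    next
      case False
      then show ?thesis using q(2)[of \<mu> d] by (auto simp: lookup_homogeneous_part in_keys_iff)
    qed
    then show "c = ?c" by (intro ext) (simp add: q(1) cls_eq_iff)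
  qed
qed

end

lemma graded_module_zero_part:
  assumes "Module.module (Lambda n) M"
  shows "graded_module n (M\<lparr>carrier := {\<zero>\<^bsub>M\<^esub>}, piece := (\<lambda>_. {\<zero>\<^bsub>M\<^esub>})\<rparr>)"
proof -
  let ?Z = "M\<lparr>carrier := {\<zero>\<^bsub>M\<^esub>}, piece := (\<lambda>_. {\<zero>\<^bsub>M\<^esub>})\<rparr>"
  interpret M: Module.module "Lambda n" M by (rule assms)
  interpret Z: Module.module "Lambda n" ?Z by (rule module_zero_part[OF assms])
  have "subgroup {\<zero>\<^bsub>M\<^esub>} (add_monoid ?Z)"
    using Z.add.subgroup_self by simp
  moreover have "\<exists>!c. (\<forall>d. c d \<in> piece ?Z d) \<and> finite {d. c d \<noteq> \<zero>\<^bsub>?Z\<^esub>} \<and> x = finsum ?Z c {d. c d \<noteq> \<zero>\<^bsub>?Z\<^esub>}"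
    if "x \<in> carrier ?Z" for x
    using that Z.finsum_empty by (intro ex1I[of _ "\<lambda>_. \<zero>\<^bsub>M\<^esub>"]) auto
  moreover have "l \<odot>\<^bsub>?Z\<^esub> x \<in> piece ?Z (e + d)" if "l \<in> Lambda_piece n e" "x \<in> piece ?Z d" for l x e d
  proof -
    have "l \<in> carrier (Lambda n)" using that(1) Lambda_piece_subset by blast
    then show ?thesis using that(2) by simp
  qed
  ultimately show ?thesis
    unfolding graded_module_def using Z.module_axioms module_zero_part[OF assms] by auto
qed

lemma is_complex_stalk:
  assumes "graded_module n M" shows "is_complex n (stalk_complex M)"
proof -
  have "Module.module (Lambda n) M" using assms by (simp add: graded_module_def)
  then interpret Module.module "Lambda n" M .
  have gm: "graded_module n (obj (stalk_complex M) i)" for i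
    using assms graded_module_zero_part[OF module_axioms] by (simp add: obj_stalk_complex)
  have "\<zero>\<^bsub>M\<^esub> \<in> piece M d" for d
    using assms subgroup.one_closed[of "piece M d" "add_monoid M"] by (simp add: graded_module_def)
  then have "graded_hom n (obj (stalk_complex M) i) (obj (stalk_complex M) (i + 1)) (bd (stalk_complex M) i)" for i
    by (auto simp: graded_hom_def hom_def obj_stalk_complex)
  then show ?thesis
    using gm by (simp add: is_complex_def obj_stalk_complex)
qed

lemma zero_in_lin_span: "\<zero>\<^bsub>M\<^esub> \<in> lin_span n M S" if "abelian_group M" for M :: "('k::field lam, 'a) gmod"
proof -
  interpret abelian_group M by (rule that)
  show ?thesis unfolding lin_span_def by (auto intro!: exI[of _ "{}"])
qed

lemma semifree_Lambda:
  fixes j :: "'k::field lam \<Rightarrow> 'a"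
  assumes rj: "\<And>l. r (j l) = l"
  shows "semifree n (stalk_complex (Lambda_gmod n j r))"
proof -
  let ?M = "Lambda_gmod n j r"
  let ?P = "stalk_complex ?M"
  interpret R: cring "Lambda n :: 'k lam ring" by (rule cring_Lambda)
  interpret M: Module.module "Lambda n" ?M by (rule module_Lambda_gmod[of r j, OF rj])
  interpret P: lam_complex n ?P by (rule lam_complex_stalk[OF M.module_axioms])
  note simps = Lambda_gmod_simps[of r j n, OF rj] j_eq_iff[of r j, OF rj]
  define u where "u = j \<one>\<^bsub>Lambda n\<^esub>"
  have u: "u \<in> carrier ?M" "l \<odot>\<^bsub>?M\<^esub> u = j l" if "l \<in> carrier (Lambda n)" for l
    using that by (simp_all add: simps u_def rj)
  let ?B = "\<lambda>i :: int. if i = 0 then {u} else {}"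
  have sums: "(\<Oplus>\<^bsub>?M\<^esub>b\<in>A. c b \<odot>\<^bsub>?M\<^esub> b) = (if A = {} then \<zero>\<^bsub>?M\<^esub> else j (c u))"
    if "A \<subseteq> {u}" "c \<in> A \<rightarrow> carrier (Lambda n)" for A c
  proof (cases "A = {}")
    case False
    then have A: "A = {u}" using that by blast
    then have "(\<Oplus>\<^bsub>?M\<^esub>b\<in>A. c b \<odot>\<^bsub>?M\<^esub> b) = c u \<odot>\<^bsub>?M\<^esub> u"
      using that u(1)[of "c u"] by (simp del: simps)
    then show ?thesis using A that u(2)[of "c u"] by simp
  qed simp
  have span: "lin_span n ?M {u} = carrier ?M"
  proof
    show "lin_span n ?M {u} \<subseteq> carrier ?M"
    proof
      fix x assume "x \<in> lin_span n ?M {u}"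
      then obtain A c where A: "A \<subseteq> {u}" "c \<in> A \<rightarrow> carrier (Lambda n)" "x = (\<Oplus>\<^bsub>?M\<^esub>b\<in>A. c b \<odot>\<^bsub>?M\<^esub> b)"
        unfolding lin_span_def by blast
      then show "x \<in> carrier ?M" unfolding A(3) sums[OF A(1,2)] by (auto simp: simps)
    qed
    show "carrier ?M \<subseteq> lin_span n ?M {u}"
    proof
      fix x assume "x \<in> carrier ?M"
      then obtain l where l: "l \<in> carrier (Lambda n)" "x = j l" by (auto simp: simps)
      have "x = (\<Oplus>\<^bsub>?M\<^esub>b\<in>{u}. (\<lambda>_. l) b \<odot>\<^bsub>?M\<^esub> b)"
        by (subst sums) (use l in auto)
      then show "x \<in> lin_span n ?M {u}"
        unfolding lin_span_def using l by (intro CollectI exI[of _ "{u}"] exI[of _ "\<lambda>_. l"]) auto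
    qed
  qed
  have indep: "lin_indep n ?M {u}"
    unfolding lin_indep_def
  proof (intro allI impI ballI)
    fix A c b assume A: "finite A \<and> A \<subseteq> {u} \<and> c \<in> A \<rightarrow> carrier (Lambda n) \<and> (\<Oplus>\<^bsub>?M\<^esub>b\<in>A. c b \<odot>\<^bsub>?M\<^esub> b) = \<zero>\<^bsub>?M\<^esub>" "b \<in> A"
    then have "A \<noteq> {}" by blast
    then have "j (c u) = \<zero>\<^bsub>?M\<^esub>" "b = u" using A sums[of A c] by auto
    then show "c b = \<zero>\<^bsub>Lambda n\<^esub>" by (simp add: simps)
  qed
  have zspan: "lin_span n (obj ?P i) {} = carrier (obj ?P i)" if "i \<noteq> 0" for i
  proof -
    have "lin_span n (obj ?P i) {} = {\<zero>\<^bsub>obj ?P i\<^esub>}"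
      unfolding lin_span_def using P.M.finsum_empty[of i] by auto
    then show ?thesis using that by (simp add: obj_stalk_complex)
  qed
  have "cls n (1 :: 'k mpoly) \<in> Lambda_piece n 0"
    by (rule Lambda_pieceI) (simp add: mono_deg_def)
  then have piece: "u \<in> piece ?M 0"
    unfolding u_def by (simp add: simps one_Lambda)
  have cx: "is_complex n ?P" by (rule is_complex_stalk[OF graded_module_Lambda_gmod[of r j, OF rj]])
  have all: "?B i \<subseteq> (\<Union>d. piece (obj ?P i) d) \<and> lin_span n (obj ?P i) (?B i) = carrier (obj ?P i) \<and>
      lin_indep n (obj ?P i) (?B i) \<and>
      (\<forall>b\<in>?B i. bd ?P i b \<in> lin_span n (obj ?P (i + 1)) {b' \<in> ?B (i + 1). (0::nat) < 0})" for i
  proof (cases "i = 0")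
    case True
    have "bd ?P i b = \<zero>\<^bsub>obj ?P (i + 1)\<^esub>" for b by (simp add: obj_stalk_complex)
    then have "bd ?P i b \<in> lin_span n (obj ?P (i + 1)) S" for b S
      using zero_in_lin_span[OF P.M.abelian_group_axioms] by simp
    then show ?thesis
      using True span indep piece by (auto simp: obj_stalk_complex(1))
  next
    case False
    then show ?thesis using zspan[OF False] by (auto simp: lin_indep_def)
  qed
  show ?thesis
    unfolding semifree_def
    by (rule conjI[OF cx], rule exI[of _ ?B], rule exI[of _ "\<lambda>_ _. 0"], rule allI, rule all)
qed

text \<open>
  \<open>\<Lambda>\<close> is its own resolution; the quasi-isomorphism only changes the injection along which \<open>\<Lambda>\<close> is
  transported.
\<close>

lemma semifree_resolution_Lambda:
  fixes j :: "'k::field lam \<Rightarrow> 'a" and j' :: "'k lam \<Rightarrow> 'b"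
  assumes rj: "\<And>l. r (j l) = l" and rj': "\<And>l. r' (j' l) = l"
  shows "semifree_resolution n (stalk_complex (Lambda_gmod n j r)) (stalk_complex (Lambda_gmod n j' r'))"
proof -
  let ?W = "stalk_complex (Lambda_gmod n j r)" and ?P = "stalk_complex (Lambda_gmod n j' r')"
  let ?f = "\<lambda>(_ :: int) x. j (r' x)"
  note simps = Lambda_gmod_simps[of r j n, OF rj] j_eq_iff[of r j, OF rj] rj rj'
  note simps' = Lambda_gmod_simps[of r' j' n, OF rj'] j_eq_iff[of r' j', OF rj']
  interpret W: lam_complex n ?W by (intro lam_complex_stalk module_Lambda_gmod rj)
  have "graded_hom n (obj ?P i) (obj ?W i) (?f i)" for i
    unfolding graded_hom_def obj_stalk_complex
    using cring.cring_simprules[OF cring_Lambda]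
    by (auto simp: hom_def simps simps')
  then have cm: "chain_map n ?P ?W ?f"
    by (auto simp: chain_map_def obj_stalk_complex simps simps')
  have coc: "cocycles ?P i = carrier (obj ?P i)" "cocycles ?W i = carrier (obj ?W i)" for i
    by (auto simp: cocycles_def obj_stalk_complex)
  have cob: "coboundaries ?P i = {\<zero>\<^bsub>obj ?P i\<^esub>}" "coboundaries ?W i = {\<zero>\<^bsub>obj ?W i\<^esub>}" for i
    unfolding coboundaries_def by (auto simp: obj_stalk_complex simps simps')
  have inj: "x = \<zero>\<^bsub>obj ?P i\<^esub>" if "x \<in> carrier (obj ?P i)" "?f i x = \<zero>\<^bsub>obj ?W i\<^esub>" for i x
    using that by (auto simp: obj_stalk_complex simps simps' split: if_splits)
  have surj: "\<exists>x\<in>carrier (obj ?P i). y \<ominus>\<^bsub>obj ?W i\<^esub> ?f i x = \<zero>\<^bsub>obj ?W i\<^esub>" if "y \<in> carrier (obj ?W i)" for i y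
  proof -
    have "\<exists>x\<in>carrier (obj ?P i). ?f i x = y"
      using that by (auto simp: obj_stalk_complex simps simps' split: if_splits)
    then obtain x where x: "x \<in> carrier (obj ?P i)" "?f i x = y" ..
    have "y \<ominus>\<^bsub>obj ?W i\<^esub> ?f i x = \<zero>\<^bsub>obj ?W i\<^esub>"
      unfolding x(2) using W.M.r_neg[OF that] by (simp add: a_minus_def)
    then show ?thesis using x(1) by blast
  qed
  have "quasi_iso n ?P ?W ?f"
    unfolding quasi_iso_def coc cob using cm inj surj by auto
  then show ?thesis
    unfolding semifree_resolution_def using semifree_Lambda[of r' j', OF rj'] by blast
qed

lemma lam_complex_zero: "lam_complex n (zero_complex :: ('k::field lam, unit) gcomplex)"
proof (rule lam_complex.intro)
  show "Module.module (Lambda n) (obj (zero_complex :: ('k lam, unit) gcomplex) i)" for i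
    by (rule moduleI) (auto simp: cring_Lambda zero_complex_def zero_gmod_def intro!: abelian_groupI)
qed (auto simp: zero_complex_def zero_gmod_def hom_def)

lemma zero_in_D_tensor_zero:
  assumes "lam_complex n P"
  shows "zero_in_D n (tensor_complex n (zero_complex :: ('k::field lam, unit) gcomplex) P)"
proof -
  interpret Z: lam_complex n "zero_complex :: ('k lam, unit) gcomplex" by (rule lam_complex_zero)
  interpret P: lam_complex n P by (rule assms)
  interpret tensor_pair n "zero_complex :: ('k lam, unit) gcomplex" P ..
  have "z \<in> J (carrier (Lambda n)) m" if "z \<in> X m" for z m
  proof (rule additive_formal_tensors[OF that _ subgp_balanced_kernel, where f = "\<lambda>z. z"])
    fix p y x assume "y \<in> carrier (obj P (m - p))"
    then show "frag_of (p, x, y) \<in> J (carrier (Lambda n)) m"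
      using J_zero_left[of y m p] by (metis old.unit.exhaust)
  qed (simp add: additive_def)
  then show ?thesis
    unfolding zero_in_D_tensor_iff acyclic_mod_def
    by (auto intro!: bexI[of _ 0] simp: D.zero subgp_zero subgp_formal_tensors)
qed

text \<open>
  Evaluation \<open>g \<otimes> q \<mapsto> g(f(q))\<close> kills coboundaries, because \<open>f\<close> is a chain map to a complex with zero
  differential. It takes the value 1 on the tensor of the functional that reads off the constant
  term with a cocycle over 1.
\<close>

lemma nonzero_dual_tensor_Lambda:
  fixes P :: "('k::field lam, 'b) gcomplex"
  assumes n_pos: "\<And>i. 1 \<le> i \<Longrightarrow> 0 < n i"
    and P: "lam_complex n P" and f: "quasi_iso n P (stalk_complex (Lambda_gmod n (\<lambda>l. l) (\<lambda>l. l))) f"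
  shows "\<not> zero_in_D n (tensor_complex n (dual_complex n :: ('k lam, 'k lam \<Rightarrow> 'k) gcomplex) P)"
proof
  let ?I = "dual_complex n :: ('k lam, 'k lam \<Rightarrow> 'k) gcomplex"
  let ?W = "stalk_complex (Lambda_gmod n (\<lambda>l. l) (\<lambda>l. l)) :: ('k lam, 'k lam) gcomplex"
  assume zero: "zero_in_D n (tensor_complex n ?I P)"
  interpret I: lam_complex n ?I by (rule lam_complex_dual)
  interpret P: lam_complex n P by (rule P)
  interpret tensor_pair n ?I P ..
  interpret R: cring "Lambda n :: 'k lam ring" by (rule cring_Lambda)
  note simps = Lambda_gmod_simps[of "\<lambda>l. l" "\<lambda>l. l" n, OF refl]
  interpret W: lam_complex n ?W by (intro lam_complex_stalk module_Lambda_gmod refl)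
  have cm: "chain_map n P ?W f" using f by (simp add: quasi_iso_def)
  have f_closed: "f 0 q \<in> carrier (Lambda n)" if "q \<in> carrier (obj P 0)" for q
    using cm that by (auto simp: chain_map_def graded_hom_def hom_def obj_stalk_complex simps dest!: spec[of _ 0])
  have f_add: "f 0 (q \<oplus>\<^bsub>obj P 0\<^esub> q') = f 0 q \<oplus>\<^bsub>Lambda n\<^esub> f 0 q'" if "q \<in> carrier (obj P 0)" "q' \<in> carrier (obj P 0)" for q q'
  proof -
    have "f 0 \<in> hom (add_monoid (obj P 0)) (add_monoid (obj ?W 0))" using cm by (simp add: chain_map_def graded_hom_def)
    from hom_mult[OF this, of q q'] that show ?thesis by (simp add: obj_stalk_complex simps)
  qed
  have f_smult: "f 0 (l \<odot>\<^bsub>obj P 0\<^esub> q) = l \<otimes>\<^bsub>Lambda n\<^esub> f 0 q" if "l \<in> carrier (Lambda n)" "q \<in> carrier (obj P 0)" for l q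
  proof -
    have "f 0 (l \<odot>\<^bsub>obj P 0\<^esub> q) = l \<odot>\<^bsub>obj ?W 0\<^esub> f 0 q" using cm that by (simp add: chain_map_def graded_hom_def)
    then show ?thesis by (simp add: obj_stalk_complex simps)
  qed
  have f_bd: "f 0 (bd P (- 1) q) = \<zero>\<^bsub>Lambda n\<^esub>" if "q \<in> carrier (obj P (- 1))" for q
  proof -
    have "f (- 1 + 1) (bd P (- 1) q) = bd ?W (- 1) (f (- 1) q)" using cm that unfolding chain_map_def by blast
    then show ?thesis by (simp add: obj_stalk_complex simps)
  qed
  have "\<one>\<^bsub>Lambda n\<^esub> \<in> cocycles ?W 0" by (simp add: cocycles_def obj_stalk_complex simps)
  then obtain x where x: "x \<in> cocycles P 0" "\<one>\<^bsub>Lambda n\<^esub> \<ominus>\<^bsub>obj ?W 0\<^esub> f 0 x \<in> coboundaries ?W 0"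
    using f unfolding quasi_iso_def by blast
  have xc: "x \<in> carrier (obj P 0)" "bd P 0 x = \<zero>\<^bsub>obj P 1\<^esub>" using x(1) by (simp_all add: cocycles_def)
  have "coboundaries ?W 0 = {\<zero>\<^bsub>obj ?W 0\<^esub>}"
    by (auto simp: coboundaries_def obj_stalk_complex)
  then have diff: "\<one>\<^bsub>Lambda n\<^esub> \<ominus>\<^bsub>obj ?W 0\<^esub> f 0 x = \<zero>\<^bsub>obj ?W 0\<^esub>" using x(2) by blast
  have c: "\<one>\<^bsub>Lambda n\<^esub> \<in> carrier (obj ?W 0)" "f 0 x \<in> carrier (obj ?W 0)"
    using f_closed[OF xc(1)] by (simp_all add: obj_stalk_complex simps)
  then have "\<one>\<^bsub>Lambda n\<^esub> = (\<one>\<^bsub>Lambda n\<^esub> \<ominus>\<^bsub>obj ?W 0\<^esub> f 0 x) \<oplus>\<^bsub>obj ?W 0\<^esub> f 0 x"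
    by (simp add: a_minus_def W.M.a_assoc W.M.l_neg)
  then have fx: "f 0 x = \<one>\<^bsub>Lambda n\<^esub>" using c unfolding diff by simp
  let ?e = "socle_functional n 0 :: 'k lam \<Rightarrow> 'k"
  have e: "?e \<in> carrier (obj ?I 0)" using socle_functional_dual[OF n_pos] by (simp add: obj_dual_complex)
  let ?z = "frag_of (0, ?e, x)"
  have "?z \<in> X 0" using e xc by simp
  moreover have "D 0 ?z \<in> J (carrier (Lambda n)) 1"
    using J_zero_left[of x 1 1] J_zero_right[OF e, of 1] xc
    by (simp add: formal_bd_of obj_dual_complex subgp_add[OF subgp_balanced_kernel])
  ultimately obtain u where u: "u \<in> X (- 1)" "?z - D (- 1) u \<in> J (carrier (Lambda n)) 0"
    using zero unfolding zero_in_D_tensor_iff acyclic_mod_def by fastforce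
  define \<theta> where "\<theta> = (\<lambda>(p :: int, g, q). if p = 0 then g (f 0 q) else (0 :: 'k))"
  interpret \<theta>: additive "linear_extension \<theta>" by (rule additive_linear_extension)
  have "linear_extension \<theta> (?z - D (- 1) u) \<in> {0}"
    by (rule additive_balanced_kernel[OF u(2) additive_linear_extension])
      (auto simp: \<theta>_def obj_dual_complex f_closed f_add f_smult dual_carrier_add subgp_def)
  moreover have "linear_extension \<theta> (D (- 1) u) \<in> {0}"
  proof (rule additive_formal_tensors[OF u(1), where f = "\<lambda>u. linear_extension \<theta> (D (- 1) u)"])
    show "additive (\<lambda>u. linear_extension \<theta> (D (- 1) u))"
      by (simp add: additive_def D.add \<theta>.add)
    fix p g q assume gq: "g \<in> carrier (obj ?I p)" "q \<in> carrier (obj P (- 1 - p))"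
    have "\<theta> (p + 1, bd ?I p g, q) = 0"
      using gq f_closed[of q] by (cases "p = - 1") (auto simp: \<theta>_def obj_dual_complex)
    moreover have "\<theta> (p, g, bd P (- 1 - p) q) = 0"
      using gq f_bd[of q] by (cases "p = 0") (auto simp: \<theta>_def obj_dual_complex dual_carrier_zero)
    ultimately show "linear_extension \<theta> (D (- 1) (frag_of (p, g, q))) \<in> {0}"
      by (simp add: formal_bd_of \<theta>.add \<theta>.minus)
  qed (simp add: subgp_def)
  ultimately have "linear_extension \<theta> ?z = 0" by (simp add: \<theta>.diff)
  moreover have "?e \<one>\<^bsub>Lambda n\<^esub> = 1"
    by (simp add: one_Lambda socle_functional_cls[OF n_pos] socle_def)
  ultimately show False by (simp add: \<theta>_def fx)
qed

theorem corollary7p3: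
  fixes n :: "nat \<Rightarrow> nat"
  assumes "countable (UNIV :: 'k::field set)"
    and "\<forall>i\<ge>1. n i \<ge> 2"
  shows "(bousfield_class n (dual_complex n :: ('k lam, 'k lam \<Rightarrow> 'k) gcomplex) ::
            ('k lam, 'k lam) gcomplex set) \<noteq> bousfield_class n zero_complex \<and>
         (\<forall>E :: ('k lam, 'e) gcomplex. is_complex n E \<and> \<not> zero_in_D n E \<longrightarrow>
            (bousfield_class n E :: ('k lam, 'w) gcomplex set) \<subseteq> bousfield_class n (dual_complex n))"
proof (intro conjI allI impI)
  have n_pos: "0 < n i" if "1 \<le> i" for i using assms(2) that by fastforce
  let ?W = "stalk_complex (Lambda_gmod n (\<lambda>l. l) (\<lambda>l. l)) :: ('k lam, 'k lam) gcomplex"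
  let ?P = "stalk_complex (Lambda_gmod n (\<lambda>l _. l) (\<lambda>g. g undefined)) :: ('k lam, monomial list \<times> 'k lam \<Rightarrow> 'k lam) gcomplex"
  have "is_complex n ?W" by (intro is_complex_stalk graded_module_Lambda_gmod) simp
  moreover have res: "semifree_resolution n ?W ?P" by (rule semifree_resolution_Lambda) simp_all
  moreover have "zero_in_D n (tensor_complex n (zero_complex :: ('k lam, unit) gcomplex) ?P)"
    by (intro zero_in_D_tensor_zero lam_complex_stalk module_Lambda_gmod) simp
  ultimately have "?W \<in> bousfield_class n (zero_complex :: ('k lam, unit) gcomplex)"
    unfolding bousfield_class_def is_derived_tensor_def by blast
  moreover have "?W \<notin> bousfield_class n (dual_complex n :: ('k lam, 'k lam \<Rightarrow> 'k) gcomplex)"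
  proof
    assume "?W \<in> bousfield_class n (dual_complex n :: ('k lam, 'k lam \<Rightarrow> 'k) gcomplex)"
    then obtain P :: "('k lam, monomial list \<times> 'k lam \<Rightarrow> 'k lam) gcomplex" and f
      where P: "semifree n P" "quasi_iso n P ?W f"
        "zero_in_D n (tensor_complex n (dual_complex n :: ('k lam, 'k lam \<Rightarrow> 'k) gcomplex) P)"
      unfolding bousfield_class_def is_derived_tensor_def semifree_resolution_def by blast
    have "lam_complex n P" using P(1) by (intro lam_complex_if_is_complex) (simp add: semifree_def)
    from nonzero_dual_tensor_Lambda[OF n_pos this P(2)] P(3) show False by blast
  qed
  ultimately show "(bousfield_class n (dual_complex n :: ('k lam, 'k lam \<Rightarrow> 'k) gcomplex) ::
      ('k lam, 'k lam) gcomplex set) \<noteq> bousfield_class n zero_complex"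
    by blast
  fix E :: "('k lam, 'e) gcomplex" assume E: "is_complex n E \<and> \<not> zero_in_D n E"
  show "(bousfield_class n E :: ('k lam, 'w) gcomplex set) \<subseteq> bousfield_class n (dual_complex n)"
  proof
    fix W :: "('k lam, 'w) gcomplex" assume "W \<in> bousfield_class n E"
    then obtain P :: "('k lam, monomial list \<times> 'w \<Rightarrow> 'k lam) gcomplex" where P: "is_complex n W"
      "semifree_resolution n W P" "zero_in_D n (tensor_complex n E P)"
      unfolding bousfield_class_def is_derived_tensor_def by blast
    then have "semifree n P" by (simp add: semifree_resolution_def)
    with E P(3) n_pos
    have "zero_in_D n (tensor_complex n (dual_complex n :: ('k lam, 'k lam \<Rightarrow> 'k) gcomplex) P)"
      by (intro zero_dual_tensor_if_zero_tensor) auto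
    then show "W \<in> bousfield_class n (dual_complex n)"
      using P unfolding bousfield_class_def is_derived_tensor_def by blast
  qed
qed

end
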